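(* Let $\Bbbk$ be an algebraically closed field, let $Q$ be a finite quiver without oriented cycles, and let $A=\Bbbk Q$ be its path algebra, with vertex simples $S_1,\dots,S_k$. Let $w=S_{i_1}S_{i_2}\cdots S_{i_u}$ be a word in the $S_i$. Then $$\mathcal{O}^l_w=\bigcup_{w'}\tilde{\mathcal{A}}_{w'}\qquad\text{resp.}\qquad \mathcal{O}^r_w=\bigcup_{w'}\tilde{\mathcal{A}}_{w'},$$ where the union runs over all $\ast$-words $w'$ in the generators $R_i$ of the composition monoid $\mathcal{C}(Q)$ (with $\mathcal{A}_{w'}$ the corresponding element of $\mathcal{C}(Q)$) such that $w'$ can be rewritten, using the relations in $\mathcal{C}(Q)$, in the form $$w'=R_{i_1}\ast R_{i_2}\ast\cdots\ast R_{i_u}\ast w''\qquad\text{resp.}\qquad w'=w''\ast R_{i_1}\ast R_{i_2}\ast\cdots\ast R_{i_u}$$ for another (possibly empty) $\ast$-word $w''$.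
   Context: **Representations of $Q$.** $A=\Bbbk Q$ is finite dimensional hereditary; its simple representations are one-dimensional and correspond to the vertices $v_1,\dots,v_k$ of $Q$, $S_i$ being the simple at $v_i$. $\mathrm{rep}\,A=\bigsqcup_n\mathrm{rep}_nA$ is the set of all finite dimensional representations of $A$, with $\mathrm{rep}_nA$ the scheme of $n$-dimensional representations. For a dimension vector $\alpha$ of total dimension $|\alpha|$, $\mathrm{rep}_\alpha Q$ is the affine space of $\alpha$-dimensional representations of $Q$ with base-change action of $GL(\alpha)$, and $\mathrm{rep}_nA=\bigsqcup_{|\alpha|=n}GL_n\times^{GL(\alpha)}\mathrm{rep}_\alpha Q$. For a $GL(\alpha)$-stable subset $\mathcal{C}\subset\mathrm{rep}_\alpha Q$ with $|\alpha|=n$, $\tilde{\mathcal{C}}$ denotes the subset $GL_n\times^{GL(\alpha)}\mathcal{C}$ of $\mathrm{rep}_nA$. **Composition monoid.** $\mathcal{M}(Q)$ is the monoid whose elements are all irreducible closed $GL(\alpha)$-stable subvarieties of $\mathrm{rep}_\alpha Q$, for all dimension vectors $\alpha$, with product, for $\mathcal{A}\subset\mathrm{rep}_\alpha Q$ and $\mathcal{B}\subset\mathrm{rep}_\beta Q$, $$\mathcal{A}\ast\mathcal{B}=\{X\in\mathrm{rep}_{\alpha+\beta}Q\mid\text{there is an exact sequence }0\to M\to X\to N\to0\text{ with }M\in\mathcal{A},\ N\in\mathcal{B}\},$$ which is again an element of $\mathcal{M}(Q)$ (a known result of Reineke). The composition monoid $\mathcal{C}(Q)$ is the submonoid of $\mathcal{M}(Q)$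 generated by $R_i=\mathrm{rep}_{\delta_i}Q$, where $\delta_i$ is the dimension vector of $S_i$. A $\ast$-word is a formal product of the generators $R_i$; "can be rewritten using the relations in $\mathcal{C}(Q)$" means that the two $\ast$-words represent the same element of $\mathcal{C}(Q)$. For a $\ast$-word $w'$, $\mathcal{A}_{w'}$ is the subvariety it represents. **Basic opens.** The Zariski topology on the set $\{S_1,\dots,S_k\}$ of simples is discrete; the letter $S_i$ stands for the open set $\{S_i\}$. A Jordan–Hölder filtration of length $m$ on $M\in\mathrm{rep}\,A$ is a chain of subrepresentations $0=M_0\subset M_1\subset\cdots\subset M_m=M$ with simple quotients $\mathcal{F}_j=M_j/M_{j-1}$. For $w=S_{i_1}\cdots S_{i_u}$, $\mathcal{O}^l_w$ is the set of $M\in\mathrm{rep}\,A$ having a Jordan–Hölder filtration of some length $m\ge u$ with $\mathcal{F}_j\cong S_{i_j}$ for $1\le j\le u$; $\mathcal{O}^r_w$ is the set of $M\in\mathrm{rep}\,A$ having a Jordan–Hölder filtration of some length $m\ge u$ with $\mathcal{F}_{m-j}\cong S_{i_{u-j}}$ for $0\le j\le u-1$. *)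

theory Defs
  imports
    "HOL-Computational_Algebra.Polynomial"
    "HOL-Algebra.Module"
    "HOL-Algebra.AbelCoset"
    "Graph_Theory.Arc_Walk"
    "Jordan_Normal_Form.Matrix"
    "Jordan_Normal_Form.Matrix_Kernel"
begin

section \<open>The path algebra\<close>

text \<open>
  A path is a start vertex together with the list of its arrows in the order in which they are
  walked; the path with start \<open>v\<close> and no arrows is the idempotent at \<open>v\<close>.
  Elements of the path algebra are finitely supported functions on the set of paths.
  In a product \<open>p \<cdot> q\<close> of paths \<open>q\<close> is walked first (composition of maps), so that
  representations of the quiver are left modules.
\<close>

type_synonym ('v, 'a) path = "'v \<times> 'a list"
type_synonym ('v, 'a, 'k) path_alg = "('v, 'a) path \<Rightarrow> 'k"

definition acyclic_quiver :: "('v, 'a) pre_digraph \<Rightarrow> bool" where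
  "acyclic_quiver Q \<longleftrightarrow> \<not> (\<exists>c. pre_digraph.cycle Q c)"

definition paths :: "('v, 'a) pre_digraph \<Rightarrow> ('v, 'a) path set" where
  "paths Q = {(u, p). \<exists>v. pre_digraph.awalk Q u p v}"

definition path_end :: "('v, 'a) pre_digraph \<Rightarrow> ('v, 'a) path \<Rightarrow> 'v" where
  "path_end Q p = last (pre_digraph.awalk_verts Q (fst p) (snd p))"

definition path_algebra ::
    "('v, 'a) pre_digraph \<Rightarrow> ('k::field, ('v, 'a, 'k) path_alg) module" where
  "path_algebra Q = \<lparr>
     carrier = {x. finite {p. x p \<noteq> 0} \<and> {p. x p \<noteq> 0} \<subseteq> paths Q},
     mult = (\<lambda>x y r. \<Sum>(p, q) \<in> {(p, q). p \<in> paths Q \<and> q \<in> paths Q \<and>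
                 path_end Q q = fst p \<and> (fst q, snd q @ snd p) = r}. x p * y q),
     one = (\<lambda>p. of_bool (fst p \<in> verts Q \<and> snd p = [])),
     zero = (\<lambda>p. 0),
     add = (\<lambda>x y p. x p + y p),
     smult = (\<lambda>c x p. c * x p)\<rparr>"

section \<open>Modules over the path algebra\<close>

text \<open>
  A left \<open>A\<close>-module is stored in the record type \<^typ>\<open>('x, 'm) module\<close>, with
  \<^const>\<open>smult\<close> the action of the elements of \<open>A\<close>; the fields \<^const>\<open>mult\<close> and
  \<^const>\<open>one\<close> are irrelevant. (The locale \<^locale>\<open>Module.module\<close> itself is not available, since
  it requires a commutative ring.)
\<close>

definition quotient_module ::
    "('x, 'm) module \<Rightarrow> 'm set \<Rightarrow> ('x, 'm set) module" where
  "quotient_module M N = \<lparr>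
     carrier = a_rcosets\<^bsub>M\<^esub> N,
     mult = undefined,
     one = undefined,
     zero = N,
     add = (\<lambda>C D. C <+>\<^bsub>M\<^esub> D),
     smult = (\<lambda>x C. \<Union>c\<in>C. N +>\<^bsub>M\<^esub> (x \<odot>\<^bsub>M\<^esub> c))\<rparr>"

definition subquotient :: "('x, 'm) module \<Rightarrow> 'm set \<Rightarrow> 'm set \<Rightarrow> ('x, 'm set) module" where
  "subquotient M L N = quotient_module (M\<lparr>carrier := L\<rparr>) N"

definition simple_module :: "('x, 'r) ring_scheme \<Rightarrow> ('x, 'm) module \<Rightarrow> bool" where
  "simple_module A M \<longleftrightarrow> carrier M \<noteq> {\<zero>\<^bsub>M\<^esub>} \<and>
     (\<forall>N. Module.submodule N A M \<longrightarrow> N = {\<zero>\<^bsub>M\<^esub>} \<or> N = carrier M)"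

definition isomorphic_modules ::
    "('x, 'r) ring_scheme \<Rightarrow> ('x, 'm) module \<Rightarrow> ('x, 'n) module \<Rightarrow> bool" where
  "isomorphic_modules A M N \<longleftrightarrow> (\<exists>f. bij_betw f (carrier M) (carrier N) \<and>
     (\<forall>a\<in>carrier M. \<forall>b\<in>carrier M. f (a \<oplus>\<^bsub>M\<^esub> b) = f a \<oplus>\<^bsub>N\<^esub> f b) \<and>
     (\<forall>x\<in>carrier A. \<forall>a\<in>carrier M. f (x \<odot>\<^bsub>M\<^esub> a) = x \<odot>\<^bsub>N\<^esub> f a))"

text \<open>A chain \<open>0 = F 0 \<subset> F 1 \<subset> \<dots> \<subset> F m = M\<close> of submodules with simple quotients.\<close>

definition jh_filtration ::
    "('x, 'r) ring_scheme \<Rightarrow> ('x, 'm) module \<Rightarrow> nat \<Rightarrow> (nat \<Rightarrow> 'm set) \<Rightarrow> bool" where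
  "jh_filtration A M m F \<longleftrightarrow> F 0 = {\<zero>\<^bsub>M\<^esub>} \<and> F m = carrier M \<and>
     (\<forall>j\<le>m. Module.submodule (F j) A M) \<and>
     (\<forall>j\<in>{1..m}. F (j - 1) \<subset> F j \<and> simple_module A (subquotient M (F j) (F (j - 1))))"

section \<open>The finite dimensional representations of the path algebra\<close>

text \<open>
  The points of the scheme of \<open>n\<close>-dimensional representations are the homomorphisms of unital
  algebras from the path algebra to the \<open>n \<times> n\<close> matrices; \<open>rep_alg Q\<close> is the disjoint union
  over all \<open>n\<close>.
\<close>

type_synonym ('v, 'a, 'k) alg_rep = "('v, 'a, 'k) path_alg \<Rightarrow> 'k mat"

definition rep_n :: "('v, 'a) pre_digraph \<Rightarrow> nat \<Rightarrow> ('v, 'a, 'k::field) alg_rep set" where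
  "rep_n Q n = {\<rho> \<in> Ring.ring_hom (path_algebra Q) (ring_mat TYPE('k) n ()).
     \<rho> \<in> extensional (carrier (path_algebra Q)) \<and>
     (\<forall>c. \<forall>x\<in>carrier (path_algebra Q). \<rho> (c \<odot>\<^bsub>path_algebra Q\<^esub> x) = c \<cdot>\<^sub>m \<rho> x)}"

definition rep_alg :: "('v, 'a) pre_digraph \<Rightarrow> (nat \<times> ('v, 'a, 'k::field) alg_rep) set" where
  "rep_alg Q = (SIGMA n:UNIV. rep_n Q n)"

definition rep_module ::
    "nat \<times> ('v, 'a, 'k::field) alg_rep \<Rightarrow> (('v, 'a, 'k) path_alg, 'k vec) module" where
  "rep_module M = \<lparr>
     carrier = carrier_vec (fst M),
     mult = undefined,
     one = undefined,
     zero = 0\<^sub>v (fst M),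
     add = (+),
     smult = (\<lambda>x v. snd M x *\<^sub>v v)\<rparr>"

text \<open>
  The simple at \<open>i\<close> is one-dimensional: the idempotent at \<open>i\<close> acts as the identity, all other
  paths act as zero.
\<close>

definition vertex_simple ::
    "('v, 'a) pre_digraph \<Rightarrow> 'v \<Rightarrow> nat \<times> ('v, 'a, 'k::field) alg_rep" where
  "vertex_simple Q i = (1, \<lambda>x\<in>carrier (path_algebra Q). mat 1 1 (\<lambda>_. x (i, [])))"

definition has_simple_factor ::
    "('v, 'a) pre_digraph \<Rightarrow> nat \<times> ('v, 'a, 'k::field) alg_rep \<Rightarrow> (nat \<Rightarrow> 'k vec set)
      \<Rightarrow> nat \<Rightarrow> 'v \<Rightarrow> bool" where
  "has_simple_factor Q M F j i \<longleftrightarrow>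
     isomorphic_modules (path_algebra Q :: ('k, ('v, 'a, 'k) path_alg) module)
       (subquotient (rep_module M) (F j) (F (j - 1)))
       (rep_module (vertex_simple Q i))"

text \<open>The letters of a word \<open>w\<close> of length \<open>u\<close> are \<open>w ! 0, \<dots>, w ! (u - 1)\<close>.\<close>

definition left_open ::
    "('v, 'a) pre_digraph \<Rightarrow> 'v list \<Rightarrow> (nat \<times> ('v, 'a, 'k::field) alg_rep) set" where
  "left_open Q w = {M \<in> rep_alg Q. \<exists>m\<ge>length w. \<exists>F.
     jh_filtration (path_algebra Q :: ('k, ('v, 'a, 'k) path_alg) module) (rep_module M) m F \<and>
     (\<forall>j\<in>{1..length w}. has_simple_factor Q M F j (w ! (j - 1)))}"

definition right_open ::
    "('v, 'a) pre_digraph \<Rightarrow> 'v list \<Rightarrow> (nat \<times> ('v, 'a, 'k::field) alg_rep) set" where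
  "right_open Q w = {M \<in> rep_alg Q. \<exists>m\<ge>length w. \<exists>F.
     jh_filtration (path_algebra Q :: ('k, ('v, 'a, 'k) path_alg) module) (rep_module M) m F \<and>
     (\<forall>j<length w. has_simple_factor Q M F (m - j) (w ! (length w - 1 - j)))}"

section \<open>Representations of the quiver\<close>

text \<open>
  Dimension vectors vanish, and representations are \<^const>\<open>undefined\<close>, off the quiver, so that
  equality of dimension vectors and of representations is extensional equality.
\<close>

type_synonym ('a, 'k) quiver_rep = "'a \<Rightarrow> 'k mat"

definition dim_vectors :: "('v, 'a) pre_digraph \<Rightarrow> ('v \<Rightarrow> nat) set" where
  "dim_vectors Q = {\<alpha>. \<forall>v. v \<notin> verts Q \<longrightarrow> \<alpha> v = 0}"

definition total_dim :: "('v, 'a) pre_digraph \<Rightarrow> ('v \<Rightarrow> nat) \<Rightarrow> nat" where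
  "total_dim Q \<alpha> = (\<Sum>v\<in>verts Q. \<alpha> v)"

definition simple_dim :: "'v \<Rightarrow> 'v \<Rightarrow> nat" where
  "simple_dim i = (\<lambda>v. of_bool (v = i))"

definition rep_space ::
    "('v, 'a) pre_digraph \<Rightarrow> ('v \<Rightarrow> nat) \<Rightarrow> ('a, 'k::field) quiver_rep set" where
  "rep_space Q \<alpha> = (\<Pi>\<^sub>E a\<in>arcs Q. carrier_mat (\<alpha> (head Q a)) (\<alpha> (tail Q a)))"

abbreviation GL :: "'k::field itself \<Rightarrow> nat \<Rightarrow> 'k mat set" where
  "GL k n \<equiv> Units (ring_mat k n ())"

abbreviation GL_inv :: "nat \<Rightarrow> 'k::field mat \<Rightarrow> 'k mat" where
  "GL_inv n g \<equiv> inv\<^bsub>ring_mat TYPE('k) n ()\<^esub> g"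

definition base_change ::
    "('v, 'a) pre_digraph \<Rightarrow> ('v \<Rightarrow> nat) \<Rightarrow> ('v \<Rightarrow> 'k::field mat)
      \<Rightarrow> ('a, 'k) quiver_rep \<Rightarrow> ('a, 'k) quiver_rep" where
  "base_change Q \<alpha> g X =
     (\<lambda>a\<in>arcs Q. g (head Q a) * X a * GL_inv (\<alpha> (tail Q a)) (g (tail Q a)))"

definition quiver_hom ::
    "('v, 'a) pre_digraph \<Rightarrow> ('v \<Rightarrow> nat) \<Rightarrow> ('v \<Rightarrow> nat) \<Rightarrow> ('a, 'k::field) quiver_rep
      \<Rightarrow> ('a, 'k) quiver_rep \<Rightarrow> ('v \<Rightarrow> 'k mat) set" where
  "quiver_hom Q \<alpha> \<beta> X Y = {f \<in> (\<Pi> v\<in>verts Q. carrier_mat (\<beta> v) (\<alpha> v)).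
     \<forall>a\<in>arcs Q. f (head Q a) * X a = Y a * f (tail Q a)}"

text \<open>Exactness of \<open>0 \<rightarrow> M \<rightarrow> X \<rightarrow> N \<rightarrow> 0\<close> with dimension vectors \<open>\<alpha>\<close>, \<open>\<gamma>\<close>, \<open>\<beta>\<close>.\<close>

definition short_exact ::
    "('v, 'a) pre_digraph \<Rightarrow> ('v \<Rightarrow> nat) \<Rightarrow> ('v \<Rightarrow> nat) \<Rightarrow> ('v \<Rightarrow> nat)
      \<Rightarrow> ('a, 'k::field) quiver_rep \<Rightarrow> ('a, 'k) quiver_rep \<Rightarrow> ('a, 'k) quiver_rep
      \<Rightarrow> ('v \<Rightarrow> 'k mat) \<Rightarrow> ('v \<Rightarrow> 'k mat) \<Rightarrow> bool" where
  "short_exact Q \<alpha> \<gamma> \<beta> M X N f g \<longleftrightarrow>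
     f \<in> quiver_hom Q \<alpha> \<gamma> M X \<and> g \<in> quiver_hom Q \<gamma> \<beta> X N \<and>
     (\<forall>v\<in>verts Q.
        inj_on ((*\<^sub>v) (f v)) (carrier_vec (\<alpha> v)) \<and>
        (*\<^sub>v) (f v) ` carrier_vec (\<alpha> v) = mat_kernel (g v) \<and>
        (*\<^sub>v) (g v) ` carrier_vec (\<gamma> v) = carrier_vec (\<beta> v))"

section \<open>From representations of the quiver to representations of the path algebra\<close>

text \<open>
  \<open>vs\<close> enumerates the vertices; it fixes the order of the summands in the identification of
  \<open>\<Oplus>\<^sub>v k\<^bsup>\<alpha> v\<^esup>\<close> with \<open>k\<^bsup>n\<^esup>\<close>. The matrix \<open>block_incl Q vs \<alpha> v\<close> is the inclusion of the
  summand at \<open>v\<close>, its transpose is the projection.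
\<close>

definition block_incl ::
    "('v, 'a) pre_digraph \<Rightarrow> 'v list \<Rightarrow> ('v \<Rightarrow> nat) \<Rightarrow> 'v \<Rightarrow> 'k::field mat" where
  "block_incl Q vs \<alpha> v = mat (total_dim Q \<alpha>) (\<alpha> v)
     (\<lambda>(i, j). of_bool (i = sum_list (map \<alpha> (takeWhile (\<lambda>u. u \<noteq> v) vs)) + j))"

definition path_map :: "('v \<Rightarrow> nat) \<Rightarrow> ('a, 'k::field) quiver_rep \<Rightarrow> ('v, 'a) path \<Rightarrow> 'k mat" where
  "path_map \<alpha> X p = fold (\<lambda>a B. X a * B) (snd p) (1\<^sub>m (\<alpha> (fst p)))"

definition path_block ::
    "('v, 'a) pre_digraph \<Rightarrow> 'v list \<Rightarrow> ('v \<Rightarrow> nat) \<Rightarrow> ('a, 'k::field) quiver_rep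
      \<Rightarrow> ('v, 'a) path \<Rightarrow> 'k mat" where
  "path_block Q vs \<alpha> X p =
     block_incl Q vs \<alpha> (path_end Q p) * path_map \<alpha> X p *
     transpose_mat (block_incl Q vs \<alpha> (fst p))"

definition rep_of_quiver_rep ::
    "('v, 'a) pre_digraph \<Rightarrow> 'v list \<Rightarrow> ('v \<Rightarrow> nat) \<Rightarrow> ('a, 'k::field) quiver_rep
      \<Rightarrow> ('v, 'a, 'k) alg_rep" where
  "rep_of_quiver_rep Q vs \<alpha> X =
     (\<lambda>x\<in>carrier (path_algebra Q). mat (total_dim Q \<alpha>) (total_dim Q \<alpha>)
        (\<lambda>ij. \<Sum>p | x p \<noteq> 0. x p * path_block Q vs \<alpha> X p $$ ij))"

text \<open>
  The image of \<open>GL\<^sub>n \<times> C\<close>, equivalently of \<open>GL\<^sub>n \<times>\<^bsup>GL(\<alpha>)\<^esup> C\<close>, in the \<open>n\<close>-dimensional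
  representations under \<open>(g, X) \<mapsto> g X g\<^bsup>-1\<^esup>\<close>, for \<open>n\<close> the total dimension of \<open>\<alpha>\<close>.
\<close>

definition assoc_bundle ::
    "('v, 'a) pre_digraph \<Rightarrow> 'v list \<Rightarrow> ('v \<Rightarrow> nat) \<times> ('a, 'k::field) quiver_rep set
      \<Rightarrow> (nat \<times> ('v, 'a, 'k) alg_rep) set" where
  "assoc_bundle Q vs = (\<lambda>(\<alpha>, C).
     {(total_dim Q \<alpha>, \<lambda>x\<in>carrier (path_algebra Q).
         g * rep_of_quiver_rep Q vs \<alpha> X x * GL_inv (total_dim Q \<alpha>) g) |
       g X. g \<in> GL TYPE('k) (total_dim Q \<alpha>) \<and> X \<in> C})"

section \<open>The composition monoid\<close>

inductive_set polynomial_functions ::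
    "('v, 'a) pre_digraph \<Rightarrow> ('v \<Rightarrow> nat) \<Rightarrow> (('a, 'k::field) quiver_rep \<Rightarrow> 'k) set"
  for Q \<alpha> where
  const: "(\<lambda>X. c) \<in> polynomial_functions Q \<alpha>"
| coord: "a \<in> arcs Q \<Longrightarrow> i < \<alpha> (head Q a) \<Longrightarrow> j < \<alpha> (tail Q a) \<Longrightarrow>
    (\<lambda>X. X a $$ (i, j)) \<in> polynomial_functions Q \<alpha>"
| add: "f \<in> polynomial_functions Q \<alpha> \<Longrightarrow> g \<in> polynomial_functions Q \<alpha> \<Longrightarrow>
    (\<lambda>X. f X + g X) \<in> polynomial_functions Q \<alpha>"
| mult: "f \<in> polynomial_functions Q \<alpha> \<Longrightarrow> g \<in> polynomial_functions Q \<alpha> \<Longrightarrow>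
    (\<lambda>X. f X * g X) \<in> polynomial_functions Q \<alpha>"

definition zariski_closed ::
    "('v, 'a) pre_digraph \<Rightarrow> ('v \<Rightarrow> nat) \<Rightarrow> ('a, 'k::field) quiver_rep set \<Rightarrow> bool" where
  "zariski_closed Q \<alpha> Z \<longleftrightarrow>
     (\<exists>P \<subseteq> polynomial_functions Q \<alpha>. Z = {X \<in> rep_space Q \<alpha>. \<forall>f\<in>P. f X = 0})"

definition irreducible_closed ::
    "('v, 'a) pre_digraph \<Rightarrow> ('v \<Rightarrow> nat) \<Rightarrow> ('a, 'k::field) quiver_rep set \<Rightarrow> bool" where
  "irreducible_closed Q \<alpha> Z \<longleftrightarrow> zariski_closed Q \<alpha> Z \<and> Z \<noteq> {} \<and>
     (\<forall>Z1 Z2. zariski_closed Q \<alpha> Z1 \<and> zariski_closed Q \<alpha> Z2 \<and> Z = Z1 \<union> Z2 \<longrightarrow>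
        Z = Z1 \<or> Z = Z2)"

definition GL_stable ::
    "('v, 'a) pre_digraph \<Rightarrow> ('v \<Rightarrow> nat) \<Rightarrow> ('a, 'k::field) quiver_rep set \<Rightarrow> bool" where
  "GL_stable Q \<alpha> C \<longleftrightarrow>
     (\<forall>g \<in> (\<Pi> v\<in>verts Q. GL TYPE('k) (\<alpha> v)). \<forall>X\<in>C. base_change Q \<alpha> g X \<in> C)"

definition extension_product ::
    "('v, 'a) pre_digraph \<Rightarrow> ('v \<Rightarrow> nat) \<Rightarrow> ('v \<Rightarrow> nat) \<Rightarrow> ('a, 'k::field) quiver_rep set
      \<Rightarrow> ('a, 'k) quiver_rep set \<Rightarrow> ('a, 'k) quiver_rep set" where
  "extension_product Q \<alpha> \<beta> A B = {X \<in> rep_space Q (\<lambda>v. \<alpha> v + \<beta> v).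
     \<exists>M\<in>A. \<exists>N\<in>B. \<exists>f g. short_exact Q \<alpha> (\<lambda>v. \<alpha> v + \<beta> v) \<beta> M X N f g}"

text \<open>
  Elements are pairs of a dimension vector and a subset of its representation space; the
  dimension vector is kept because representation spaces of different dimension vectors may
  coincide as sets of matrix families, for instance if there are no arrows.
\<close>

type_synonym ('v, 'a, 'k) monoid_elem = "('v \<Rightarrow> nat) \<times> ('a, 'k) quiver_rep set"

definition extension_monoid ::
    "('v, 'a) pre_digraph \<Rightarrow> ('v, 'a, 'k::field) monoid_elem monoid" where
  "extension_monoid Q = \<lparr>
     carrier = {(\<alpha>, C). \<alpha> \<in> dim_vectors Q \<and> irreducible_closed Q \<alpha> C \<and> GL_stable Q \<alpha> C},
     mult = (\<lambda>(\<alpha>, A) (\<beta>, B). (\<lambda>v. \<alpha> v + \<beta> v, extension_product Q \<alpha> \<beta> A B)),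
     one = (\<lambda>v. 0, rep_space Q (\<lambda>v. 0))\<rparr>"

definition generator ::
    "('v, 'a) pre_digraph \<Rightarrow> 'v \<Rightarrow> ('v, 'a, 'k::field) monoid_elem" where
  "generator Q i = (simple_dim i, rep_space Q (simple_dim i))"

definition composition_monoid ::
    "('v, 'a) pre_digraph \<Rightarrow> ('v, 'a, 'k::field) monoid_elem monoid" where
  "composition_monoid Q = (extension_monoid Q)\<lparr>carrier :=
     \<Inter>{H. submonoid H (extension_monoid Q) \<and> generator Q ` verts Q \<subseteq> H}\<rparr>"

text \<open>A word in the generators is given by the list of its vertices.\<close>

definition word_value ::
    "('v, 'a) pre_digraph \<Rightarrow> 'v list \<Rightarrow> ('v, 'a, 'k::field) monoid_elem" where
  "word_value Q w = foldr (\<lambda>i y. generator Q i \<otimes>\<^bsub>composition_monoid Q\<^esub> y) w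
     \<one>\<^bsub>composition_monoid Q\<^esub>"

end

theory Submission
  imports Defs
begin

text \<open>
  Both sides of the claim are compared with one notion: a module of dimension \<open>n\<close> has a basis
  \<open>b\<^sub>0, \<dots>, b\<^sub>n\<^sub>-\<^sub>1\<close> in which every element \<open>x\<close> of the path algebra acts by an upper triangular matrix
  whose diagonal entry at \<open>j\<close> is the coefficient of \<open>x\<close> at the idempotent of the \<open>j\<close>-th letter of a word.
  The spans of the initial segments of such a basis form a Jordan--Hoelder filtration with these
  factors, and conversely every such filtration yields such a basis, which can be chosen to consist
  of vectors supported at single vertices. Restricted to the arrows, this says that a representation
  of the quiver is conjugate to a triangular one, and peeling off the first basis vector shows by
  induction on the word that these representations are the iterated extensions by the generators.
  Finally, in the absence of oriented cycles there are only finitely many paths, so every simple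
  subquotient is a vertex simple, and a filtration that is prescribed at one end can be completed to
  a whole word.
\<close>

text \<open>The two sides live in different frames: the monoid works vertex by vertex with
  GL(\<alpha>), the filtrations in one space k^n with GL_n, and \<open>block_incl\<close> orders
  coordinates by vertices while a word orders them by its letters. A triangular matrix makes sense
  only in the order of letters, so the passage between the two numberings is carried out once,
  together with the base change by GL(\<alpha>), and is absorbed into the factor GL_n of the
  associated bundle. Triangularity over the algebra would not suffice to return to the quiver: the
  basis must be homogeneous for the vertices. This is why diagonal idempotents are demanded, and why
  a vector spanning a factor is replaced by its image under the idempotent of the letter. The
  conventions agree because the left factor of a product is the subrepresentation, so that the first
  letter is the bottom of the filtration. Rewriting is harmless: a member of the union depends only
  on the value of its word, so it suffices to treat words that literally begin, or end, with
  \<open>w\<close>.\<close>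

section \<open>Invertible matrices over a field\<close>

text \<open>A one-sided inverse of a square matrix over a field is two-sided, so one product already
  yields both membership and the value of the inverse.\<close>

lemma GL_I:
  fixes A :: "'k::field mat"
  assumes "A \<in> carrier_mat n n" "B \<in> carrier_mat n n" "A * B = 1\<^sub>m n"
  shows "A \<in> GL TYPE('k) n" "GL_inv n A = B"
proof -
  interpret R: ring "ring_mat TYPE('k) n ()" by (rule ring_mat)
  have BA: "B * A = 1\<^sub>m n"
    using mat_mult_left_right_inverse assms by blast
  show A: "A \<in> GL TYPE('k) n"
    using assms BA unfolding Units_def ring_mat_simps by auto
  show "GL_inv n A = B"
    using R.inv_unique' assms BA unfolding ring_mat_simps by metis
qed

lemma
  fixes A :: "'k::field mat"
  assumes "A \<in> GL TYPE('k) n"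
  shows GL_carrier: "A \<in> carrier_mat n n"
    and GL_inv_carrier: "GL_inv n A \<in> carrier_mat n n"
    and GL_inv_right: "A * GL_inv n A = 1\<^sub>m n"
    and GL_inv_left: "GL_inv n A * A = 1\<^sub>m n"
proof -
  interpret R: ring "ring_mat TYPE('k) n ()" by (rule ring_mat)
  show "A \<in> carrier_mat n n" "GL_inv n A \<in> carrier_mat n n"
    "A * GL_inv n A = 1\<^sub>m n" "GL_inv n A * A = 1\<^sub>m n"
    using R.Units_closed[OF assms] R.Units_inv_closed[OF assms] R.Units_r_inv[OF assms]
      R.Units_l_inv[OF assms] by (simp_all add: ring_mat_simps)
qed

lemma GL_inv_inv:
  fixes A :: "'k::field mat"
  assumes "A \<in> GL TYPE('k) n"
  shows "GL_inv n A \<in> GL TYPE('k) n" "GL_inv n (GL_inv n A) = A"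
  using GL_I[OF GL_inv_carrier GL_carrier GL_inv_left, OF assms assms assms] by blast+

lemma GL_mult:
  fixes A B :: "'k::field mat"
  assumes A: "A \<in> GL TYPE('k) n" and B: "B \<in> GL TYPE('k) n"
  shows "A * B \<in> GL TYPE('k) n" "GL_inv n (A * B) = GL_inv n B * GL_inv n A"
proof -
  note c = GL_carrier[OF A] GL_carrier[OF B] GL_inv_carrier[OF A] GL_inv_carrier[OF B]
  have "A * B * (GL_inv n B * GL_inv n A) = A * (B * GL_inv n B) * GL_inv n A"
    using c by (simp add: assoc_mult_mat[of _ n n _ n _ n] mult_carrier_mat[of _ n n _ n])
  then have "A * B * (GL_inv n B * GL_inv n A) = 1\<^sub>m n"
    using c by (simp add: GL_inv_right[OF A] GL_inv_right[OF B])
  then show "A * B \<in> GL TYPE('k) n" "GL_inv n (A * B) = GL_inv n B * GL_inv n A"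
    using GL_I[of "A * B" n "GL_inv n B * GL_inv n A"] c by auto
qed

lemma mat_eqI_vec:
  fixes A :: "'k::field mat"
  assumes A: "A \<in> carrier_mat m n" and B: "B \<in> carrier_mat m n"
    and "\<And>v. v \<in> carrier_vec n \<Longrightarrow> A *\<^sub>v v = B *\<^sub>v v"
  shows "A = B"
proof (rule eq_matI)
  fix i j assume "i < dim_row B" "j < dim_col B"
  then have ij: "i < m" "j < n" using B by auto
  have *: "(C *\<^sub>v unit_vec n j) $ i = C $$ (i, j)" if "C \<in> carrier_mat m n" for C :: "'k mat"
  proof -
    have "row C i \<in> carrier_vec n" using that by auto
    then show ?thesis using that ij by (simp add: scalar_prod_right_unit)
  qed
  show "A $$ (i, j) = B $$ (i, j)"
    using assms(3)[of "unit_vec n j"] *[OF A] *[OF B] by simp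
qed (use assms in auto)

section \<open>The path algebra of an acyclic quiver and its basis of paths\<close>

abbreviation path_comp :: "('v, 'a) path \<Rightarrow> ('v, 'a) path \<Rightarrow> ('v, 'a) path" where
  "path_comp p q \<equiv> (fst q, snd q @ snd p)"

definition path_elem :: "('v, 'a) path \<Rightarrow> ('v, 'a, 'k::field) path_alg" where
  "path_elem p = (\<lambda>r. of_bool (r = p))"

lemma path_elem_apply: "path_elem p r = (if r = p then 1 else 0)"
  by (simp add: path_elem_def)

locale acyclic_fin_digraph = fin_digraph Q for Q :: "('v, 'a) pre_digraph" +
  assumes acyclic: "acyclic_quiver Q"
begin

abbreviation kQ :: "('k::field, ('v, 'a, 'k) path_alg) module" where
  "kQ \<equiv> path_algebra Q"

lemma no_closed_walk: "awalk u p u \<Longrightarrow> p = []"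
  using acyclic closed_w_imp_cycle unfolding acyclic_quiver_def closed_w_def by blast

lemma no_loop: "a \<in> arcs Q \<Longrightarrow> tail Q a \<noteq> head Q a"
  using no_closed_walk[of "tail Q a" "[a]"] arc_implies_awalk[of a] by auto

text \<open>A walk that visits a vertex twice contains a nonempty closed walk, which acyclicity
  excludes; so every walk has distinct vertices, and a finite digraph has only finitely many of
  those.\<close>

lemma finite_paths: "finite (paths Q)"
proof -
  have "paths Q \<subseteq> (\<lambda>(u, p, v). (u, p)) ` {(u, p, v). apath u p v}"
  proof
    fix r assume "r \<in> paths Q"
    then obtain u p v where r: "r = (u, p)" "awalk u p v" by (auto simp: paths_def)
    have "distinct (awalk_verts u p)"
      using awalk_not_distinct_decomp[OF r(2)] no_closed_walk by fastforce
    then have "apath u p v" using r by (simp add: apath_def)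
    then show "r \<in> (\<lambda>(u, p, v). (u, p)) ` {(u, p, v). apath u p v}"
      using r by (intro image_eqI[of _ _ "(u, p, v)"]) auto
  qed
  then show ?thesis by (rule finite_subset[OF _ finite_imageI[OF apaths_finite_triple]])
qed

lemma path_awalk: "p \<in> paths Q \<Longrightarrow> awalk (fst p) (snd p) (path_end Q p)"
  by (auto simp: paths_def path_end_def)

lemma paths_I: "awalk u p v \<Longrightarrow> (u, p) \<in> paths Q" "awalk u p v \<Longrightarrow> path_end Q (u, p) = v"
  by (auto simp: paths_def path_end_def)

lemma path_verts: "p \<in> paths Q \<Longrightarrow> fst p \<in> verts Q" "p \<in> paths Q \<Longrightarrow> path_end Q p \<in> verts Q"
  using path_awalk awalk_hd_in_verts awalk_last_in_verts by metis+

lemma trivial_path: "(u, []) \<in> paths Q \<longleftrightarrow> u \<in> verts Q" "path_end Q (u, []) = u"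
  by (auto simp: paths_def path_end_def awalk_Nil_iff awalk_verts.simps)

lemma arc_path:
  assumes "a \<in> arcs Q"
  shows "(tail Q a, [a]) \<in> paths Q" "path_end Q (tail Q a, [a]) = head Q a"
  using paths_I[OF arc_implies_awalk[OF assms]] by auto

lemma path_compI:
  assumes "p \<in> paths Q" "q \<in> paths Q" "path_end Q q = fst p"
  shows "path_comp p q \<in> paths Q" "path_end Q (path_comp p q) = path_end Q p"
proof -
  have "awalk (fst q) (snd q @ snd p) (path_end Q p)"
    using awalk_appendI[OF path_awalk[OF assms(2)] path_awalk[OF assms(1), folded assms(3)]] by simp
  from paths_I[OF this]
  show "path_comp p q \<in> paths Q" "path_end Q (path_comp p q) = path_end Q p" by auto
qed

text \<open>Finiteness of the support is automatic because there are finitely many paths in all;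
  from here on sums can run over the fixed finite set \<open>paths Q\<close>.\<close>

lemma carrier_path_algebra:
  "x \<in> carrier kQ \<longleftrightarrow> (\<forall>p. p \<notin> paths Q \<longrightarrow> x p = 0)"
proof -
  have "{p. x p \<noteq> 0} \<subseteq> paths Q \<longleftrightarrow> (\<forall>p. p \<notin> paths Q \<longrightarrow> x p = 0)" by blast
  then show ?thesis
    using finite_subset[OF _ finite_paths, of "{p. x p \<noteq> 0}"] by (auto simp: path_algebra_def)
qed

lemma add_path_algebra: "(x \<oplus>\<^bsub>kQ\<^esub> y) = (\<lambda>p. x p + y p)"
  by (simp add: path_algebra_def)

lemma smult_path_algebra: "(c \<odot>\<^bsub>kQ\<^esub> x) = (\<lambda>p. c * x p)"
  by (simp add: path_algebra_def)

lemma one_path_algebra: "\<one>\<^bsub>kQ\<^esub> = (\<lambda>p. of_bool (fst p \<in> verts Q \<and> snd p = []))"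
  by (simp add: path_algebra_def)

text \<open>A full double sum with an indicator, instead of a sum over composable pairs, can be
  exchanged freely with other summations.\<close>

lemma mult_path_algebra:
  "(x \<otimes>\<^bsub>kQ\<^esub> y) r =
     (\<Sum>p\<in>paths Q. \<Sum>q\<in>paths Q. if path_end Q q = fst p \<and> path_comp p q = r then x p * y q else 0)"
proof -
  have "(x \<otimes>\<^bsub>kQ\<^esub> y) r = (\<Sum>(p, q) \<in> {(p, q). p \<in> paths Q \<and> q \<in> paths Q \<and>
                 path_end Q q = fst p \<and> path_comp p q = r}. x p * y q)"
    by (simp add: path_algebra_def)
  also have "\<dots> = (\<Sum>(p, q) \<in> paths Q \<times> paths Q.
      if path_end Q q = fst p \<and> path_comp p q = r then x p * y q else 0)"
    by (rule sum.mono_neutral_cong_left) (auto simp: finite_paths split: if_splits)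
  finally show ?thesis by (simp add: sum.cartesian_product)
qed

lemma mult_path_elem:
  assumes "p \<in> paths Q" "q \<in> paths Q"
  shows "path_elem p \<otimes>\<^bsub>kQ\<^esub> path_elem q =
    (if path_end Q q = fst p then path_elem (path_comp p q) else (\<lambda>r. 0))"
proof
  fix r
  have "(path_elem p \<otimes>\<^bsub>kQ\<^esub> path_elem q) r =
     (\<Sum>p'\<in>paths Q. \<Sum>q'\<in>paths Q. if p' = p then if q' = q then
        if path_end Q q = fst p \<and> path_comp p q = r then 1 else 0 else 0 else 0)"
    unfolding mult_path_algebra by (intro sum.cong refl) (simp add: path_elem_apply)
  also have "\<dots> = (\<Sum>p'\<in>paths Q. if p' = p then \<Sum>q'\<in>paths Q. if q' = q then
        if path_end Q q = fst p \<and> path_comp p q = r then 1 else 0 else 0 else 0)"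
    by (intro sum.cong refl) auto
  also have "\<dots> = (if path_end Q q = fst p \<and> path_comp p q = r then 1 else 0)"
    using assms finite_paths by simp
  finally show "(path_elem p \<otimes>\<^bsub>kQ\<^esub> path_elem q) r =
    (if path_end Q q = fst p then path_elem (path_comp p q) else (\<lambda>r. 0)) r"
    by (auto simp: path_elem_def)
qed

lemma path_elem_carrier: "p \<in> paths Q \<Longrightarrow> path_elem p \<in> carrier kQ"
  by (auto simp: carrier_path_algebra path_elem_def)

lemma carrier_closed:
  fixes x :: "('v, 'a, 'k::field) path_alg"
  shows "(\<lambda>r. 0) \<in> carrier kQ"
    and "x \<in> carrier kQ \<Longrightarrow> y \<in> carrier kQ \<Longrightarrow>
      x \<oplus>\<^bsub>kQ\<^esub> y \<in> carrier kQ"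
    and "x \<in> carrier kQ \<Longrightarrow> c \<odot>\<^bsub>kQ\<^esub> x \<in> carrier kQ"
    and "\<one>\<^bsub>kQ\<^esub> \<in> carrier kQ"
    and "x \<otimes>\<^bsub>kQ\<^esub> y \<in> carrier kQ"
proof -
  show "x \<otimes>\<^bsub>kQ\<^esub> y \<in> carrier kQ"
    unfolding carrier_path_algebra
  proof (intro allI impI)
    fix r assume r: "r \<notin> paths Q"
    have *: "\<not> (path_end Q q = fst p \<and> path_comp p q = r)" if "p \<in> paths Q" "q \<in> paths Q" for p q
      using path_compI(1)[OF that] r by blast
    show "(x \<otimes>\<^bsub>kQ\<^esub> y) r = 0"
      unfolding mult_path_algebra by (intro sum.neutral ballI) (simp only: * if_False)
  qed
qed (auto simp: carrier_path_algebra add_path_algebra smult_path_algebra one_path_algebra trivial_path)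

subsection \<open>Finite dimensional representations as families of path matrices\<close>

text \<open>Restriction to the carrier makes the value extensional, as \<open>rep_n\<close> demands,
  so that a representation equals the linear extension of its values on paths as a function.\<close>

definition lin_ext :: "nat \<Rightarrow> (('v, 'a) path \<Rightarrow> 'k::field mat) \<Rightarrow> ('v, 'a, 'k) alg_rep" where
  "lin_ext n f = (\<lambda>x\<in>carrier kQ. mat n n (\<lambda>ij. \<Sum>p\<in>paths Q. x p * f p $$ ij))"

lemma rep_nD:
  assumes "\<rho> \<in> rep_n Q n"
  shows "\<And>x. x \<in> carrier kQ \<Longrightarrow> \<rho> x \<in> carrier_mat n n"
    and "\<And>x y. x \<in> carrier kQ \<Longrightarrow> y \<in> carrier kQ \<Longrightarrow>
        \<rho> (x \<otimes>\<^bsub>kQ\<^esub> y) = \<rho> x * \<rho> y"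
    and "\<And>x y. x \<in> carrier kQ \<Longrightarrow> y \<in> carrier kQ \<Longrightarrow>
        \<rho> (\<lambda>p. x p + y p) = \<rho> x + \<rho> y"
    and "\<And>c x. x \<in> carrier kQ \<Longrightarrow> \<rho> (\<lambda>p. c * x p) = c \<cdot>\<^sub>m \<rho> x"
    and "\<rho> \<one>\<^bsub>kQ\<^esub> = 1\<^sub>m n"
    and "\<rho> \<in> extensional (carrier kQ)"
  using assms unfolding rep_n_def Ring.ring_hom_def ring_mat_simps add_path_algebra smult_path_algebra
  by auto

lemma rep_nI:
  fixes \<rho> :: "('v, 'a, 'k::field) alg_rep"
  assumes "\<And>x. x \<in> carrier kQ \<Longrightarrow> \<rho> x \<in> carrier_mat n n"
    and "\<And>x y. x \<in> carrier kQ \<Longrightarrow> y \<in> carrier kQ \<Longrightarrow>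
        \<rho> (x \<otimes>\<^bsub>kQ\<^esub> y) = \<rho> x * \<rho> y"
    and "\<And>x y. x \<in> carrier kQ \<Longrightarrow> y \<in> carrier kQ \<Longrightarrow>
        \<rho> (\<lambda>p. x p + y p) = \<rho> x + \<rho> y"
    and "\<And>c x. x \<in> carrier kQ \<Longrightarrow> \<rho> (\<lambda>p. c * x p) = c \<cdot>\<^sub>m \<rho> x"
    and "\<rho> \<one>\<^bsub>kQ\<^esub> = 1\<^sub>m n"
    and "\<rho> \<in> extensional (carrier kQ)"
  shows "\<rho> \<in> rep_n Q n"
  using assms unfolding rep_n_def Ring.ring_hom_def ring_mat_simps add_path_algebra smult_path_algebra
  by auto

lemma rep_n_zero:
  assumes "\<rho> \<in> rep_n Q n"
  shows "\<rho> (\<lambda>p. 0) = 0\<^sub>m n n"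
proof -
  have "\<rho> (\<lambda>p. 0 * 0) = 0 \<cdot>\<^sub>m \<rho> (\<lambda>p. 0)"
    by (rule rep_nD(4)[OF assms carrier_closed(1)])
  also have "\<dots> = 0\<^sub>m n n"
    using rep_nD(1)[OF assms carrier_closed(1)] by (intro eq_matI) auto
  finally show ?thesis by simp
qed

text \<open>Splitting off one path is the common induction step behind expanding a representation
  along the basis of paths and behind testing, path by path, whether a vector is moved into an
  invariant subspace.\<close>

lemma rep_n_insert:
  assumes \<rho>: "\<rho> \<in> rep_n Q n" and S: "insert p S \<subseteq> paths Q" "p \<notin> S"
  shows "\<rho> (\<lambda>r. if r \<in> insert p S then x r else 0) =
    x p \<cdot>\<^sub>m \<rho> (path_elem p) + \<rho> (\<lambda>r. if r \<in> S then x r else 0)"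
proof -
  have p: "p \<in> paths Q" using S by simp
  let ?y = "\<lambda>r. x p * path_elem p r" and ?z = "\<lambda>r. if r \<in> S then x r else 0"
  have c: "?y \<in> carrier kQ" "?z \<in> carrier kQ"
    using path_elem_carrier[OF p] S by (auto simp: carrier_path_algebra)
  have "(\<lambda>r. if r \<in> insert p S then x r else 0) = (\<lambda>r. ?y r + ?z r)"
    using S(2) by (auto simp: path_elem_def)
  then show ?thesis
    using rep_nD(3)[OF \<rho> c] rep_nD(4)[OF \<rho> path_elem_carrier[OF p]] by simp
qed

lemma rep_n_lin_ext:
  assumes \<rho>: "\<rho> \<in> rep_n Q n"
  shows "\<rho> = lin_ext n (\<lambda>p. \<rho> (path_elem p))"
proof
  fix x
  show "\<rho> x = lin_ext n (\<lambda>p. \<rho> (path_elem p)) x"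
  proof (cases "x \<in> carrier kQ")
    case False
    then show ?thesis using rep_nD(6)[OF \<rho>] by (simp add: lin_ext_def extensional_def)
  next
    case True
    have *: "\<rho> (\<lambda>r. if r \<in> S then x r else 0) = mat n n (\<lambda>ij. \<Sum>p\<in>S. x p * \<rho> (path_elem p) $$ ij)"
      if "finite S" "S \<subseteq> paths Q" for S
      using that
    proof (induction S)
      case empty
      then show ?case using rep_n_zero[OF \<rho>] by (auto intro!: eq_matI)
    next
      case (insert p S)
      then have p: "p \<in> paths Q" by simp
      show ?case
        unfolding rep_n_insert[OF \<rho> insert.prems insert.hyps(2)]
        using insert rep_nD(1)[OF \<rho> path_elem_carrier[OF p]] by (auto intro!: eq_matI)
    qed
    have "(\<lambda>r. if r \<in> paths Q then x r else 0) = x"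
      using True by (auto simp: carrier_path_algebra)
    then show ?thesis using *[OF finite_paths] True by (simp add: lin_ext_def)
  qed
qed

lemma rep_n_eqI:
  assumes "\<rho> \<in> rep_n Q n" "\<sigma> \<in> rep_n Q n"
    and "\<And>p. p \<in> paths Q \<Longrightarrow> \<rho> (path_elem p) = \<sigma> (path_elem p)"
  shows "\<rho> = \<sigma>"
proof -
  have "lin_ext n (\<lambda>p. \<rho> (path_elem p)) = lin_ext n (\<lambda>p. \<sigma> (path_elem p))"
    unfolding lin_ext_def using assms(3) by (auto intro!: restrict_ext eq_matI sum.cong)
  then show ?thesis using rep_n_lin_ext[OF assms(1)] rep_n_lin_ext[OF assms(2)] by simp
qed

lemma lin_ext_path_elem:
  assumes "p \<in> paths Q" "f p \<in> carrier_mat n n"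
  shows "lin_ext n f (path_elem p) = f p"
proof -
  have "(\<Sum>r\<in>paths Q. path_elem p r * f r $$ ij) = f p $$ ij" for ij
  proof -
    have "(\<Sum>r\<in>paths Q. path_elem p r * f r $$ ij) = (\<Sum>r\<in>paths Q. if r = p then f r $$ ij else 0)"
      by (intro sum.cong) (auto simp: path_elem_def)
    then show ?thesis using assms finite_paths by simp
  qed
  then show ?thesis using assms path_elem_carrier[OF assms(1)] by (auto simp: lin_ext_def)
qed

lemma lin_ext_mult:
  fixes f :: "('v, 'a) path \<Rightarrow> 'k::field mat"
  assumes f: "\<And>p. p \<in> paths Q \<Longrightarrow> f p \<in> carrier_mat n n"
    and ff: "\<And>p q. p \<in> paths Q \<Longrightarrow> q \<in> paths Q \<Longrightarrow>
      f p * f q = (if path_end Q q = fst p then f (path_comp p q) else 0\<^sub>m n n)"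
    and x: "x \<in> carrier kQ" and y: "y \<in> carrier kQ"
  shows "lin_ext n f (x \<otimes>\<^bsub>kQ\<^esub> y) = lin_ext n f x * lin_ext n f y" (is "?l = ?r")
proof (rule eq_matI)
  fix i j assume "i < dim_row ?r" "j < dim_col ?r"
  then have ij: "i < n" "j < n" using x y by (auto simp: lin_ext_def)
  have "?r $$ (i, j) = (\<Sum>k<n. (\<Sum>p\<in>paths Q. x p * f p $$ (i, k)) * (\<Sum>q\<in>paths Q. y q * f q $$ (k, j)))"
    using x y ij by (simp add: lin_ext_def scalar_prod_def atLeast0LessThan)
  also have "\<dots> = (\<Sum>k<n. \<Sum>p\<in>paths Q. \<Sum>q\<in>paths Q. x p * y q * (f p $$ (i, k) * f q $$ (k, j)))"
    unfolding sum_product by (intro sum.cong refl) (simp add: algebra_simps)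
  also have "\<dots> = (\<Sum>p\<in>paths Q. \<Sum>q\<in>paths Q. \<Sum>k<n. x p * y q * (f p $$ (i, k) * f q $$ (k, j)))"
    by (subst sum.swap, rule sum.cong[OF refl], rule sum.swap)
  also have "\<dots> = (\<Sum>p\<in>paths Q. \<Sum>q\<in>paths Q. x p * y q * (f p * f q) $$ (i, j))"
    using ij f by (intro sum.cong refl) (auto simp: scalar_prod_def sum_distrib_left atLeast0LessThan carrier_matD[OF f])
  also have "\<dots> = (\<Sum>p\<in>paths Q. \<Sum>q\<in>paths Q. x p * y q *
      (if path_end Q q = fst p then f (path_comp p q) $$ (i, j) else 0))"
    using ff ij by (intro sum.cong refl) auto
  \<comment> \<open>A composable pair contributes to exactly one \<open>r\<close>, its composite;
    the extra summation produces the indicator form of \<open>mult_path_algebra\<close>.\<close>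
  also have "\<dots> = (\<Sum>p\<in>paths Q. \<Sum>q\<in>paths Q. \<Sum>r\<in>paths Q.
      (if path_end Q q = fst p \<and> path_comp p q = r then x p * y q else 0) * f r $$ (i, j))"
  proof (intro sum.cong refl)
    fix p q assume pq: "p \<in> paths Q" "q \<in> paths Q"
    show "x p * y q * (if path_end Q q = fst p then f (path_comp p q) $$ (i, j) else 0) =
      (\<Sum>r\<in>paths Q. (if path_end Q q = fst p \<and> path_comp p q = r then x p * y q else 0) * f r $$ (i, j))"
    proof (cases "path_end Q q = fst p")
      case True
      have "(\<Sum>r\<in>paths Q. (if path_end Q q = fst p \<and> path_comp p q = r then x p * y q else 0) * f r $$ (i, j))
        = (\<Sum>r\<in>paths Q. if path_comp p q = r then x p * y q * f r $$ (i, j) else 0)"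
        using True by (intro sum.cong) auto
      then show ?thesis using True path_compI(1)[OF pq True] finite_paths by simp
    qed simp
  qed
  also have "\<dots> = (\<Sum>r\<in>paths Q. (x \<otimes>\<^bsub>kQ\<^esub> y) r * f r $$ (i, j))"
    unfolding mult_path_algebra sum_distrib_right
    by (rule trans[OF sum.cong[OF refl sum.swap] sum.swap])
  also have "\<dots> = ?l $$ (i, j)"
    using ij by (simp add: lin_ext_def carrier_closed)
  finally show "?l $$ (i, j) = ?r $$ (i, j)" by simp
qed (use x y in \<open>auto simp: lin_ext_def carrier_closed\<close>)

text \<open>The unit of the path algebra is the sum of the trivial paths, so \<open>f1\<close> says
  that it acts as the identity matrix; multiplicativity extends from paths by bilinearity.\<close>

lemma lin_ext_rep_n:
  fixes f :: "('v, 'a) path \<Rightarrow> 'k::field mat"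
  assumes f: "\<And>p. p \<in> paths Q \<Longrightarrow> f p \<in> carrier_mat n n"
    and ff: "\<And>p q. p \<in> paths Q \<Longrightarrow> q \<in> paths Q \<Longrightarrow>
      f p * f q = (if path_end Q q = fst p then f (path_comp p q) else 0\<^sub>m n n)"
    and f1: "\<And>i j. i < n \<Longrightarrow> j < n \<Longrightarrow> (\<Sum>v\<in>verts Q. f (v, []) $$ (i, j)) = of_bool (i = j)"
  shows "lin_ext n f \<in> rep_n Q n"
proof -
  have one: "lin_ext n f \<one>\<^bsub>kQ\<^esub> = 1\<^sub>m n"
  proof (rule eq_matI)
    fix i j assume "i < dim_row (1\<^sub>m n :: 'k mat)" "j < dim_col (1\<^sub>m n :: 'k mat)"
    then have ij: "i < n" "j < n" by auto
    have "lin_ext n f \<one>\<^bsub>kQ\<^esub> $$ (i, j) =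
      (\<Sum>p\<in>paths Q. of_bool (fst p \<in> verts Q \<and> snd p = []) * f p $$ (i, j))"
      using ij by (simp add: lin_ext_def carrier_closed) (simp add: one_path_algebra)
    also have "\<dots> = (\<Sum>p\<in>(\<lambda>v. (v, [])) ` verts Q. f p $$ (i, j))"
      by (rule sum.mono_neutral_cong_right)
        (use finite_paths trivial_path in \<open>auto simp: image_iff\<close>)
    also have "\<dots> = (\<Sum>v\<in>verts Q. f (v, []) $$ (i, j))"
      by (subst sum.reindex) (auto simp: inj_on_def)
    finally show "lin_ext n f \<one>\<^bsub>kQ\<^esub> $$ (i, j) = 1\<^sub>m n $$ (i, j)"
      using ij f1 by simp
  qed (auto simp: lin_ext_def carrier_closed)
  show ?thesis
  proof (rule rep_nI)
    show "lin_ext n f (\<lambda>p. x p + y p) = lin_ext n f x + lin_ext n f y"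
      if "x \<in> carrier kQ" "y \<in> carrier kQ" for x y
      using that carrier_closed(2)[OF that]
      by (auto simp: lin_ext_def add_path_algebra algebra_simps sum.distrib)
    show "lin_ext n f (\<lambda>p. c * x p) = c \<cdot>\<^sub>m lin_ext n f x"
      if "x \<in> carrier kQ" for c x
      using that carrier_closed(3)[OF that, of c]
      by (auto simp: lin_ext_def smult_path_algebra algebra_simps sum_distrib_left)
  qed (use one lin_ext_mult[OF f ff] in \<open>auto simp: lin_ext_def\<close>)
qed

text \<open>The action of GL_n on representations by which \<open>assoc_bundle\<close> is
  formed.\<close>

definition conj_rep :: "nat \<Rightarrow> 'k::field mat \<Rightarrow> ('v, 'a, 'k) alg_rep \<Rightarrow> ('v, 'a, 'k) alg_rep" where
  "conj_rep n g \<rho> = (\<lambda>x\<in>carrier kQ. g * \<rho> x * GL_inv n g)"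

lemma conj_rep_n:
  fixes \<rho> :: "('v, 'a, 'k::field) alg_rep"
  assumes \<rho>: "\<rho> \<in> rep_n Q n" and g: "g \<in> GL TYPE('k) n"
  shows "conj_rep n g \<rho> \<in> rep_n Q n"
proof -
  note c = rep_nD(1)[OF \<rho>] GL_carrier[OF g] GL_inv_carrier[OF g]
  have "g * (\<rho> x * \<rho> y) * GL_inv n g = g * \<rho> x * GL_inv n g * (g * \<rho> y * GL_inv n g)"
    if x: "x \<in> carrier kQ" and y: "y \<in> carrier kQ" for x y
  proof -
    note c = c(1)[OF x] c(1)[OF y] c(2,3)
    have "g * \<rho> x * GL_inv n g * (g * \<rho> y * GL_inv n g) = g * \<rho> x * (GL_inv n g * g) * \<rho> y * GL_inv n g"
      using c by (simp add: assoc_mult_mat[of _ n n _ n _ n] mult_carrier_mat[of _ n n _ n])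
    also have "\<dots> = g * (\<rho> x * \<rho> y) * GL_inv n g"
      using c by (simp add: GL_inv_left[OF g] assoc_mult_mat[of _ n n _ n _ n]
          mult_carrier_mat[of _ n n _ n] left_mult_one_mat[of _ n n])
    finally show ?thesis by simp
  qed
  moreover have "g * (\<rho> x + \<rho> y) * GL_inv n g = g * \<rho> x * GL_inv n g + g * \<rho> y * GL_inv n g"
    if x: "x \<in> carrier kQ" and y: "y \<in> carrier kQ" for x y
    using c(1)[OF x] c(1)[OF y] c(2,3)
    by (simp add: mult_add_distrib_mat[of _ n n _ n] add_mult_distrib_mat[of _ n n _ _ n])
  moreover have "g * (k \<cdot>\<^sub>m \<rho> x) * GL_inv n g = k \<cdot>\<^sub>m (g * \<rho> x * GL_inv n g)"
    if x: "x \<in> carrier kQ" for k x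
    using c(1)[OF x] c(2,3)
    by (simp add: mult_smult_distrib[of _ n n _ n] mult_smult_assoc_mat[of _ n n _ n])
  moreover have "g * 1\<^sub>m n * GL_inv n g = 1\<^sub>m n"
    using c(2) GL_inv_right[OF g] by simp
  moreover have "g * \<rho> x * GL_inv n g \<in> carrier_mat n n" if "x \<in> carrier kQ" for x
    using c(1)[OF that] c(2,3) by simp
  ultimately show ?thesis
    using rep_nD[OF \<rho>]
    by (intro rep_nI) (simp_all add: conj_rep_def carrier_closed
      carrier_closed(2)[unfolded add_path_algebra] carrier_closed(3)[unfolded smult_path_algebra])
qed

lemma conj_rep_conj_rep:
  fixes \<rho> :: "('v, 'a, 'k::field) alg_rep"
  assumes \<rho>: "\<rho> \<in> rep_n Q n" and g: "g \<in> GL TYPE('k) n" and h: "h \<in> GL TYPE('k) n"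
  shows "conj_rep n g (conj_rep n h \<rho>) = conj_rep n (g * h) \<rho>"
proof
  fix x
  show "conj_rep n g (conj_rep n h \<rho>) x = conj_rep n (g * h) \<rho> x"
  proof (cases "x \<in> carrier kQ")
    case True
    then show ?thesis
      using rep_nD(1)[OF \<rho> True] GL_carrier[OF g] GL_carrier[OF h] GL_inv_carrier[OF g] GL_inv_carrier[OF h]
      by (simp add: conj_rep_def GL_mult(2)[OF g h] assoc_mult_mat[of _ n n _ n _ n]
          mult_carrier_mat[of _ n n _ n])
  qed (simp add: conj_rep_def)
qed

lemma conj_rep_one:
  fixes \<rho> :: "('v, 'a, 'k::field) alg_rep"
  assumes \<rho>: "\<rho> \<in> rep_n Q n"
  shows "conj_rep n (1\<^sub>m n) \<rho> = \<rho>"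
proof -
  have "GL_inv n (1\<^sub>m n :: 'k mat) = 1\<^sub>m n" by (rule GL_I) auto
  then show ?thesis
    using rep_nD(6)[OF \<rho>] left_mult_one_mat[OF rep_nD(1)[OF \<rho>]] right_mult_one_mat[OF rep_nD(1)[OF \<rho>]]
    by (auto simp: conj_rep_def extensional_def fun_eq_iff)
qed

end

section \<open>Matrices and the splitting of k^(d+c) into first and last coordinates\<close>

text \<open>The side conditions compare dimensions instead of naming carriers, so rewriting can
  discharge them from known values of \<open>dim_row\<close> and \<open>dim_col\<close>.\<close>

lemma mat_assoc:
  fixes A :: "'k::semiring_0 mat"
  assumes "dim_col A = dim_row B" "dim_col B = dim_row C"
  shows "A * B * C = A * (B * C)"
  by (rule assoc_mult_mat[of _ "dim_row A" "dim_col A" _ "dim_col B" _ "dim_col C"]) (use assms in auto)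

lemma mat_vec_assoc:
  fixes A :: "'k::semiring_0 mat"
  assumes "dim_col A = dim_row B" "dim_col B = dim_vec v"
  shows "A * B *\<^sub>v v = A *\<^sub>v (B *\<^sub>v v)"
  by (rule assoc_mult_mat_vec[of _ "dim_row A" "dim_col A" _ "dim_col B"]) (use assms in auto)

lemma inj_imp_GL:
  fixes A :: "'k::field mat"
  assumes "A \<in> carrier_mat n n"
    and "\<And>x. x \<in> carrier_vec n \<Longrightarrow> A *\<^sub>v x = 0\<^sub>v n \<Longrightarrow> x = 0\<^sub>v n"
  shows "A \<in> GL TYPE('k) n"
proof (rule det_non_zero_imp_unit[OF assms(1)])
  show "det A \<noteq> 0"
    unfolding det_0_iff_vec_prod_zero_field[OF assms(1)] using assms(2) by blast
qed

text \<open>Preimages of the unit vectors serve as the columns of the right inverse.\<close>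

lemma surj_imp_right_inverse:
  fixes A :: "'k::field mat"
  assumes A: "A \<in> carrier_mat m n"
    and surj: "\<And>y. y \<in> carrier_vec m \<Longrightarrow> \<exists>x\<in>carrier_vec n. A *\<^sub>v x = y"
  obtains B where "B \<in> carrier_mat n m" "A * B = 1\<^sub>m m"
proof -
  have "\<exists>x. x \<in> carrier_vec n \<and> A *\<^sub>v x = unit_vec m j" for j
    using surj[of "unit_vec m j"] by auto
  then obtain x where x: "\<And>j. x j \<in> carrier_vec n" "\<And>j. A *\<^sub>v x j = unit_vec m j" by metis
  define B where "B = mat n m (\<lambda>(i, j). x j $ i)"
  have col: "col B j = x j" if "j < m" for j
    using that carrier_vecD[OF x(1), of j] by (intro eq_vecI) (auto simp: B_def)
  have "A * B = 1\<^sub>m m"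
  proof (rule eq_matI)
    fix i j assume "i < dim_row (1\<^sub>m m :: 'k mat)" "j < dim_col (1\<^sub>m m :: 'k mat)"
    then have ij: "i < m" "j < m" by auto
    then have "(A * B) $$ (i, j) = (A *\<^sub>v x j) $ i" using A col by (simp add: B_def)
    then show "(A * B) $$ (i, j) = 1\<^sub>m m $$ (i, j)" using ij x(2) by simp
  qed (use A in \<open>auto simp: B_def\<close>)
  then show thesis using that[of B] by (simp add: B_def)
qed

text \<open>The inclusions and projections of k^(d+c) as the sum of k^d and k^c. In use,
  \<open>d\<close> counts the basis vectors contributed at a vertex by the first letter of a word,
  hence is 0 or 1, and \<open>c\<close> those of the remaining letters.\<close>

definition incl_first :: "nat \<Rightarrow> nat \<Rightarrow> 'k::field mat" where
  "incl_first d c = mat (d + c) d (\<lambda>(i, j). of_bool (i = j))"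

definition proj_first :: "nat \<Rightarrow> nat \<Rightarrow> 'k::field mat" where
  "proj_first d c = mat d (d + c) (\<lambda>(i, j). of_bool (i = j))"

definition incl_last :: "nat \<Rightarrow> nat \<Rightarrow> 'k::field mat" where
  "incl_last d c = mat (d + c) c (\<lambda>(i, j). of_bool (i = d + j))"

definition proj_last :: "nat \<Rightarrow> nat \<Rightarrow> 'k::field mat" where
  "proj_last d c = mat c (d + c) (\<lambda>(i, j). of_bool (j = d + i))"

lemma first_last_dim [simp]:
  "dim_row (incl_first d c) = d + c" "dim_col (incl_first d c) = d"
  "dim_row (proj_first d c) = d" "dim_col (proj_first d c) = d + c"
  "dim_row (incl_last d c) = d + c" "dim_col (incl_last d c) = c"
  "dim_row (proj_last d c) = c" "dim_col (proj_last d c) = d + c"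
  by (auto simp: incl_first_def proj_first_def incl_last_def proj_last_def)

lemma index_first_last:
  fixes A :: "'k::field mat"
  shows "i < c \<Longrightarrow> j < dim_col A \<Longrightarrow> dim_row A = d + c \<Longrightarrow> (proj_last d c * A) $$ (i, j) = A $$ (d + i, j)"
    and "i < dim_row A \<Longrightarrow> j < d + c \<Longrightarrow> dim_col A = c \<Longrightarrow>
      (A * proj_last d c) $$ (i, j) = (if j < d then 0 else A $$ (i, j - d))"
    and "i < dim_row A \<Longrightarrow> j < d \<Longrightarrow> dim_col A = d + c \<Longrightarrow> (A * incl_first d c) $$ (i, j) = A $$ (i, j)"
    and "i < dim_row A \<Longrightarrow> j < c \<Longrightarrow> dim_col A = d + c \<Longrightarrow> (A * incl_last d c) $$ (i, j) = A $$ (i, d + j)"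
    and "i < dim_row A \<Longrightarrow> j < d + c \<Longrightarrow> dim_col A = d \<Longrightarrow>
      (A * proj_first d c) $$ (i, j) = (if j < d then A $$ (i, j) else 0)"
proof (goal_cases)
  case 2
  have "(j = d + k) = (k = j - d)" if "\<not> j < d" for k using that by auto
  moreover have "j \<noteq> d + k" if "j < d" for k using that by auto
  ultimately show ?case
    using 2 by (simp add: proj_last_def scalar_prod_def of_bool_def if_distrib[of "\<lambda>t. _ * t"] cong: if_cong, arith)
qed (auto simp: proj_first_def incl_first_def proj_last_def incl_last_def scalar_prod_def of_bool_def
    if_distrib[of "\<lambda>t. t * _"] if_distrib[of "\<lambda>t. _ * t"] cong: if_cong)

lemma first_last_mult:
  "proj_first d c * incl_first d c = (1\<^sub>m d :: 'k::field mat)"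
  "proj_last d c * incl_last d c = (1\<^sub>m c :: 'k mat)"
  "proj_last d c * incl_first d c = (0\<^sub>m c d :: 'k mat)"
  "incl_first d c * proj_first d c + incl_last d c * proj_last d c = (1\<^sub>m (d + c) :: 'k mat)"
proof -
  show "proj_first d c * incl_first d c = (1\<^sub>m d :: 'k mat)"
    by (rule eq_matI) (simp_all add: index_first_last del: index_mult_mat(1), simp add: proj_first_def)
  show "proj_last d c * incl_last d c = (1\<^sub>m c :: 'k mat)"
    by (rule eq_matI) (simp_all add: index_first_last del: index_mult_mat(1), simp add: proj_last_def)
  show "proj_last d c * incl_first d c = (0\<^sub>m c d :: 'k mat)"
    by (rule eq_matI) (simp_all add: index_first_last del: index_mult_mat(1), simp add: proj_last_def)
  show "incl_first d c * proj_first d c + incl_last d c * proj_last d c = (1\<^sub>m (d + c) :: 'k mat)"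
    by (rule eq_matI) (simp_all add: index_first_last del: index_mult_mat(1), auto simp: incl_first_def incl_last_def)
qed

text \<open>Apply the decomposition of the identity in \<open>first_last_mult\<close> to
  \<open>x\<close>; the part through the last coordinates vanishes by assumption.\<close>

lemma proj_last_kernel:
  fixes x :: "'k::field vec"
  assumes "x \<in> carrier_vec (d + c)" "proj_last d c *\<^sub>v x = 0\<^sub>v c"
  shows "x = incl_first d c *\<^sub>v (proj_first d c *\<^sub>v x)"
proof -
  have z: "incl_last d c *\<^sub>v 0\<^sub>v c = (0\<^sub>v (d + c) :: 'k vec)"
    by (intro eq_vecI) (auto simp: incl_last_def)
  have "1\<^sub>m (d + c) *\<^sub>v x = incl_first d c *\<^sub>v (proj_first d c *\<^sub>v x) + incl_last d c *\<^sub>v (proj_last d c *\<^sub>v x)"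
    unfolding first_last_mult(4)[symmetric] using assms(1)
    by (subst add_mult_distrib_mat_vec[of _ "d + c" "d + c"])
      (auto simp: mat_vec_assoc intro!: carrier_matI)
  moreover have "incl_first d c *\<^sub>v (proj_first d c *\<^sub>v x) \<in> carrier_vec (d + c)"
    by (rule carrier_vecI) simp
  ultimately show ?thesis using assms(1) z unfolding assms(2) by simp
qed

subsection \<open>Words and triangular representations of the quiver\<close>

text \<open>
  The position \<open>j\<close> of \<open>w\<close> is the basis vector number \<open>snd (word_index w j)\<close> at the vertex \<open>w ! j\<close>
  for the dimension vector \<open>count_list w\<close>.
\<close>

definition word_index :: "'v list \<Rightarrow> nat \<Rightarrow> 'v \<times> nat" where
  "word_index w j = (w ! j, count_list (take j w) (w ! j))"

lemma fst_word_index [simp]: "fst (word_index w j) = w ! j"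
  by (simp add: word_index_def)

lemma snd_word_index_Cons [simp]:
  "snd (word_index (i # w) 0) = 0"
  "snd (word_index (i # w) (Suc j)) = simple_dim i (w ! j) + snd (word_index w j)"
  by (auto simp: word_index_def simple_dim_def)

lemma word_index_less: "j < length w \<Longrightarrow> snd (word_index w j) < count_list w (w ! j)"
proof (induction w arbitrary: j)
  case (Cons i w)
  then show ?case by (cases j) (auto simp: simple_dim_def)
qed simp

lemma word_index_surj:
  "p < count_list w v \<Longrightarrow> \<exists>j<length w. w ! j = v \<and> snd (word_index w j) = p"
proof (induction w arbitrary: p)
  case (Cons i w)
  show ?case
  proof (cases "v = i \<and> p = 0")
    case True
    then show ?thesis by (intro exI[of _ 0]) simp
  next
    case False
    with Cons.prems have "p - simple_dim i v < count_list w v"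
      by (auto simp: simple_dim_def split: if_splits)
    then obtain j where j: "j < length w" "w ! j = v" "snd (word_index w j) = p - simple_dim i v"
      using Cons.IH by blast
    with False show ?thesis by (intro exI[of _ "Suc j"]) (auto simp: simple_dim_def)
  qed
qed simp

text \<open>Surjectivity is enough: the letter counts over \<open>V\<close> add up to the length of
  \<open>w\<close>, so both sets have the same size.\<close>

lemma bij_word_index:
  assumes "set w \<subseteq> V" "finite V"
  shows "bij_betw (word_index w) {..<length w} (SIGMA v:V. {..<count_list w v})"
proof -
  let ?I = "SIGMA v:V. {..<count_list w v}"
  have eq: "word_index w ` {..<length w} = ?I"
  proof
    show "word_index w ` {..<length w} \<subseteq> ?I"
    proof (rule image_subsetI)
      fix j assume "j \<in> {..<length w}"
      then have "w ! j \<in> V" "snd (word_index w j) < count_list w (w ! j)"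
        using assms(1) word_index_less[of j w] by auto
      then show "word_index w j \<in> ?I" by (simp add: word_index_def)
    qed
    show "?I \<subseteq> word_index w ` {..<length w}"
    proof (rule subsetI)
      fix r assume "r \<in> ?I"
      then have "snd r < count_list w (fst r)" by auto
      then obtain j where "j < length w" "w ! j = fst r" "snd (word_index w j) = snd r"
        using word_index_surj by metis
      then show "r \<in> word_index w ` {..<length w}"
        by (intro image_eqI[of _ _ j]) (simp_all add: prod_eq_iff)
    qed
  qed
  have "card ?I = length w"
    using sum_count_set[OF assms] assms(2) by simp
  then have "inj_on (word_index w) {..<length w}"
    using eq by (intro eq_card_imp_inj_on) auto
  with eq show ?thesis by (simp add: bij_betw_def)
qed

text \<open>At a vertex other than \<open>i\<close> the first summand has dimension 0, so this is an
  identity matrix there and \<open>first_letter\<close> has no columns; a single formula thus covers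
  all vertices.\<close>

abbreviation drop_letter :: "'v \<Rightarrow> 'v list \<Rightarrow> 'v \<Rightarrow> 'k::field mat" where
  "drop_letter i w v \<equiv> proj_last (simple_dim i v) (count_list w v)"

abbreviation first_letter :: "'v \<Rightarrow> 'v list \<Rightarrow> 'v \<Rightarrow> 'k::field mat" where
  "first_letter i w v \<equiv> incl_first (simple_dim i v) (count_list w v)"

text \<open>Strict in the order of the letters: since \<open>j = i\<close> is included, an arrow
  sends the vector at position \<open>j\<close> into the span of the vectors at earlier positions.
  Hence initial segments are subrepresentations and arrows act as zero on successive
  quotients.\<close>

definition word_triangular :: "('v, 'a) pre_digraph \<Rightarrow> 'v list \<Rightarrow> ('a, 'k::field) quiver_rep \<Rightarrow> bool" where
  "word_triangular Q w X \<longleftrightarrow> (\<forall>a\<in>arcs Q. \<forall>i<length w. \<forall>j\<le>i. w ! i = head Q a \<longrightarrow> w ! j = tail Q a \<longrightarrow>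
     X a $$ (snd (word_index w i), snd (word_index w j)) = 0)"

lemma count_list_Cons_simple_dim: "count_list (i # w) = (\<lambda>v. simple_dim i v + count_list w v)"
  by (auto simp: simple_dim_def)

lemma fst_word_value: "fst (word_value Q w :: ('v, 'a, 'k::field) monoid_elem) = count_list w"
proof (induction w)
  case Nil
  then show ?case by (auto simp: word_value_def composition_monoid_def extension_monoid_def)
next
  case (Cons i w)
  then show ?case
    unfolding count_list_Cons_simple_dim
    by (auto simp: word_value_def composition_monoid_def extension_monoid_def generator_def case_prod_beta)
qed

lemma snd_word_value:
  "snd (word_value Q [] :: ('v, 'a, 'k::field) monoid_elem) = rep_space Q (\<lambda>v. 0)"
  "snd (word_value Q (i # w) :: ('v, 'a, 'k) monoid_elem) =
    extension_product Q (simple_dim i) (count_list w) (rep_space Q (simple_dim i)) (snd (word_value Q w))"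
proof -
  show "snd (word_value Q [] :: ('v, 'a, 'k) monoid_elem) = rep_space Q (\<lambda>v. 0)"
    by (simp add: word_value_def composition_monoid_def extension_monoid_def)
  have "word_value Q (i # w) = generator Q i \<otimes>\<^bsub>extension_monoid Q\<^esub> (word_value Q w :: ('v, 'a, 'k) monoid_elem)"
    by (simp add: word_value_def composition_monoid_def)
  then show "snd (word_value Q (i # w) :: ('v, 'a, 'k) monoid_elem) =
    extension_product Q (simple_dim i) (count_list w) (rep_space Q (simple_dim i)) (snd (word_value Q w))"
    by (simp add: extension_monoid_def generator_def case_prod_beta fst_word_value)
qed

lemma rep_space_carrier:
  "X \<in> rep_space Q \<alpha> \<Longrightarrow> a \<in> arcs Q \<Longrightarrow> X a \<in> carrier_mat (\<alpha> (head Q a)) (\<alpha> (tail Q a))"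
  by (auto simp: rep_space_def)

text \<open>
  \<open>Y\<close> is conjugate to a triangular representation; the columns of \<open>B v\<close>, taken in the order of the
  word, span the steps of a flag of subrepresentations.
\<close>

definition word_flagged :: "('v, 'a) pre_digraph \<Rightarrow> 'v list \<Rightarrow> ('a, 'k::field) quiver_rep \<Rightarrow> bool" where
  "word_flagged Q w Y \<longleftrightarrow> (\<exists>B X. (\<forall>v\<in>verts Q. B v \<in> GL TYPE('k) (count_list w v)) \<and>
     X \<in> rep_space Q (count_list w) \<and> word_triangular Q w X \<and>
     (\<forall>a\<in>arcs Q. Y a * B (tail Q a) = B (head Q a) * X a))"

text \<open>Split off the basis vector of the first letter. An entry with \<open>l \<le> k\<close>
  either lies in its column, which vanishes by \<open>zero\<close>, or in the block that avoids both
  its row and its column, which \<open>eq\<close> identifies with \<open>X'\<close>; the rest of its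
  row lies above the diagonal.\<close>

lemma word_triangular_ConsI:
  assumes X: "X \<in> rep_space Q (\<lambda>v. simple_dim i v + count_list w v)"
    and X': "X' \<in> rep_space Q (count_list w)" "word_triangular Q w X'"
    and eq: "\<And>a. a \<in> arcs Q \<Longrightarrow>
      drop_letter i w (head Q a) * X a =
      X' a * drop_letter i w (tail Q a)"
    and zero: "\<And>a. a \<in> arcs Q \<Longrightarrow> X a * first_letter i w (tail Q a) =
      0\<^sub>m (simple_dim i (head Q a) + count_list w (head Q a)) (simple_dim i (tail Q a))"
  shows "word_triangular Q (i # w) X"
  unfolding word_triangular_def
proof (intro ballI allI impI)
  fix a k l assume a: "a \<in> arcs Q" and k: "k < length (i # w)" "l \<le> k"
    "(i # w) ! k = head Q a" "(i # w) ! l = tail Q a"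
  let ?h = "head Q a" and ?t = "tail Q a"
  note d = carrier_matD[OF rep_space_carrier[OF X a]] carrier_matD[OF rep_space_carrier[OF X'(1) a]]
  show "X a $$ (snd (word_index (i # w) k), snd (word_index (i # w) l)) = 0"
  proof (cases l)
    case 0
    have "snd (word_index (i # w) k) < simple_dim i ?h + count_list w ?h"
      using word_index_less[OF k(1)] k(3) unfolding count_list_Cons_simple_dim by simp
    moreover have "simple_dim i ?t = 1" using k(4) 0 by (simp add: simple_dim_def)
    ultimately show ?thesis
      using index_first_last(3)[of "snd (word_index (i # w) k)" "X a" 0 "simple_dim i ?t" "count_list w ?t"]
        d zero[OF a] 0 by (simp del: index_mult_mat)
  next
    case (Suc l')
    then obtain k' where k': "k = Suc k'" "l' \<le> k'" using k(2) by (cases k) auto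
    have w: "w ! k' = ?h" "w ! l' = ?t" "k' < length w" "l' < length w" using k k' Suc by auto
    let ?p = "snd (word_index w k')" and ?q = "snd (word_index w l')"
    have pq: "?p < count_list w ?h" "?q < count_list w ?t"
      using word_index_less[of k' w] word_index_less[of l' w] w by auto
    have "X a $$ (simple_dim i ?h + ?p, simple_dim i ?t + ?q) =
        (proj_last (simple_dim i ?h) (count_list w ?h) * X a) $$ (?p, simple_dim i ?t + ?q)"
      using pq d by (subst index_first_last(1)) auto
    also have "\<dots> = X' a $$ (?p, ?q)"
      unfolding eq[OF a] using pq d by (subst index_first_last(2)) auto
    also have "\<dots> = 0"
      using X'(2) a w k'(2) unfolding word_triangular_def by blast
    finally show ?thesis using k' Suc w by simp
  qed
qed

text \<open>The block that remains after deleting the row and the column of the first letter is the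
  representation of the shorter word. Prepending a letter shifts the numbering at its own vertex by
  one, whence the offsets \<open>simple_dim\<close> in \<open>X'\<close>.\<close>

lemma word_triangular_ConsE:
  fixes X :: "('a, 'k::field) quiver_rep"
  assumes X: "X \<in> rep_space Q (\<lambda>v. simple_dim i v + count_list w v)"
    and tri: "word_triangular Q (i # w) X"
  obtains X' where "X' \<in> rep_space Q (count_list w)" "word_triangular Q w X'"
    "\<And>a. a \<in> arcs Q \<Longrightarrow>
      drop_letter i w (head Q a) * X a =
      X' a * drop_letter i w (tail Q a)"
    "\<And>a. a \<in> arcs Q \<Longrightarrow> X a * first_letter i w (tail Q a) =
      0\<^sub>m (simple_dim i (head Q a) + count_list w (head Q a)) (simple_dim i (tail Q a))"
proof -
  define X' where "X' = (\<lambda>a\<in>arcs Q. mat (count_list w (head Q a)) (count_list w (tail Q a))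
    (\<lambda>(p, q). X a $$ (simple_dim i (head Q a) + p, simple_dim i (tail Q a) + q)))"
  have X': "X' \<in> rep_space Q (count_list w)" by (auto simp: X'_def rep_space_def)
  have "word_triangular Q w X'"
    unfolding word_triangular_def
  proof (intro ballI allI impI)
    fix a k l assume a: "a \<in> arcs Q" and k: "k < length w" "l \<le> k" "w ! k = head Q a" "w ! l = tail Q a"
    have "X a $$ (snd (word_index (i # w) (Suc k)), snd (word_index (i # w) (Suc l))) = 0"
      using tri a k unfolding word_triangular_def by (metis Suc_le_mono Suc_less_eq length_Cons nth_Cons_Suc)
    then show "X' a $$ (snd (word_index w k), snd (word_index w l)) = 0"
      using a k word_index_less[of k w] word_index_less[of l w] by (simp add: X'_def)
  qed
  \<comment> \<open>Every row \<open>p\<close> at the head is the number of some letter, and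
    position 0 is not after that letter, so triangularity kills the whole first column.\<close>
  moreover have col0: "X a $$ (p, 0) = 0"
    if a: "a \<in> arcs Q" and t: "tail Q a = i" and p: "p < simple_dim i (head Q a) + count_list w (head Q a)" for a p
  proof -
    have "p < count_list (i # w) (head Q a)" using p unfolding count_list_Cons_simple_dim .
    then obtain k where "k < length (i # w)" "(i # w) ! k = head Q a" "snd (word_index (i # w) k) = p"
      using word_index_surj by metis
    then show ?thesis using tri a t unfolding word_triangular_def
      by (metis le0 nth_Cons_0 snd_word_index_Cons(1))
  qed
  moreover have "drop_letter i w (head Q a) * X a =
      X' a * drop_letter i w (tail Q a)" (is "?l = ?r")
    if a: "a \<in> arcs Q" for a
  proof -
    note d = carrier_matD[OF rep_space_carrier[OF X a]] carrier_matD[OF rep_space_carrier[OF X' a]]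
    show ?thesis
    proof (rule eq_matI)
      fix p q assume "p < dim_row ?r" "q < dim_col ?r"
      then have pq: "p < count_list w (head Q a)" "q < simple_dim i (tail Q a) + count_list w (tail Q a)"
        using d by auto
      have l: "?l $$ (p, q) = X a $$ (simple_dim i (head Q a) + p, q)"
        using pq d by (subst index_first_last(1)) auto
      have r: "?r $$ (p, q) = (if q < simple_dim i (tail Q a) then 0 else X' a $$ (p, q - simple_dim i (tail Q a)))"
        using pq d by (subst index_first_last(2)) auto
      show "?l $$ (p, q) = ?r $$ (p, q)"
      proof (cases "q < simple_dim i (tail Q a)")
        case True
        then have "tail Q a = i" "q = 0" by (cases "tail Q a = i", auto simp: simple_dim_def)+
        then show ?thesis unfolding l r using col0[OF a] pq True by simp
      next
        case False
        then show ?thesis unfolding l r using a pq by (simp add: X'_def)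
      qed
    qed (use d in auto)
  qed
  moreover have "X a * first_letter i w (tail Q a) =
      0\<^sub>m (simple_dim i (head Q a) + count_list w (head Q a)) (simple_dim i (tail Q a))" (is "?l = ?r")
    if a: "a \<in> arcs Q" for a
  proof -
    note d = carrier_matD[OF rep_space_carrier[OF X a]]
    show ?thesis
    proof (rule eq_matI)
      fix p q assume "p < dim_row ?r" "q < dim_col ?r"
      then have pq: "p < simple_dim i (head Q a) + count_list w (head Q a)" "q < simple_dim i (tail Q a)" by auto
      then have "tail Q a = i" "q = 0" by (cases "tail Q a = i", auto simp: simple_dim_def)+
      moreover have "?l $$ (p, q) = X a $$ (p, q)"
        using pq d by (subst index_first_last(3)) auto
      ultimately show "?l $$ (p, q) = ?r $$ (p, q)" using col0[OF a] pq by simp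
    qed (use d in auto)
  qed
  ultimately show thesis using that X' by blast
qed

lemma mult_mat_zero_vec:
  fixes A :: "'k::field mat"
  shows "dim_col A = n \<Longrightarrow> A *\<^sub>v 0\<^sub>v n = 0\<^sub>v (dim_row A)"
  by (intro eq_vecI) (auto intro!: scalar_prod_right_zero row_carrier_vec)

section \<open>Flags and iterated extensions by the generators\<close>

context acyclic_fin_digraph
begin

text \<open>In the basis \<open>B v\<close> the vector of the first letter spans the
  subrepresentation: \<open>f v\<close> is the corresponding part of \<open>B v\<close>, and
  \<open>g v\<close> consists of the remaining coordinate functions. The induced quotient
  \<open>N\<close> is the triangular representation of the shorter word itself, so identity matrices
  flag it.\<close>

lemma flagged_imp_extension:
  fixes Y :: "('a, 'k::field) quiver_rep"
  assumes Y: "Y \<in> rep_space Q (\<lambda>v. simple_dim i v + count_list w v)" and fl: "word_flagged Q (i # w) Y"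
  shows "\<exists>M\<in>rep_space Q (simple_dim i). \<exists>N\<in>rep_space Q (count_list w). word_flagged Q w N \<and>
    (\<exists>f g. short_exact Q (simple_dim i) (\<lambda>v. simple_dim i v + count_list w v) (count_list w) M Y N f g)"
proof -
  let ?d = "simple_dim i" and ?c = "count_list w"
  have "word_flagged Q (i # w) Y \<longleftrightarrow> (\<exists>B X. (\<forall>v\<in>verts Q. B v \<in> GL TYPE('k) (?d v + ?c v)) \<and>
     X \<in> rep_space Q (\<lambda>v. ?d v + ?c v) \<and> word_triangular Q (i # w) X \<and>
     (\<forall>a\<in>arcs Q. Y a * B (tail Q a) = B (head Q a) * X a))"
    unfolding word_flagged_def count_list_Cons_simple_dim ..
  then obtain B X where "\<forall>v\<in>verts Q. B v \<in> GL TYPE('k) (?d v + ?c v)"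
    and X: "X \<in> rep_space Q (\<lambda>v. ?d v + ?c v)" and tri: "word_triangular Q (i # w) X"
    and "\<forall>a\<in>arcs Q. Y a * B (tail Q a) = B (head Q a) * X a"
    using fl by blast
  then have B: "\<And>v. v \<in> verts Q \<Longrightarrow> B v \<in> GL TYPE('k) (?d v + ?c v)"
    and YB: "\<And>a. a \<in> arcs Q \<Longrightarrow> Y a * B (tail Q a) = B (head Q a) * X a" by blast+
  obtain N where N: "N \<in> rep_space Q ?c" "word_triangular Q w N"
    and SX: "\<And>a. a \<in> arcs Q \<Longrightarrow>
      proj_last (?d (head Q a)) (?c (head Q a)) * X a = N a * proj_last (?d (tail Q a)) (?c (tail Q a))"
    and XT: "\<And>a. a \<in> arcs Q \<Longrightarrow> X a * incl_first (?d (tail Q a)) (?c (tail Q a)) =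
      0\<^sub>m (?d (head Q a) + ?c (head Q a)) (?d (tail Q a))"
    by (rule word_triangular_ConsE[OF X tri]) blast
  define C where "C v = GL_inv (?d v + ?c v) (B v)" for v
  define M :: "('a, 'k) quiver_rep" where "M = (\<lambda>a\<in>arcs Q. 0\<^sub>m (?d (head Q a)) (?d (tail Q a)))"
  define f :: "'v \<Rightarrow> 'k mat" where "f v = B v * incl_first (?d v) (?c v)" for v
  define g :: "'v \<Rightarrow> 'k mat" where "g v = proj_last (?d v) (?c v) * C v" for v
  have dB: "dim_row (B v) = ?d v + ?c v" "dim_col (B v) = ?d v + ?c v"
    and dC: "dim_row (C v) = ?d v + ?c v" "dim_col (C v) = ?d v + ?c v"
    and BC: "B v * C v = 1\<^sub>m (?d v + ?c v)" "C v * B v = 1\<^sub>m (?d v + ?c v)" if "v \<in> verts Q" for v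
    using carrier_matD[OF GL_carrier[OF B[OF that]]] carrier_matD[OF GL_inv_carrier[OF B[OF that]]]
      GL_inv_left[OF B[OF that]] GL_inv_right[OF B[OF that]] by (simp_all add: C_def)
  have M: "M \<in> rep_space Q ?d" by (auto simp: M_def rep_space_def)
  have "f \<in> quiver_hom Q ?d (\<lambda>v. ?d v + ?c v) M Y"
    unfolding quiver_hom_def
  proof (intro CollectI conjI ballI Pi_I)
    fix v assume "v \<in> verts Q"
    then show "f v \<in> carrier_mat (?d v + ?c v) (?d v)" by (auto simp: f_def dB)
  next
    fix a assume a: "a \<in> arcs Q"
    then have v: "head Q a \<in> verts Q" "tail Q a \<in> verts Q" by auto
    note d = carrier_matD[OF rep_space_carrier[OF X a]] carrier_matD[OF rep_space_carrier[OF Y a]] dB[OF v(1)] dB[OF v(2)]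
    have "Y a * f (tail Q a) = (Y a * B (tail Q a)) * incl_first (?d (tail Q a)) (?c (tail Q a))"
      unfolding f_def using d by (simp add: mat_assoc)
    also have "\<dots> = B (head Q a) * (X a * incl_first (?d (tail Q a)) (?c (tail Q a)))"
      unfolding YB[OF a] using d by (simp add: mat_assoc)
    also have "\<dots> = 0\<^sub>m (?d (head Q a) + ?c (head Q a)) (?d (tail Q a))"
      unfolding XT[OF a] using d by (intro right_mult_zero_mat) auto
    also have "\<dots> = f (head Q a) * M a"
      unfolding M_def using a d by (simp add: f_def right_mult_zero_mat[OF carrier_matI])
    finally show "f (head Q a) * M a = Y a * f (tail Q a)" by simp
  qed
  moreover have "g \<in> quiver_hom Q (\<lambda>v. ?d v + ?c v) ?c Y N"
    unfolding quiver_hom_def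
  proof (intro CollectI conjI ballI Pi_I)
    fix v assume "v \<in> verts Q"
    then show "g v \<in> carrier_mat (?c v) (?d v + ?c v)" by (auto simp: g_def dC)
  next
    fix a assume a: "a \<in> arcs Q"
    let ?h = "head Q a" and ?t = "tail Q a"
    have v: "?h \<in> verts Q" "?t \<in> verts Q" using a by auto
    note d = carrier_matD[OF rep_space_carrier[OF X a]] carrier_matD[OF rep_space_carrier[OF Y a]]
      carrier_matD[OF rep_space_carrier[OF N(1) a]] dB[OF v(1)] dB[OF v(2)] dC[OF v(1)] dC[OF v(2)]
    have "C ?h * Y a = C ?h * (Y a * (B ?t * C ?t))"
      using d BC(1)[OF v(2)] by simp
    also have "\<dots> = C ?h * ((Y a * B ?t) * C ?t)" using d by (simp add: mat_assoc)
    also have "\<dots> = (C ?h * B ?h) * (X a * C ?t)" unfolding YB[OF a] using d by (simp add: mat_assoc)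
    also have "\<dots> = X a * C ?t" using d BC(2)[OF v(1)] by simp
    finally have CY: "C ?h * Y a = X a * C ?t" .
    have "g ?h * Y a = proj_last (?d ?h) (?c ?h) * (C ?h * Y a)"
      unfolding g_def using d by (simp add: mat_assoc)
    also have "\<dots> = (proj_last (?d ?h) (?c ?h) * X a) * C ?t"
      unfolding CY using d by (simp add: mat_assoc)
    also have "\<dots> = N a * g ?t" unfolding SX[OF a] g_def using d by (simp add: mat_assoc)
    finally show "g ?h * Y a = N a * g ?t" .
  qed
  moreover have "inj_on ((*\<^sub>v) (f v)) (carrier_vec (?d v)) \<and>
        (*\<^sub>v) (f v) ` carrier_vec (?d v) = mat_kernel (g v) \<and>
        (*\<^sub>v) (g v) ` carrier_vec (?d v + ?c v) = carrier_vec (?c v)" if v: "v \<in> verts Q" for v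
  proof (intro conjI)
    note d = dB[OF v] dC[OF v] and BC = BC[OF v]
    let ?T = "incl_first (?d v) (?c v) :: 'k mat" and ?E = "proj_first (?d v) (?c v) :: 'k mat"
      and ?S = "proj_last (?d v) (?c v) :: 'k mat" and ?R = "incl_last (?d v) (?c v) :: 'k mat"
    show "inj_on ((*\<^sub>v) (f v)) (carrier_vec (?d v))"
    proof (rule inj_onI)
      fix x y assume xy: "x \<in> carrier_vec (?d v)" "y \<in> carrier_vec (?d v)" "f v *\<^sub>v x = f v *\<^sub>v y"
      \<comment> \<open>A left inverse of \<open>f v\<close>: the first coordinates with respect to
        the basis \<open>B v\<close>.\<close>
      have *: "(?E * C v) *\<^sub>v (f v *\<^sub>v z) = z" if "z \<in> carrier_vec (?d v)" for z
      proof -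
        have "(?E * C v) *\<^sub>v (f v *\<^sub>v z) = ?E * ((C v * B v) * ?T) *\<^sub>v z"
          using d that by (simp add: f_def mat_assoc mat_vec_assoc)
        then show ?thesis using d that BC(2) by (simp add: first_last_mult)
      qed
      show "x = y" using *[OF xy(1)] *[OF xy(2)] unfolding xy(3) by (rule trans[OF sym])
    qed
    have gf: "g v * f v = 0\<^sub>m (?c v) (?d v)"
    proof -
      have "g v * f v = ?S * ((C v * B v) * ?T)" using d by (simp add: g_def f_def mat_assoc)
      then show ?thesis using d BC(2) by (simp add: first_last_mult)
    qed
    show "(*\<^sub>v) (f v) ` carrier_vec (?d v) = mat_kernel (g v)"
    proof
      show "(*\<^sub>v) (f v) ` carrier_vec (?d v) \<subseteq> mat_kernel (g v)"
      proof (rule image_subsetI)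
        fix x :: "'k vec" assume x: "x \<in> carrier_vec (?d v)"
        have "g v *\<^sub>v (f v *\<^sub>v x) = (g v * f v) *\<^sub>v x"
          using d x by (simp add: mat_vec_assoc g_def f_def)
        also have "\<dots> = 0\<^sub>v (?c v)" unfolding gf using x by (intro eq_vecI) auto
        finally show "f v *\<^sub>v x \<in> mat_kernel (g v)"
          using d x by (auto simp: mat_kernel_def f_def g_def intro!: carrier_vecI)
      qed
      show "mat_kernel (g v) \<subseteq> (*\<^sub>v) (f v) ` carrier_vec (?d v)"
      proof
        fix u assume "u \<in> mat_kernel (g v)"
        then have u: "u \<in> carrier_vec (?d v + ?c v)" "g v *\<^sub>v u = 0\<^sub>v (?c v)"
          using d by (auto simp: mat_kernel_def g_def)
        have Cu: "C v *\<^sub>v u \<in> carrier_vec (?d v + ?c v)" using d by (auto intro: carrier_vecI)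
        have "?S *\<^sub>v (C v *\<^sub>v u) = 0\<^sub>v (?c v)" using u d by (simp add: g_def mat_vec_assoc)
        \<comment> \<open>A vector of the kernel has no last coordinates in the basis
          \<open>B v\<close>, so its first coordinates give the preimage under
          \<open>f v\<close>.\<close>
        from proj_last_kernel[OF Cu this]
        have "B v *\<^sub>v (C v *\<^sub>v u) = f v *\<^sub>v (?E *\<^sub>v (C v *\<^sub>v u))"
          using d u by (simp add: f_def mat_vec_assoc)
        moreover have "B v *\<^sub>v (C v *\<^sub>v u) = u"
          using d u BC(1) mat_vec_assoc[of "B v" "C v" u] by simp
        ultimately show "u \<in> (*\<^sub>v) (f v) ` carrier_vec (?d v)"
          by (intro image_eqI[of _ _ "?E *\<^sub>v (C v *\<^sub>v u)"]) (auto intro: carrier_vecI)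
      qed
    qed
    show "(*\<^sub>v) (g v) ` carrier_vec (?d v + ?c v) = carrier_vec (?c v)"
    proof
      show "(*\<^sub>v) (g v) ` carrier_vec (?d v + ?c v) \<subseteq> carrier_vec (?c v)"
        using d by (auto simp: g_def intro!: carrier_vecI)
      show "carrier_vec (?c v) \<subseteq> (*\<^sub>v) (g v) ` carrier_vec (?d v + ?c v)"
      proof
        fix z :: "'k vec" assume z: "z \<in> carrier_vec (?c v)"
        \<comment> \<open>The last columns of \<open>B v\<close> form a section of
          \<open>g v\<close>.\<close>
        have "g v *\<^sub>v (B v *\<^sub>v (?R *\<^sub>v z)) = ?S * ((C v * B v) * ?R) *\<^sub>v z"
          using d z by (simp add: g_def mat_assoc mat_vec_assoc)
        also have "\<dots> = z" using d z BC(2) by (simp add: first_last_mult)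
        finally show "z \<in> (*\<^sub>v) (g v) ` carrier_vec (?d v + ?c v)"
          using d by (intro image_eqI[of _ _ "B v *\<^sub>v (?R *\<^sub>v z)"]) (auto intro: carrier_vecI)
      qed
    qed
  qed
  ultimately have "short_exact Q ?d (\<lambda>v. ?d v + ?c v) ?c M Y N f g"
    by (simp add: short_exact_def)
  moreover have "word_flagged Q w N"
    unfolding word_flagged_def
  proof (intro exI conjI ballI)
    show "(1\<^sub>m (?c v) :: 'k mat) \<in> GL TYPE('k) (?c v)" for v by (rule GL_I[of _ _ "1\<^sub>m (?c v)"]) auto
    show "N a * 1\<^sub>m (?c (tail Q a)) = 1\<^sub>m (?c (head Q a)) * N a" if "a \<in> arcs Q" for a
      using rep_space_carrier[OF N(1) that] by simp
  qed (use N in auto)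
  ultimately show ?thesis using M N(1) by blast
qed

text \<open>A linear section \<open>G v\<close> of \<open>g v\<close> at every vertex lifts the flag
  basis of \<open>N\<close>; together with the image of \<open>f v\<close> these lifts form a flag
  basis for \<open>Y\<close>. The sections need not commute with the arrows: the defect lands in the
  row of the first letter, where triangularity leaves room for it.\<close>

lemma extension_imp_flagged:
  fixes Y :: "('a, 'k::field) quiver_rep"
  assumes Y: "Y \<in> rep_space Q (\<lambda>v. simple_dim i v + count_list w v)"
    and M: "M \<in> rep_space Q (simple_dim i)" and N: "N \<in> rep_space Q (count_list w)"
    and fl: "word_flagged Q w N"
    and exact: "short_exact Q (simple_dim i) (\<lambda>v. simple_dim i v + count_list w v) (count_list w) M Y N f g"
  shows "word_flagged Q (i # w) Y"
proof -
  let ?d = "simple_dim i" and ?c = "count_list w"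
  let ?T = "\<lambda>v. incl_first (?d v) (?c v) :: 'k mat" and ?E = "\<lambda>v. proj_first (?d v) (?c v) :: 'k mat"
    and ?S = "\<lambda>v. proj_last (?d v) (?c v) :: 'k mat"
  obtain C X' where C: "\<And>v. v \<in> verts Q \<Longrightarrow> C v \<in> GL TYPE('k) (?c v)"
    and X': "X' \<in> rep_space Q ?c" "word_triangular Q w X'"
    and NC: "\<And>a. a \<in> arcs Q \<Longrightarrow> N a * C (tail Q a) = C (head Q a) * X' a"
    using fl unfolding word_flagged_def by metis
  have f: "f v \<in> carrier_mat (?d v + ?c v) (?d v)" and g: "g v \<in> carrier_mat (?c v) (?d v + ?c v)"
    and inj: "inj_on ((*\<^sub>v) (f v)) (carrier_vec (?d v))"
    and ker: "(*\<^sub>v) (f v) ` carrier_vec (?d v) = mat_kernel (g v)"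
    and surj: "(*\<^sub>v) (g v) ` carrier_vec (?d v + ?c v) = carrier_vec (?c v)" if "v \<in> verts Q" for v
    using exact that unfolding short_exact_def quiver_hom_def by auto
  have fM: "f (head Q a) * M a = Y a * f (tail Q a)"
    and gY: "g (head Q a) * Y a = N a * g (tail Q a)" if "a \<in> arcs Q" for a
    using exact that unfolding short_exact_def quiver_hom_def by auto
  have "\<exists>G. G \<in> carrier_mat (?d v + ?c v) (?c v) \<and> g v * G = 1\<^sub>m (?c v)" if v: "v \<in> verts Q" for v
  proof (rule surj_imp_right_inverse[OF g[OF v]])
    show "\<exists>x\<in>carrier_vec (?d v + ?c v). g v *\<^sub>v x = y" if "y \<in> carrier_vec (?c v)" for y
      using that surj[OF v] by (metis imageE)
  qed blast
  then obtain G where G: "\<And>v. v \<in> verts Q \<Longrightarrow> G v \<in> carrier_mat (?d v + ?c v) (?c v)"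
    "\<And>v. v \<in> verts Q \<Longrightarrow> g v * G v = 1\<^sub>m (?c v)" by metis
  note d = carrier_matD[OF f] carrier_matD[OF g] carrier_matD[OF G(1)] carrier_matD[OF GL_carrier[OF C]]
  \<comment> \<open>Columns: the image of \<open>f v\<close> first, then the lifts of the columns of
    \<open>C v\<close>.\<close>
  define B where "B v = f v * ?E v + G v * C v * ?S v" for v
  have gf: "g v *\<^sub>v (f v *\<^sub>v x) = 0\<^sub>v (?c v)" if "v \<in> verts Q" "x \<in> carrier_vec (?d v)" for v x
    using ker[OF that(1)] that d by (auto simp: mat_kernel_def)
  have gf0: "g v * f v = 0\<^sub>m (?c v) (?d v)" if v: "v \<in> verts Q" for v
    by (rule mat_eqI_vec) (use gf[OF v] d[OF v] f[OF v] g[OF v] in \<open>auto simp: mat_vec_assoc intro!: eq_vecI\<close>)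
  have Bc: "B v \<in> carrier_mat (?d v + ?c v) (?d v + ?c v)" if "v \<in> verts Q" for v
    using d[OF that] by (auto simp: B_def intro!: carrier_matI)
  have gB: "g v * B v = C v * ?S v" if v: "v \<in> verts Q" for v
  proof -
    have "g v * B v = g v * (f v * ?E v) + g v * (G v * C v * ?S v)"
      unfolding B_def using d[OF v]
      by (intro mult_add_distrib_mat[of _ "?c v" "?d v + ?c v" _ "?d v + ?c v"]) (auto intro!: carrier_matI)
    also have "\<dots> = (g v * f v) * ?E v + (g v * G v) * (C v * ?S v)"
      using d[OF v] by (simp add: mat_assoc)
    also have "\<dots> = C v * ?S v"
      unfolding gf0[OF v] G(2)[OF v] using d[OF v]
      by (simp add: left_mult_zero_mat[OF carrier_matI] left_add_zero_mat[OF carrier_matI]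
        left_mult_one_mat[OF carrier_matI])
    finally show ?thesis .
  qed
  have BT: "B v * ?T v = f v" if v: "v \<in> verts Q" for v
  proof -
    have "B v * ?T v = f v * ?E v * ?T v + G v * C v * ?S v * ?T v"
      unfolding B_def using d[OF v]
      by (intro add_mult_distrib_mat[of _ "?d v + ?c v" "?d v + ?c v" _ _ "?d v"]) (auto intro!: carrier_matI)
    also have "\<dots> = f v * (?E v * ?T v) + (G v * C v) * (?S v * ?T v)"
      using d[OF v] by (simp add: mat_assoc)
    also have "\<dots> = f v"
      unfolding first_last_mult using d[OF v]
      by (simp add: right_mult_zero_mat[OF carrier_matI] right_add_zero_mat[OF carrier_matI]
        right_mult_one_mat[OF carrier_matI])
    finally show ?thesis .
  qed
  \<comment> \<open>If \<open>B v\<close> kills \<open>x\<close>, applying \<open>g v\<close> leaves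
    \<open>C v\<close> on the last coordinates, so these vanish; on the first coordinates
    \<open>B v\<close> is the injective \<open>f v\<close>.\<close>
  have B: "B v \<in> GL TYPE('k) (?d v + ?c v)" if v: "v \<in> verts Q" for v
  proof (rule inj_imp_GL[OF Bc[OF v]])
    fix x assume x: "x \<in> carrier_vec (?d v + ?c v)" and Bx: "B v *\<^sub>v x = 0\<^sub>v (?d v + ?c v)"
    note dB = carrier_matD[OF Bc[OF v]] and dx = carrier_vecD[OF x]
    let ?Ci = "GL_inv (?c v) (C v)"
    note Ci = carrier_matD[OF GL_inv_carrier[OF C[OF v]]]
    have "g v * B v *\<^sub>v x = 0\<^sub>v (?c v)"
      using Bx d[OF v] dB dx g[OF v] by (simp add: mat_vec_assoc mult_mat_zero_vec)
    then have "?Ci *\<^sub>v (C v *\<^sub>v (?S v *\<^sub>v x)) = ?Ci *\<^sub>v 0\<^sub>v (?c v)"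
      unfolding gB[OF v] using d[OF v] dx by (simp add: mat_vec_assoc)
    moreover have "?Ci *\<^sub>v 0\<^sub>v (?c v) = 0\<^sub>v (?c v)" using Ci by (simp add: mult_mat_zero_vec)
    moreover have "?Ci *\<^sub>v (C v *\<^sub>v (?S v *\<^sub>v x)) = (?Ci * C v) *\<^sub>v (?S v *\<^sub>v x)"
      using d[OF v] dx Ci by (simp add: mat_vec_assoc)
    moreover have "1\<^sub>m (?c v) *\<^sub>v (?S v *\<^sub>v x) = ?S v *\<^sub>v x"
      by (intro one_mult_mat_vec carrier_vecI) simp
    ultimately have Sx: "?S v *\<^sub>v x = 0\<^sub>v (?c v)" unfolding GL_inv_left[OF C[OF v]] by simp
    note x_eq = proj_last_kernel[OF x Sx]
    have Ex: "?E v *\<^sub>v x \<in> carrier_vec (?d v)" by (intro carrier_vecI) simp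
    have "f v *\<^sub>v (?E v *\<^sub>v x) = B v *\<^sub>v (?T v *\<^sub>v (?E v *\<^sub>v x))"
      unfolding BT[OF v, symmetric] using dB dx by (simp add: mat_vec_assoc)
    also have "\<dots> = f v *\<^sub>v 0\<^sub>v (?d v)"
      unfolding x_eq[symmetric] Bx using d[OF v] by (simp add: mult_mat_zero_vec)
    finally have Ex0: "?E v *\<^sub>v x = 0\<^sub>v (?d v)"
      using inj_onD[OF inj[OF v]] Ex by auto
    show "x = 0\<^sub>v (?d v + ?c v)"
      using x_eq unfolding Ex0 mult_mat_zero_vec[OF first_last_dim(2)] by simp
  qed
  define D where "D v = GL_inv (?d v + ?c v) (B v)" for v
  note dB = carrier_matD[OF Bc]
  have dD: "dim_row (D v) = ?d v + ?c v" "dim_col (D v) = ?d v + ?c v"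
    and BD: "B v * D v = 1\<^sub>m (?d v + ?c v)" "D v * B v = 1\<^sub>m (?d v + ?c v)" if "v \<in> verts Q" for v
    using carrier_matD[OF GL_inv_carrier[OF B[OF that]]]
      GL_inv_left[OF B[OF that]] GL_inv_right[OF B[OF that]] by (simp_all add: D_def)
  define X where "X = (\<lambda>a\<in>arcs Q. D (head Q a) * (Y a * B (tail Q a)))"
  have X: "X \<in> rep_space Q (\<lambda>v. ?d v + ?c v)"
    unfolding X_def rep_space_def using dB dD by (auto intro!: carrier_matI)
  have YB: "Y a * B (tail Q a) = B (head Q a) * X a" if a: "a \<in> arcs Q" for a
  proof -
    have v: "head Q a \<in> verts Q" "tail Q a \<in> verts Q" using a by auto
    note dd = dB[OF v(1)] dB[OF v(2)] dD[OF v(1)] carrier_matD[OF rep_space_carrier[OF Y a]]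
    have "B (head Q a) * X a = (B (head Q a) * D (head Q a)) * (Y a * B (tail Q a))"
      using dd a by (simp add: X_def mat_assoc)
    then show ?thesis unfolding BD(1)[OF v(1)] using dd by (simp add: left_mult_one_mat[OF carrier_matI])
  qed
  have "word_triangular Q (i # w) X"
  proof (rule word_triangular_ConsI[OF X X'])
    fix a assume a: "a \<in> arcs Q"
    let ?h = "head Q a" and ?t = "tail Q a"
    have v: "?h \<in> verts Q" "?t \<in> verts Q" using a by auto
    note dd = dB[OF v(1)] dB[OF v(2)] dD[OF v(1)] carrier_matD[OF rep_space_carrier[OF Y a]] d[OF v(1)] d[OF v(2)]
      carrier_matD[OF rep_space_carrier[OF X a]] carrier_matD[OF rep_space_carrier[OF X'(1) a]]
      carrier_matD[OF rep_space_carrier[OF N a]] carrier_matD[OF rep_space_carrier[OF M a]]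
    let ?Ci = "GL_inv (?c ?h) (C ?h)"
    note Ci = carrier_matD[OF GL_inv_carrier[OF C[OF v(1)]]]
    \<comment> \<open>The equation is proved with the factor \<open>C ?h\<close> in front, where
      both sides can be expressed through \<open>g\<close> and \<open>N\<close>, and the invertible
      factor is cancelled afterwards.\<close>
    have "C ?h * (?S ?h * X a) = g ?h * (B ?h * X a)"
      using dd mat_assoc[of "C ?h" "?S ?h" "X a"] mat_assoc[of "g ?h" "B ?h" "X a"] gB[OF v(1)] by simp
    also have "\<dots> = (g ?h * Y a) * B ?t" unfolding YB[OF a, symmetric] using dd by (simp add: mat_assoc)
    also have "\<dots> = N a * (g ?t * B ?t)" unfolding gY[OF a] using dd by (simp add: mat_assoc)
    also have "\<dots> = (N a * C ?t) * ?S ?t" unfolding gB[OF v(2)] using dd by (simp add: mat_assoc)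
    also have "\<dots> = C ?h * (X' a * ?S ?t)" unfolding NC[OF a] using dd by (simp add: mat_assoc)
    finally have "?Ci * (C ?h * (?S ?h * X a)) = ?Ci * (C ?h * (X' a * ?S ?t))" by simp
    moreover have "?Ci * (C ?h * Z) = Z" if "dim_row Z = ?c ?h" for Z
      using mat_assoc[of ?Ci "C ?h" Z] that dd Ci GL_inv_left[OF C[OF v(1)]]
      by (simp add: left_mult_one_mat[OF carrier_matI])
    ultimately show "?S ?h * X a = X' a * ?S ?t" using dd by simp
    have "X a * ?T ?t = D ?h * (Y a * (B ?t * ?T ?t))"
      using dd a by (simp add: X_def mat_assoc)
    also have "\<dots> = D ?h * (f ?h * M a)" unfolding BT[OF v(2)] fM[OF a] ..
    \<comment> \<open>Without loops the two ends of \<open>a\<close> are not both \<open>i\<close>,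
      so either \<open>M a\<close> has no columns or the product runs over an empty inner
      dimension.\<close>
    also have "f ?h * M a = 0\<^sub>m (?d ?h + ?c ?h) (?d ?t)"
    proof (cases "?h = i")
      case True
      then have "?d ?t = 0" using no_loop[OF a] by (auto simp: simple_dim_def)
      then show ?thesis using dd by (intro eq_matI) auto
    next
      case False
      then have "?d ?h = 0" by (auto simp: simple_dim_def)
      then show ?thesis using dd by (intro eq_matI) (auto simp: scalar_prod_def)
    qed
    also have "D ?h * 0\<^sub>m (?d ?h + ?c ?h) (?d ?t) = 0\<^sub>m (?d ?h + ?c ?h) (?d ?t)"
      using dd by (intro right_mult_zero_mat) auto
    finally show "X a * ?T ?t = 0\<^sub>m (?d ?h + ?c ?h) (?d ?t)" .
  qed
  then show ?thesis
    unfolding word_flagged_def count_list_Cons_simple_dim using B X YB by blast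
qed

text \<open>Both sides unfold by the same recursion, since prepending a letter multiplies by a
  generator from the left; over the zero dimension vector the flag consists of empty
  matrices.\<close>

lemma word_value_iff_flagged:
  fixes Y :: "('a, 'k::field) quiver_rep"
  shows "Y \<in> snd (word_value Q w :: ('v, 'a, 'k) monoid_elem) \<longleftrightarrow>
    Y \<in> rep_space Q (count_list w) \<and> word_flagged Q w Y"
proof (induction w arbitrary: Y)
  case Nil
  have "word_flagged Q [] Y" if Y: "Y \<in> rep_space Q (\<lambda>v. 0)"
    unfolding word_flagged_def
  proof (intro exI conjI ballI)
    show "(1\<^sub>m 0 :: 'k mat) \<in> GL TYPE('k) (count_list [] v)" for v by (rule GL_I[of _ _ "1\<^sub>m 0"]) auto
    show "Y \<in> rep_space Q (count_list [])" using Y by (simp add: count_list.simps(1)[abs_def])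
    show "Y a * 1\<^sub>m 0 = 1\<^sub>m 0 * Y a" if "a \<in> arcs Q" for a
      using rep_space_carrier[OF Y that] by simp
  qed (simp add: word_triangular_def)
  moreover have "count_list [] = (\<lambda>v. 0)" by auto
  ultimately show ?case by (auto simp: snd_word_value)
next
  case (Cons i w)
  show ?case
    unfolding snd_word_value extension_product_def count_list_Cons_simple_dim
    using Cons.IH flagged_imp_extension[of Y i w] extension_imp_flagged[of Y i w] by blast
qed

end

subsection \<open>From positions to coordinates\<close>

text \<open>
  A basis of \<open>\<Oplus>\<^sub>v k\<^bsup>\<alpha> v\<^esup>\<close> is numbered by a bijection onto the pairs of a vertex \<open>v\<close> and a
  \<open>p < \<alpha> v\<close>. Both the order by vertices underlying \<^const>\<open>block_incl\<close> and the order of the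
  letters of a word are of this kind.
\<close>

definition coords :: "'v set \<Rightarrow> ('v \<Rightarrow> nat) \<Rightarrow> ('v \<times> nat) set" where
  "coords V \<alpha> = (SIGMA v:V. {..<\<alpha> v})"

text \<open>Rows and columns may be numbered by different bijections, so that a change of numbering
  is itself a matrix of this form and can be merged with a base change.\<close>

definition coord_mat :: "nat \<Rightarrow> (nat \<Rightarrow> 'c) \<Rightarrow> (nat \<Rightarrow> 'c) \<Rightarrow> ('c \<Rightarrow> 'c \<Rightarrow> 'k) \<Rightarrow> 'k mat" where
  "coord_mat n \<beta> \<gamma> f = mat n n (\<lambda>(i, j). f (\<beta> i) (\<gamma> j))"

lemma coord_mat_carrier [simp]: "coord_mat n \<beta> \<gamma> f \<in> carrier_mat n n"
  by (simp add: coord_mat_def)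

lemma coord_mat_dim [simp]: "dim_row (coord_mat n \<beta> \<gamma> f) = n" "dim_col (coord_mat n \<beta> \<gamma> f) = n"
  by (simp_all add: coord_mat_def)

lemma coord_mat_index [simp]: "i < n \<Longrightarrow> j < n \<Longrightarrow> coord_mat n \<beta> \<gamma> f $$ (i, j) = f (\<beta> i) (\<gamma> j)"
  by (simp add: coord_mat_def)

lemma coord_mat_cong:
  assumes "bij_betw \<beta> {..<n} I" "bij_betw \<gamma> {..<n} I"
    and "\<And>s t. s \<in> I \<Longrightarrow> t \<in> I \<Longrightarrow> f s t = g s t"
  shows "coord_mat n \<beta> \<gamma> f = coord_mat n \<beta> \<gamma> g"
  using assms bij_betwE[OF assms(1)] bij_betwE[OF assms(2)] by (auto simp: coord_mat_def intro!: eq_matI)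

text \<open>Reindexing along the bijection \<open>\<gamma>\<close> makes the inner numbering
  disappear: matrices multiply as kernels on the coordinate set.\<close>

lemma coord_mat_mult:
  fixes f g :: "'c \<Rightarrow> 'c \<Rightarrow> 'k::semiring_0"
  assumes "bij_betw \<gamma> {..<n} I"
  shows "coord_mat n \<beta> \<gamma> f * coord_mat n \<gamma> \<delta> g = coord_mat n \<beta> \<delta> (\<lambda>s t. \<Sum>r\<in>I. f s r * g r t)"
proof (rule eq_matI)
  fix i j assume "i < dim_row (coord_mat n \<beta> \<delta> (\<lambda>s t. \<Sum>r\<in>I. f s r * g r t))"
    "j < dim_col (coord_mat n \<beta> \<delta> (\<lambda>s t. \<Sum>r\<in>I. f s r * g r t))"
  then have ij: "i < n" "j < n" by (auto simp: coord_mat_def)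
  have "(coord_mat n \<beta> \<gamma> f * coord_mat n \<gamma> \<delta> g) $$ (i, j) = (\<Sum>k<n. f (\<beta> i) (\<gamma> k) * g (\<gamma> k) (\<delta> j))"
    using ij by (simp add: coord_mat_def scalar_prod_def atLeast0LessThan)
  also have "\<dots> = (\<Sum>r\<in>I. f (\<beta> i) r * g r (\<delta> j))"
    by (rule sum.reindex_bij_betw[OF assms])
  finally show "(coord_mat n \<beta> \<gamma> f * coord_mat n \<gamma> \<delta> g) $$ (i, j) =
      coord_mat n \<beta> \<delta> (\<lambda>s t. \<Sum>r\<in>I. f s r * g r t) $$ (i, j)"
    using ij by simp
qed (auto simp: coord_mat_def)

lemma sum_coords_single:
  assumes "finite V" "u \<in> V"
  shows "(\<Sum>r\<in>coords V \<alpha>. if fst r = u then h (snd r) else 0) = (\<Sum>k<\<alpha> u. h k)"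
proof -
  have "(\<Sum>r\<in>coords V \<alpha>. if fst r = u then h (snd r) else 0) = (\<Sum>v\<in>V. \<Sum>k<\<alpha> v. if v = u then h k else 0)"
    using assms(1) unfolding coords_def by (subst sum.Sigma) (auto simp: case_prod_beta)
  also have "\<dots> = (\<Sum>v\<in>V. if v = u then \<Sum>k<\<alpha> u. h k else 0)"
    by (intro sum.cong) auto
  finally show ?thesis using assms by simp
qed

definition path_entry :: "('v, 'a) pre_digraph \<Rightarrow> ('v \<Rightarrow> nat) \<Rightarrow> ('a, 'k::field) quiver_rep \<Rightarrow>
    ('v, 'a) path \<Rightarrow> 'v \<times> nat \<Rightarrow> 'v \<times> nat \<Rightarrow> 'k" where
  "path_entry Q \<alpha> X P s t =
     (if fst s = path_end Q P \<and> fst t = fst P then path_map \<alpha> X P $$ (snd s, snd t) else 0)"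

text \<open>A family such as an element of GL(\<alpha>), seen as a block diagonal endomorphism of
  the sum over all vertices.\<close>

definition diag_entry :: "('v \<Rightarrow> 'k::field mat) \<Rightarrow> 'v \<times> nat \<Rightarrow> 'v \<times> nat \<Rightarrow> 'k" where
  "diag_entry B s t = (if fst s = fst t then B (fst s) $$ (snd s, snd t) else 0)"

context acyclic_fin_digraph
begin

abbreviation index_set :: "('v \<Rightarrow> nat) \<Rightarrow> ('v \<times> nat) set" where
  "index_set \<equiv> coords (verts Q)"

text \<open>The arrows act from the left, so a start value other than the identity just stays as a
  right factor. In the induction \<open>c\<close> and \<open>B\<close> are generalised because the
  first arrow replaces \<open>B\<close> by \<open>X a * B\<close>, and the dimension of the partial
  product is carried along for associativity.\<close>

lemma fold_path_map:
  assumes X: "X \<in> rep_space Q \<alpha>" and p: "awalk u p v" and B: "B \<in> carrier_mat (\<alpha> u) c"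
  shows "fold (\<lambda>a B. X a * B) p B = path_map \<alpha> X (u, p) * B"
    and "path_map \<alpha> X (u, p) \<in> carrier_mat (\<alpha> v) (\<alpha> u)"
proof -
  have "(\<forall>c. \<forall>B\<in>carrier_mat (\<alpha> u) c. fold (\<lambda>a B. X a * B) p B = path_map \<alpha> X (u, p) * B) \<and>
      path_map \<alpha> X (u, p) \<in> carrier_mat (\<alpha> v) (\<alpha> u)"
    using p
  proof (induction p arbitrary: u)
    case Nil
    then show ?case by (auto simp: path_map_def awalk_Nil_iff left_mult_one_mat)
  next
    case (Cons a p)
    then have a: "a \<in> arcs Q" "u = tail Q a" and hp: "awalk (head Q a) p v" by (auto simp: awalk_Cons_iff)
    note Xa = rep_space_carrier[OF X a(1)]
    note IH = Cons.IH[OF hp, THEN conjunct1, rule_format] Cons.IH[OF hp, THEN conjunct2]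
    have pm: "path_map \<alpha> X (u, a # p) = path_map \<alpha> X (head Q a, p) * X a"
      using IH(1)[of "X a"] Xa a by (simp add: path_map_def right_mult_one_mat)
    have "fold (\<lambda>a B. X a * B) (a # p) B = path_map \<alpha> X (u, a # p) * B"
      if B: "B \<in> carrier_mat (\<alpha> u) c" for c B
    proof -
      have "X a * B \<in> carrier_mat (\<alpha> (head Q a)) c" using Xa B a by auto
      from IH(1)[OF this] show ?thesis using IH(2) Xa B a unfolding pm by (simp add: mat_assoc)
    qed
    then show ?case using IH(2) Xa a unfolding pm by auto
  qed
  then show "fold (\<lambda>a B. X a * B) p B = path_map \<alpha> X (u, p) * B"
    "path_map \<alpha> X (u, p) \<in> carrier_mat (\<alpha> v) (\<alpha> u)" using B by blast+
qed

lemma path_map_carrier: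
  assumes "X \<in> rep_space Q \<alpha>" "P \<in> paths Q"
  shows "path_map \<alpha> X P \<in> carrier_mat (\<alpha> (path_end Q P)) (\<alpha> (fst P))"
  using fold_path_map(2)[OF assms(1) path_awalk[OF assms(2)] one_carrier_mat] by simp

lemma path_map_comp:
  assumes X: "X \<in> rep_space Q \<alpha>" and P: "P \<in> paths Q" "P' \<in> paths Q" "path_end Q P' = fst P"
  shows "path_map \<alpha> X (path_comp P P') = path_map \<alpha> X P * path_map \<alpha> X P'"
  using fold_path_map(1)[OF X path_awalk[OF P(1)] path_map_carrier[OF X P(2), unfolded P(3)]]
  by (simp add: path_map_def)

lemma path_map_Cons:
  assumes X: "X \<in> rep_space Q \<alpha>" and p: "awalk (tail Q a) (a # p) v"
  shows "path_map \<alpha> X (tail Q a, a # p) = path_map \<alpha> X (head Q a, p) * X a"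
proof -
  have a: "a \<in> arcs Q" and hp: "awalk (head Q a) p v" using p by (auto simp: awalk_Cons_iff)
  show ?thesis
    using fold_path_map(1)[OF X hp rep_space_carrier[OF X a]] rep_space_carrier[OF X a]
    by (simp add: path_map_def right_mult_one_mat)
qed

lemma path_map_intertwine:
  assumes X: "X \<in> rep_space Q \<alpha>" and Y: "Y \<in> rep_space Q \<alpha>"
    and B: "\<And>v. v \<in> verts Q \<Longrightarrow> B v \<in> carrier_mat (\<alpha> v) (\<alpha> v)"
    and eq: "\<And>a. a \<in> arcs Q \<Longrightarrow> Y a * B (tail Q a) = B (head Q a) * X a"
    and p: "awalk u p v"
  shows "path_map \<alpha> Y (u, p) * B u = B v * path_map \<alpha> X (u, p)"
  using p
proof (induction p arbitrary: u)
  case Nil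
  then have "u = v" "v \<in> verts Q" by (auto simp: awalk_Nil_iff)
  then show ?case using B[of v] by (simp add: path_map_def)
next
  case (Cons a p)
  then have a: "a \<in> arcs Q" "u = tail Q a" and hp: "awalk (head Q a) p v" by (auto simp: awalk_Cons_iff)
  have v: "u \<in> verts Q" "v \<in> verts Q" "head Q a \<in> verts Q" using a hp by auto
  note d = carrier_matD[OF rep_space_carrier[OF X a(1)]] carrier_matD[OF rep_space_carrier[OF Y a(1)]]
    carrier_matD[OF B[OF v(1)]] carrier_matD[OF B[OF v(2)]] carrier_matD[OF B[OF v(3)]]
    carrier_matD[OF fold_path_map(2)[OF X hp one_carrier_mat]]
    carrier_matD[OF fold_path_map(2)[OF Y hp one_carrier_mat]]
  have "path_map \<alpha> Y (u, a # p) * B u = path_map \<alpha> Y (head Q a, p) * (Y a * B (tail Q a))"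
    using path_map_Cons[OF Y, of a p v] Cons.prems a d by (simp add: mat_assoc)
  also have "\<dots> = (path_map \<alpha> Y (head Q a, p) * B (head Q a)) * X a"
    unfolding eq[OF a(1)] using d by (simp add: mat_assoc)
  also have "\<dots> = B v * (path_map \<alpha> X (head Q a, p) * X a)"
    unfolding Cons.IH[OF hp] using d by (simp add: mat_assoc)
  also have "\<dots> = B v * path_map \<alpha> X (u, a # p)"
    using path_map_Cons[OF X, of a p v] Cons.prems a by simp
  finally show ?case .
qed

lemma coord_sum_mult:
  fixes A C :: "'k::field mat"
  assumes "A \<in> carrier_mat m (\<alpha> u)" "C \<in> carrier_mat (\<alpha> u) l" "i < m" "j < l" "u \<in> verts Q"
  shows "(\<Sum>r\<in>index_set \<alpha>. if fst r = u then A $$ (i, snd r) * C $$ (snd r, j) else 0) = (A * C) $$ (i, j)"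
  using assms by (simp add: sum_coords_single[where h = "\<lambda>k. A $$ (i, k) * C $$ (k, j)"]
    scalar_prod_def atLeast0LessThan)

lemma path_entry_comp:
  assumes X: "X \<in> rep_space Q \<alpha>" and P: "P \<in> paths Q" "P' \<in> paths Q"
    and st: "s \<in> index_set \<alpha>" "t \<in> index_set \<alpha>"
  shows "(\<Sum>r\<in>index_set \<alpha>. path_entry Q \<alpha> X P s r * path_entry Q \<alpha> X P' r t) =
    (if path_end Q P' = fst P then path_entry Q \<alpha> X (path_comp P P') s t else 0)"
proof (cases "path_end Q P' = fst P \<and> fst s = path_end Q P \<and> fst t = fst P'")
  case True
  then have e: "path_end Q P' = fst P" "fst s = path_end Q P" "fst t = fst P'" by auto
  have "(\<Sum>r\<in>index_set \<alpha>. path_entry Q \<alpha> X P s r * path_entry Q \<alpha> X P' r t) =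
    (\<Sum>r\<in>index_set \<alpha>. if fst r = fst P then path_map \<alpha> X P $$ (snd s, snd r) * path_map \<alpha> X P' $$ (snd r, snd t) else 0)"
    using e by (intro sum.cong) (auto simp: path_entry_def)
  also have "\<dots> = (path_map \<alpha> X P * path_map \<alpha> X P') $$ (snd s, snd t)"
    using st e path_verts(1)[OF P(1)]
    by (intro coord_sum_mult[where \<alpha> = \<alpha> and u = "fst P", OF path_map_carrier[OF X P(1)] path_map_carrier[OF X P(2), unfolded e(1)]])
      (auto simp: coords_def)
  also have "\<dots> = path_entry Q \<alpha> X (path_comp P P') s t"
    using e path_map_comp[OF X P e(1)] path_compI(2)[OF P e(1)] by (simp add: path_entry_def)
  finally show ?thesis using e by simp
next
  case False
  have "(\<Sum>r\<in>index_set \<alpha>. path_entry Q \<alpha> X P s r * path_entry Q \<alpha> X P' r t) = 0"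
    using False by (intro sum.neutral) (auto simp: path_entry_def)
  moreover have "path_entry Q \<alpha> X (path_comp P P') s t = 0" if "path_end Q P' = fst P"
    using False path_compI(2)[OF P that] that by (auto simp: path_entry_def)
  ultimately show ?thesis by simp
qed

lemma path_entry_diag:
  assumes X: "X \<in> rep_space Q \<alpha>" and P: "P \<in> paths Q"
    and B: "\<And>v. v \<in> verts Q \<Longrightarrow> B v \<in> carrier_mat (\<alpha> v) (\<alpha> v)"
    and st: "s \<in> index_set \<alpha>" "t \<in> index_set \<alpha>"
  shows "(\<Sum>r\<in>index_set \<alpha>. path_entry Q \<alpha> X P s r * diag_entry B r t) =
      (if fst s = path_end Q P \<and> fst t = fst P then (path_map \<alpha> X P * B (fst P)) $$ (snd s, snd t) else 0)"
      (is "?l1 = ?r1")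
    and "(\<Sum>r\<in>index_set \<alpha>. diag_entry B s r * path_entry Q \<alpha> X P r t) =
      (if fst s = path_end Q P \<and> fst t = fst P then (B (path_end Q P) * path_map \<alpha> X P) $$ (snd s, snd t) else 0)"
      (is "?l2 = ?r2")
proof -
  note v = path_verts[OF P]
  have "?l1 = (if fst s = path_end Q P \<and> fst t = fst P then
      \<Sum>r\<in>index_set \<alpha>. if fst r = fst P then path_map \<alpha> X P $$ (snd s, snd r) * B (fst P) $$ (snd r, snd t) else 0
     else 0)"
    by (auto simp: path_entry_def diag_entry_def intro!: sum.cong sum.neutral)
  also have "\<dots> = ?r1"
    using coord_sum_mult[where \<alpha> = \<alpha> and u = "fst P" and i = "snd s" and j = "snd t",
      OF path_map_carrier[OF X P] B[OF v(1)] _ _ v(1)] st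
    by (auto simp: coords_def)
  finally show "?l1 = ?r1" .
  have "?l2 = (if fst s = path_end Q P \<and> fst t = fst P then
      \<Sum>r\<in>index_set \<alpha>. if fst r = path_end Q P then B (path_end Q P) $$ (snd s, snd r) * path_map \<alpha> X P $$ (snd r, snd t) else 0
     else 0)"
    by (auto simp: path_entry_def diag_entry_def intro!: sum.cong sum.neutral)
  also have "\<dots> = ?r2"
    using coord_sum_mult[where \<alpha> = \<alpha> and u = "path_end Q P" and i = "snd s" and j = "snd t",
      OF B[OF v(2)] path_map_carrier[OF X P] _ _ v(2)] st
    by (auto simp: coords_def)
  finally show "?l2 = ?r2" .
qed

lemma diag_entry_mult:
  assumes "\<And>v. v \<in> verts Q \<Longrightarrow> B v \<in> carrier_mat (\<alpha> v) (\<alpha> v)"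
    and "\<And>v. v \<in> verts Q \<Longrightarrow> C v \<in> carrier_mat (\<alpha> v) (\<alpha> v)"
    and st: "s \<in> index_set \<alpha>" "t \<in> index_set \<alpha>"
  shows "(\<Sum>r\<in>index_set \<alpha>. diag_entry B s r * diag_entry C r t) = diag_entry (\<lambda>v. B v * C v) s t"
proof -
  have "(\<Sum>r\<in>index_set \<alpha>. diag_entry B s r * diag_entry C r t) =
    (if fst s = fst t then
      \<Sum>r\<in>index_set \<alpha>. if fst r = fst s then B (fst s) $$ (snd s, snd r) * C (fst s) $$ (snd r, snd t) else 0
     else 0)"
    by (auto simp: diag_entry_def intro!: sum.cong sum.neutral)
  also have "\<dots> = diag_entry (\<lambda>v. B v * C v) s t"
    using coord_sum_mult[where \<alpha> = \<alpha> and u = "fst s" and i = "snd s" and j = "snd t", OF assms(1,2)] st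
    by (auto simp: coords_def diag_entry_def)
  finally show ?thesis .
qed

text \<open>One construction for two numberings: with the order of vertices it gives
  \<open>rep_of_quiver_rep\<close>, with the order of letters the matrices that can be
  triangular.\<close>

definition index_rep :: "nat \<Rightarrow> (nat \<Rightarrow> 'v \<times> nat) \<Rightarrow> ('v \<Rightarrow> nat) \<Rightarrow> ('a, 'k::field) quiver_rep \<Rightarrow> ('v, 'a, 'k) alg_rep" where
  "index_rep n \<beta> \<alpha> X = lin_ext n (\<lambda>P. coord_mat n \<beta> \<beta> (path_entry Q \<alpha> X P))"

lemma index_rep_path_elem:
  "P \<in> paths Q \<Longrightarrow> index_rep n \<beta> \<alpha> X (path_elem P) = coord_mat n \<beta> \<beta> (path_entry Q \<alpha> X P)"
  unfolding index_rep_def by (rule lin_ext_path_elem) auto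

lemma index_rep_n:
  assumes X: "X \<in> rep_space Q \<alpha>" and \<beta>: "bij_betw \<beta> {..<n} (index_set \<alpha>)"
  shows "index_rep n \<beta> \<alpha> X \<in> rep_n Q n"
  unfolding index_rep_def
proof (rule lin_ext_rep_n)
  fix P P' assume P: "P \<in> paths Q" "P' \<in> paths Q"
  have "(\<Sum>r\<in>index_set \<alpha>. path_entry Q \<alpha> X P (\<beta> i) r * path_entry Q \<alpha> X P' r (\<beta> j)) =
      (if path_end Q P' = fst P then path_entry Q \<alpha> X (path_comp P P') (\<beta> i) (\<beta> j) else 0)"
    if "i < n" "j < n" for i j
    using that bij_betwE[OF \<beta>] by (intro path_entry_comp[OF X P]) auto
  then show "coord_mat n \<beta> \<beta> (path_entry Q \<alpha> X P) * coord_mat n \<beta> \<beta> (path_entry Q \<alpha> X P') =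
    (if path_end Q P' = fst P then coord_mat n \<beta> \<beta> (path_entry Q \<alpha> X (path_comp P P')) else 0\<^sub>m n n)"
    unfolding coord_mat_mult[OF \<beta>] by (intro eq_matI) auto
next
  fix i j assume ij: "i < n" "j < n"
  then have I: "\<beta> i \<in> index_set \<alpha>" "\<beta> j \<in> index_set \<alpha>" using bij_betwE[OF \<beta>] by auto
  then have v: "fst (\<beta> i) \<in> verts Q" "snd (\<beta> i) < \<alpha> (fst (\<beta> i))" "snd (\<beta> j) < \<alpha> (fst (\<beta> j))"
    by (auto simp: coords_def)
  have "(\<Sum>v\<in>verts Q. coord_mat n \<beta> \<beta> (path_entry Q \<alpha> X (v, [])) $$ (i, j)) =
    (\<Sum>v\<in>verts Q. if v = fst (\<beta> i) then of_bool (\<beta> i = \<beta> j) else 0)"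
    using ij v by (intro sum.cong) (auto simp: path_entry_def trivial_path path_map_def prod_eq_iff)
  also have "\<dots> = of_bool (\<beta> i = \<beta> j)" using v by simp
  also have "\<dots> = of_bool (i = j)" using ij \<beta> by (auto simp: bij_betw_def inj_on_def)
  finally show "(\<Sum>v\<in>verts Q. coord_mat n \<beta> \<beta> (path_entry Q \<alpha> X (v, [])) $$ (i, j)) = of_bool (i = j)" .
qed auto

text \<open>Conjugacy has two sources, handled at once: the base change \<open>B\<close> and the
  change of numbering from \<open>\<gamma>\<close> to \<open>\<beta>\<close>. The conjugating matrix
  is block diagonal in coordinates, with rows numbered by \<open>\<beta>\<close> and columns by
  \<open>\<gamma>\<close>. With identity blocks the lemma compares numberings alone.\<close>

lemma index_rep_base_change:
  fixes X Y :: "('a, 'k::field) quiver_rep"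
  assumes X: "X \<in> rep_space Q \<alpha>" and Y: "Y \<in> rep_space Q \<alpha>"
    and \<beta>: "bij_betw \<beta> {..<n} (index_set \<alpha>)" and \<gamma>: "bij_betw \<gamma> {..<n} (index_set \<alpha>)"
    and B: "\<And>v. v \<in> verts Q \<Longrightarrow> B v \<in> GL TYPE('k) (\<alpha> v)"
    and eq: "\<And>a. a \<in> arcs Q \<Longrightarrow> Y a * B (tail Q a) = B (head Q a) * X a"
  shows "\<exists>G\<in>GL TYPE('k) n. index_rep n \<beta> \<alpha> Y = conj_rep n G (index_rep n \<gamma> \<alpha> X)"
proof -
  define C where "C v = GL_inv (\<alpha> v) (B v)" for v
  note Bc = GL_carrier[OF B] and Cc = GL_inv_carrier[OF B, folded C_def]
  define G where "G = coord_mat n \<beta> \<gamma> (diag_entry B)"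
  define H where "H = coord_mat n \<gamma> \<beta> (diag_entry C)"
  have "G * H = coord_mat n \<beta> \<beta> (diag_entry (\<lambda>v. B v * C v))"
    unfolding G_def H_def coord_mat_mult[OF \<gamma>]
    by (rule coord_mat_cong[OF \<beta> \<beta>]) (rule diag_entry_mult[where \<alpha> = \<alpha>, OF Bc Cc])
  also have "\<dots> = 1\<^sub>m n"
  proof (rule eq_matI)
    fix i j assume "i < dim_row (1\<^sub>m n :: 'k mat)" "j < dim_col (1\<^sub>m n :: 'k mat)"
    then have ij: "i < n" "j < n" by auto
    then have "\<beta> i \<in> index_set \<alpha>" "\<beta> j \<in> index_set \<alpha>" using bij_betwE[OF \<beta>] by auto
    then have "diag_entry (\<lambda>v. B v * C v) (\<beta> i) (\<beta> j) = of_bool (\<beta> i = \<beta> j)"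
      using GL_inv_right[OF B, folded C_def]
      by (auto simp: diag_entry_def coords_def prod_eq_iff simp del: index_mult_mat)
    also have "\<dots> = of_bool (i = j)" using ij \<beta> by (auto simp: bij_betw_def inj_on_def)
    finally show "coord_mat n \<beta> \<beta> (diag_entry (\<lambda>v. B v * C v)) $$ (i, j) = 1\<^sub>m n $$ (i, j)"
      using ij by simp
  qed (auto simp: coord_mat_def)
  finally have GH: "G * H = 1\<^sub>m n" .
  have Gc: "G \<in> carrier_mat n n" and Hc: "H \<in> carrier_mat n n" by (simp_all add: G_def H_def)
  note GL = GL_I[OF Gc Hc GH]
  have "index_rep n \<beta> \<alpha> Y = conj_rep n G (index_rep n \<gamma> \<alpha> X)"
  proof (rule rep_n_eqI[OF index_rep_n[OF Y \<beta>] conj_rep_n[OF index_rep_n[OF X \<gamma>] GL(1)]])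
    fix P assume P: "P \<in> paths Q"
    let ?RY = "coord_mat n \<beta> \<beta> (path_entry Q \<alpha> Y P)" and ?RX = "coord_mat n \<gamma> \<gamma> (path_entry Q \<alpha> X P)"
    have "?RY * G = coord_mat n \<beta> \<gamma> (\<lambda>s t. if fst s = path_end Q P \<and> fst t = fst P
        then (path_map \<alpha> Y P * B (fst P)) $$ (snd s, snd t) else 0)"
      unfolding G_def coord_mat_mult[OF \<beta>]
      by (rule coord_mat_cong[OF \<beta> \<gamma>]) (rule path_entry_diag(1)[OF Y P Bc])
    also have "path_map \<alpha> Y P * B (fst P) = B (path_end Q P) * path_map \<alpha> X P"
      using path_map_intertwine[OF X Y Bc eq path_awalk[OF P]] by simp
    also have "coord_mat n \<beta> \<gamma> (\<lambda>s t. if fst s = path_end Q P \<and> fst t = fst P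
        then (B (path_end Q P) * path_map \<alpha> X P) $$ (snd s, snd t) else 0) = G * ?RX"
      unfolding G_def coord_mat_mult[OF \<gamma>]
      by (rule coord_mat_cong[OF \<beta> \<gamma>]) (rule path_entry_diag(2)[OF X P Bc, symmetric])
    finally have "?RY * G * H = G * ?RX * H" by simp
    moreover have "?RY * G * H = ?RY"
      using Gc Hc GH assoc_mult_mat[of ?RY n n G n H n] right_mult_one_mat[of ?RY n n] by simp
    ultimately show "index_rep n \<beta> \<alpha> Y (path_elem P) = conj_rep n G (index_rep n \<gamma> \<alpha> X) (path_elem P)"
      by (simp add: conj_rep_def index_rep_path_elem[OF P] path_elem_carrier[OF P] GL(2))
  qed
  then show ?thesis using GL(1) by blast
qed

end

section \<open>The numbering of coordinates by vertices\<close>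

lemma block_offset:
  fixes \<alpha> :: "'v \<Rightarrow> nat"
  assumes "distinct vs"
  shows "v \<in> set vs \<Longrightarrow> p < \<alpha> v \<Longrightarrow>
      sum_list (map \<alpha> (takeWhile (\<lambda>u. u \<noteq> v) vs)) + p < sum_list (map \<alpha> vs)"
    and "k < sum_list (map \<alpha> vs) \<Longrightarrow> \<exists>v\<in>set vs. \<exists>p<\<alpha> v.
      sum_list (map \<alpha> (takeWhile (\<lambda>u. u \<noteq> v) vs)) + p = k"
proof -
  show "v \<in> set vs \<Longrightarrow> p < \<alpha> v \<Longrightarrow>
      sum_list (map \<alpha> (takeWhile (\<lambda>u. u \<noteq> v) vs)) + p < sum_list (map \<alpha> vs)"
    by (induction vs) auto
  show "k < sum_list (map \<alpha> vs) \<Longrightarrow> \<exists>v\<in>set vs. \<exists>p<\<alpha> v.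
      sum_list (map \<alpha> (takeWhile (\<lambda>u. u \<noteq> v) vs)) + p = k"
    using assms
  proof (induction vs arbitrary: k)
    case (Cons u vs)
    show ?case
    proof (cases "k < \<alpha> u")
      case True
      then show ?thesis by (intro bexI[of _ u] exI[of _ k]) auto
    next
      case False
      with Cons.prems have "k - \<alpha> u < sum_list (map \<alpha> vs)" by auto
      then obtain v p where vp: "v \<in> set vs" "p < \<alpha> v"
        "sum_list (map \<alpha> (takeWhile (\<lambda>u. u \<noteq> v) vs)) + p = k - \<alpha> u"
        using Cons.IH[of "k - \<alpha> u"] Cons.prems(2) by (metis distinct.simps(2))
      then have "u \<noteq> v" using Cons.prems(2) by auto
      with vp False show ?thesis by (intro bexI[of _ v] exI[of _ p]) auto
    qed
  qed simp
qed

text \<open>The offset map hits every index and its domain has as many elements, so it is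
  invertible; the second property is the form in which entries of \<open>block_incl\<close> are
  tested.\<close>

lemma block_bij:
  fixes \<alpha> :: "'v \<Rightarrow> nat"
  assumes "distinct vs"
  obtains \<beta> where "bij_betw \<beta> {..<sum_list (map \<alpha> vs)} (coords (set vs) \<alpha>)"
    and "\<And>v p i. v \<in> set vs \<Longrightarrow> p < \<alpha> v \<Longrightarrow> i < sum_list (map \<alpha> vs) \<Longrightarrow>
      \<beta> i = (v, p) \<longleftrightarrow> i = sum_list (map \<alpha> (takeWhile (\<lambda>u. u \<noteq> v) vs)) + p"
proof -
  define h where "h = (\<lambda>(v, p). sum_list (map \<alpha> (takeWhile (\<lambda>u. u \<noteq> v) vs)) + p)"
  let ?I = "coords (set vs) \<alpha>" and ?n = "sum_list (map \<alpha> vs)"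
  have img: "h ` ?I = {..<?n}"
  proof
    show "h ` ?I \<subseteq> {..<?n}"
      using block_offset(1)[OF assms, of _ _ \<alpha>] by (auto simp: h_def coords_def)
    show "{..<?n} \<subseteq> h ` ?I"
    proof
      fix k assume "k \<in> {..<?n}"
      then obtain v p where "v \<in> set vs" "p < \<alpha> v" "h (v, p) = k"
        using block_offset(2)[OF assms, of k \<alpha>] by (auto simp: h_def)
      then show "k \<in> h ` ?I" by (intro image_eqI[of _ _ "(v, p)"]) (auto simp: coords_def)
    qed
  qed
  have fin: "finite ?I" by (simp add: coords_def)
  have "card ?I = ?n"
    using assms by (simp add: coords_def sum_list_distinct_conv_sum_set)
  then have inj: "inj_on h ?I" using img fin by (intro eq_card_imp_inj_on) auto
  show thesis
  proof (rule that[of "the_inv_into ?I h"])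
    show "bij_betw (the_inv_into ?I h) {..<?n} ?I"
      using bij_betw_the_inv_into[of h ?I] inj img by (simp add: bij_betw_def)
    show "the_inv_into ?I h i = (v, p) \<longleftrightarrow> i = sum_list (map \<alpha> (takeWhile (\<lambda>u. u \<noteq> v) vs)) + p"
      if "v \<in> set vs" "p < \<alpha> v" "i < ?n" for v p i
    proof -
      have "(v, p) \<in> ?I" using that by (auto simp: coords_def)
      moreover have "i \<in> h ` ?I" using img that by simp
      ultimately have "the_inv_into ?I h i = (v, p) \<longleftrightarrow> i = h (v, p)"
        using the_inv_into_f_f[OF inj] f_the_inv_into_f[OF inj] by metis
      then show ?thesis by (simp add: h_def)
    qed
  qed
qed

context acyclic_fin_digraph
begin

text \<open>An entry of \<open>block_incl\<close> is 1 exactly when the row has the coordinate of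
  the column, so the two outer factors of \<open>path_block\<close> select a single entry of the
  matrix of the path.\<close>

lemma rep_of_quiver_rep_eq:
  fixes X :: "('a, 'k::field) quiver_rep"
  assumes vs: "distinct vs" "set vs = verts Q" and X: "X \<in> rep_space Q \<alpha>"
  obtains \<beta> where "bij_betw \<beta> {..<total_dim Q \<alpha>} (index_set \<alpha>)"
    and "rep_of_quiver_rep Q vs \<alpha> X = index_rep (total_dim Q \<alpha>) \<beta> \<alpha> X"
proof -
  let ?n = "total_dim Q \<alpha>"
  have n: "?n = sum_list (map \<alpha> vs)"
    using vs by (simp add: total_dim_def sum_list_distinct_conv_sum_set)
  obtain \<beta> where \<beta>: "bij_betw \<beta> {..<?n} (index_set \<alpha>)"
    and off: "\<And>v p i. v \<in> verts Q \<Longrightarrow> p < \<alpha> v \<Longrightarrow> i < ?n \<Longrightarrow>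
      \<beta> i = (v, p) \<longleftrightarrow> i = sum_list (map \<alpha> (takeWhile (\<lambda>u. u \<noteq> v) vs)) + p"
    using block_bij[OF vs(1), of \<alpha>] unfolding n vs(2) by blast
  have block: "path_block Q vs \<alpha> X P $$ (i, j) = path_entry Q \<alpha> X P (\<beta> i) (\<beta> j)"
    if P: "P \<in> paths Q" and ij: "i < ?n" "j < ?n" for P i j
  proof -
    let ?v = "path_end Q P" and ?u = "fst P" and ?A = "path_map \<alpha> X P"
    note v = path_verts[OF P] and A = path_map_carrier[OF X P]
    have incl: "(block_incl Q vs \<alpha> w :: 'k mat) $$ (i, k) = of_bool (\<beta> i = (w, k))"
      if "w \<in> verts Q" "i < ?n" "k < \<alpha> w" for w i k
      using that by (simp add: block_incl_def off)
    have I: "\<beta> i \<in> index_set \<alpha>" "\<beta> j \<in> index_set \<alpha>" using bij_betwE[OF \<beta>] ij by auto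
    have single: "(\<Sum>k<\<alpha> w. of_bool (\<beta> i = (w, k)) * f k) = (if fst (\<beta> i) = w then f (snd (\<beta> i)) else 0)"
      if "\<beta> i \<in> index_set \<alpha>" for w i and f :: "nat \<Rightarrow> 'k"
    proof -
      have "(\<Sum>k<\<alpha> w. of_bool (\<beta> i = (w, k)) * f k) =
          (\<Sum>k<\<alpha> w. if k = snd (\<beta> i) then if fst (\<beta> i) = w then f k else 0 else 0)"
        by (intro sum.cong) (auto simp: prod_eq_iff)
      then show ?thesis using that by (auto simp: coords_def)
    qed
    have dims: "dim_row (block_incl Q vs \<alpha> w :: 'k mat) = ?n" "dim_col (block_incl Q vs \<alpha> w :: 'k mat) = \<alpha> w" for w
      by (simp_all add: block_incl_def)
    have *: "(block_incl Q vs \<alpha> ?v * ?A) $$ (i, l) = (if fst (\<beta> i) = ?v then ?A $$ (snd (\<beta> i), l) else 0)"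
      if "l < \<alpha> ?u" for l
    proof -
      have "(block_incl Q vs \<alpha> ?v * ?A) $$ (i, l) = (\<Sum>k<\<alpha> ?v. of_bool (\<beta> i = (?v, k)) * ?A $$ (k, l))"
        using A ij that v(2) by (simp add: dims incl scalar_prod_def atLeast0LessThan)
      then show ?thesis using single[OF I(1)] by simp
    qed
    have "path_block Q vs \<alpha> X P $$ (i, j) =
        (\<Sum>l<\<alpha> ?u. (block_incl Q vs \<alpha> ?v * ?A) $$ (i, l) * of_bool (\<beta> j = (?u, l)))"
      unfolding path_block_def using A ij v(1)
      by (subst index_mult_mat(1)) (simp_all add: dims incl scalar_prod_def atLeast0LessThan del: index_mult_mat(1))
    also have "\<dots> = (\<Sum>l<\<alpha> ?u. of_bool (\<beta> j = (?u, l)) * (if fst (\<beta> i) = ?v then ?A $$ (snd (\<beta> i), l) else 0))"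
      using * by (intro sum.cong) (auto simp: mult.commute)
    also have "\<dots> = path_entry Q \<alpha> X P (\<beta> i) (\<beta> j)"
      unfolding single[OF I(2)] by (simp add: path_entry_def)
    finally show ?thesis .
  qed
  have "rep_of_quiver_rep Q vs \<alpha> X = index_rep ?n \<beta> \<alpha> X"
    unfolding rep_of_quiver_rep_def index_rep_def lin_ext_def
  proof (intro restrict_ext eq_matI)
    fix x :: "('v, 'a, 'k) path_alg" and i j
    assume x: "x \<in> carrier kQ"
    assume "i < dim_row (mat ?n ?n (\<lambda>ij. \<Sum>p\<in>paths Q. x p * coord_mat ?n \<beta> \<beta> (path_entry Q \<alpha> X p) $$ ij))"
      "j < dim_col (mat ?n ?n (\<lambda>ij. \<Sum>p\<in>paths Q. x p * coord_mat ?n \<beta> \<beta> (path_entry Q \<alpha> X p) $$ ij))"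
    then have ij: "i < ?n" "j < ?n" by auto
    have "(\<Sum>p | x p \<noteq> 0. x p * path_block Q vs \<alpha> X p $$ (i, j)) =
      (\<Sum>p\<in>paths Q. x p * path_entry Q \<alpha> X p (\<beta> i) (\<beta> j))"
      using x finite_paths block[OF _ ij]
      by (intro sum.mono_neutral_cong_left) (auto simp: carrier_path_algebra)
    then show "mat ?n ?n (\<lambda>ij. \<Sum>p | x p \<noteq> 0. x p * path_block Q vs \<alpha> X p $$ ij) $$ (i, j) =
      mat ?n ?n (\<lambda>ij. \<Sum>p\<in>paths Q. x p * coord_mat ?n \<beta> \<beta> (path_entry Q \<alpha> X p) $$ ij) $$ (i, j)"
      using ij by simp
  qed auto
  with that[OF \<beta>] show thesis by blast
qed

section \<open>The associated bundle of a word\<close>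

abbreviation word_rep :: "'v list \<Rightarrow> ('a, 'k::field) quiver_rep \<Rightarrow> ('v, 'a, 'k) alg_rep" where
  "word_rep w \<equiv> index_rep (length w) (word_index w) (count_list w)"

lemma total_dim_count_list: "w \<in> lists (verts Q) \<Longrightarrow> total_dim Q (count_list w) = length w"
  unfolding total_dim_def by (rule sum_count_set) auto

lemma bij_word_index_set:
  "w \<in> lists (verts Q) \<Longrightarrow> bij_betw (word_index w) {..<length w} (index_set (count_list w))"
  unfolding coords_def by (rule bij_word_index) auto

text \<open>The conjugation by GL(\<alpha>) hidden in \<open>word_flagged\<close> and the passage
  from the order of vertices to that of letters are both realised by elements of GL_n, which the
  factor \<open>g\<close> absorbs.\<close>

lemma assoc_bundle_word:
  fixes \<rho> :: "('v, 'a, 'k::field) alg_rep"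
  assumes vs: "distinct vs" "set vs = verts Q" and w: "w \<in> lists (verts Q)"
  shows "(n, \<rho>) \<in> assoc_bundle Q vs (word_value Q w) \<longleftrightarrow> n = length w \<and>
    (\<exists>g\<in>GL TYPE('k) n. \<exists>X\<in>rep_space Q (count_list w). word_triangular Q w X \<and> \<rho> = conj_rep n g (word_rep w X))"
proof -
  let ?\<alpha> = "count_list w" and ?A = "snd (word_value Q w :: ('v, 'a, 'k) monoid_elem)"
  note n = total_dim_count_list[OF w] and \<gamma> = bij_word_index_set[OF w]
  have wv: "word_value Q w = (?\<alpha>, ?A)" by (simp add: prod_eq_iff fst_word_value)
  have bdl: "(n, \<rho>) \<in> assoc_bundle Q vs (word_value Q w) \<longleftrightarrow> n = length w \<and>
    (\<exists>g\<in>GL TYPE('k) n. \<exists>Y\<in>?A. \<rho> = conj_rep n g (rep_of_quiver_rep Q vs ?\<alpha> Y))"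
  proof -
    have "(n, \<rho>) \<in> assoc_bundle Q vs (word_value Q w) \<longleftrightarrow> (\<exists>g Y. n = length w \<and>
      \<rho> = conj_rep (length w) g (rep_of_quiver_rep Q vs ?\<alpha> Y) \<and> g \<in> GL TYPE('k) (length w) \<and> Y \<in> ?A)"
      by (subst wv) (simp add: assoc_bundle_def n conj_rep_def)
    then show ?thesis by blast
  qed
  have one: "(1\<^sub>m (?\<alpha> v) :: 'k mat) \<in> GL TYPE('k) (?\<alpha> v)" for v
    by (rule GL_I[of _ _ "1\<^sub>m (?\<alpha> v)"]) auto
  show ?thesis
    unfolding bdl
  proof (intro conj_cong refl iffI)
    assume n': "n = length w"
    assume "\<exists>g\<in>GL TYPE('k) n. \<exists>Y\<in>?A. \<rho> = conj_rep n g (rep_of_quiver_rep Q vs ?\<alpha> Y)"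
    then obtain g Y where g: "g \<in> GL TYPE('k) n" and YA: "Y \<in> ?A"
      and \<rho>: "\<rho> = conj_rep n g (rep_of_quiver_rep Q vs ?\<alpha> Y)" by blast
    have Y: "Y \<in> rep_space Q ?\<alpha>" "word_flagged Q w Y"
      using YA unfolding word_value_iff_flagged by auto
    obtain B X where B: "\<forall>v\<in>verts Q. B v \<in> GL TYPE('k) (?\<alpha> v)" and X: "X \<in> rep_space Q ?\<alpha>"
      "word_triangular Q w X" and YB: "\<forall>a\<in>arcs Q. Y a * B (tail Q a) = B (head Q a) * X a"
      using Y(2) unfolding word_flagged_def by blast
    obtain \<beta> where \<beta>: "bij_betw \<beta> {..<n} (index_set ?\<alpha>)"
      "rep_of_quiver_rep Q vs ?\<alpha> Y = index_rep n \<beta> ?\<alpha> Y"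
      using rep_of_quiver_rep_eq[OF vs Y(1)] unfolding n n' by blast
    obtain G where G: "G \<in> GL TYPE('k) n" "index_rep n \<beta> ?\<alpha> Y = conj_rep n G (word_rep w X)"
      using index_rep_base_change[OF X(1) Y(1) \<beta>(1) \<gamma>[folded n'], of B] B YB unfolding n' by blast
    have "\<rho> = conj_rep n (g * G) (word_rep w X)"
      unfolding \<rho> \<beta>(2) G(2) using conj_rep_conj_rep[OF index_rep_n[OF X(1) \<gamma>, folded n'] g G(1)] n' by simp
    then show "\<exists>g\<in>GL TYPE('k) n. \<exists>X\<in>rep_space Q ?\<alpha>. word_triangular Q w X \<and> \<rho> = conj_rep n g (word_rep w X)"
      using GL_mult(1)[OF g G(1)] X by blast
  next
    assume n': "n = length w"
    assume "\<exists>g\<in>GL TYPE('k) n. \<exists>X\<in>rep_space Q ?\<alpha>. word_triangular Q w X \<and> \<rho> = conj_rep n g (word_rep w X)"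
    then obtain g X where g: "g \<in> GL TYPE('k) n" and X: "X \<in> rep_space Q ?\<alpha>" "word_triangular Q w X"
      and \<rho>: "\<rho> = conj_rep n g (word_rep w X)" by blast
    have eq1: "X a * 1\<^sub>m (?\<alpha> (tail Q a)) = 1\<^sub>m (?\<alpha> (head Q a)) * X a" if "a \<in> arcs Q" for a
      using rep_space_carrier[OF X(1) that] by simp
    have "word_flagged Q w X"
      unfolding word_flagged_def
      by (rule exI[of _ "\<lambda>v. 1\<^sub>m (?\<alpha> v)"], rule exI[of _ X]) (use one X eq1 in blast)
    then have XA: "X \<in> ?A" using X(1) unfolding word_value_iff_flagged by simp
    obtain \<beta> where \<beta>: "bij_betw \<beta> {..<n} (index_set ?\<alpha>)"
      "rep_of_quiver_rep Q vs ?\<alpha> X = index_rep n \<beta> ?\<alpha> X"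
      using rep_of_quiver_rep_eq[OF vs X(1)] unfolding n n' by blast
    \<comment> \<open>Base change by identity blocks, that is, only the numbering is
      changed.\<close>
    obtain G where G: "G \<in> GL TYPE('k) n" "word_rep w X = conj_rep n G (index_rep n \<beta> ?\<alpha> X)"
      using index_rep_base_change[OF X(1) X(1) \<gamma>[folded n'] \<beta>(1), of "\<lambda>v. 1\<^sub>m (?\<alpha> v)"] one eq1
      unfolding n' by blast
    have "\<rho> = conj_rep n (g * G) (rep_of_quiver_rep Q vs ?\<alpha> X)"
      unfolding \<rho> \<beta>(2) G(2) by (rule conj_rep_conj_rep[OF index_rep_n[OF X(1) \<beta>(1)] g G(1)])
    then show "\<exists>g\<in>GL TYPE('k) n. \<exists>Y\<in>?A. \<rho> = conj_rep n g (rep_of_quiver_rep Q vs ?\<alpha> Y)"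
      using GL_mult(1)[OF g G(1)] XA by blast
  qed
qed

subsection \<open>Triangular representations of the path algebra\<close>

text \<open>The last clause says that every basis vector is supported at one vertex. Triangularity
  alone permits idempotents with entries above the diagonal, and then no representation of the
  quiver could be read off in these coordinates.\<close>

definition triangular_alg_rep :: "'v list \<Rightarrow> ('v, 'a, 'k::field) alg_rep \<Rightarrow> bool" where
  "triangular_alg_rep w \<sigma> \<longleftrightarrow>
    (\<forall>x\<in>carrier kQ. \<forall>i<length w. \<sigma> x $$ (i, i) = x (w ! i, []) \<and> (\<forall>j<i. \<sigma> x $$ (i, j) = 0)) \<and>
    (\<forall>v\<in>verts Q. \<forall>i<length w. \<forall>j<length w. i \<noteq> j \<longrightarrow> \<sigma> (path_elem (v, [])) $$ (i, j) = 0)"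

lemma word_index_inj:
  "w \<in> lists (verts Q) \<Longrightarrow> i < length w \<Longrightarrow> j < length w \<Longrightarrow> w ! i = w ! j \<Longrightarrow>
    snd (word_index w i) = snd (word_index w j) \<Longrightarrow> i = j"
  using bij_word_index_set[of w] unfolding bij_betw_def inj_on_def by (auto simp: prod_eq_iff)

text \<open>A nonzero entry of a product of arrows comes from a chain of nonzero entries, and by
  triangularity every arrow in the chain strictly lowers the position.\<close>

lemma path_map_triangular:
  assumes w: "w \<in> lists (verts Q)" and X: "X \<in> rep_space Q (count_list w)" and tri: "word_triangular Q w X"
    and p: "awalk u p v" and ij: "i < length w" "w ! i = v" "j < length w" "w ! j = u"
    and nz: "path_map (count_list w) X (u, p) $$ (snd (word_index w i), snd (word_index w j)) \<noteq> 0"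
  shows "i \<le> j \<and> (p \<noteq> [] \<longrightarrow> i < j)"
  using p ij(3,4) nz
proof (induction p arbitrary: u j)
  case Nil
  then have "u = v" by (auto simp: awalk_Nil_iff)
  then have "snd (word_index w i) = snd (word_index w j)"
    using Nil word_index_less[OF ij(1)] word_index_less[of j w] ij(2)
    by (auto simp: path_map_def split: if_splits)
  then have "i = j" using word_index_inj[OF w ij(1), of j] ij(2) Nil \<open>u = v\<close> by simp
  then show ?case by simp
next
  case (Cons a p)
  let ?c = "count_list w" and ?h = "head Q a"
  have a: "a \<in> arcs Q" "u = tail Q a" and hp: "awalk ?h p v" using Cons.prems by (auto simp: awalk_Cons_iff)
  let ?M = "path_map ?c X (?h, p)"
  have M: "?M \<in> carrier_mat (?c v) (?c ?h)" by (rule fold_path_map(2)[OF X hp one_carrier_mat])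
  have "path_map ?c X (u, a # p) $$ (snd (word_index w i), snd (word_index w j)) =
    (\<Sum>k<?c ?h. ?M $$ (snd (word_index w i), k) * X a $$ (k, snd (word_index w j)))"
    using path_map_Cons[OF X, of a p v] Cons.prems(1) a M rep_space_carrier[OF X a(1)]
      word_index_less[OF ij(1)] word_index_less[OF Cons.prems(2)] ij(2) Cons.prems(3)
    by (simp add: scalar_prod_def atLeast0LessThan)
  with Cons.prems(4) have "(\<Sum>k<?c ?h. ?M $$ (snd (word_index w i), k) * X a $$ (k, snd (word_index w j))) \<noteq> 0"
    by simp
  then obtain k where k: "k < ?c ?h" "?M $$ (snd (word_index w i), k) * X a $$ (k, snd (word_index w j)) \<noteq> 0"
    by (metis (no_types, lifting) lessThan_iff sum.not_neutral_contains_not_neutral)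
  \<comment> \<open>The intermediate coordinate \<open>k\<close> belongs to some letter, whose
    position \<open>l\<close> is the next one in the chain.\<close>
  obtain l where l: "l < length w" "w ! l = ?h" "snd (word_index w l) = k"
    using word_index_surj[OF k(1)] by blast
  have "i \<le> l" using Cons.IH[OF hp l(1,2)] k l(3) by auto
  moreover have "\<not> j \<le> l"
  proof
    assume "j \<le> l"
    then have "X a $$ (snd (word_index w l), snd (word_index w j)) = 0"
      using tri a l Cons.prems(3) unfolding word_triangular_def by blast
    then show False using k l(3) by simp
  qed
  ultimately show ?case by simp
qed

lemma path_entry_trivial:
  assumes "w \<in> lists (verts Q)" "i < length w" "j < length w"
  shows "path_entry Q (count_list w) X (v, []) (word_index w i) (word_index w j) = of_bool (i = j \<and> w ! i = v)"
proof (cases "w ! i = v \<and> w ! j = v")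
  case True
  then show ?thesis
    using word_index_less[OF assms(2)] word_index_less[OF assms(3)] word_index_inj[OF assms]
    by (auto simp: path_entry_def trivial_path path_map_def)
next
  case False
  then show ?thesis by (auto simp: path_entry_def trivial_path)
qed

text \<open>Nontrivial paths lie strictly above the diagonal, so a diagonal entry receives only the
  coefficient of the trivial path at its letter.\<close>

lemma word_rep_triangular:
  fixes X :: "('a, 'k::field) quiver_rep"
  assumes w: "w \<in> lists (verts Q)" and X: "X \<in> rep_space Q (count_list w)" and tri: "word_triangular Q w X"
  shows "triangular_alg_rep w (word_rep w X)"
proof -
  let ?pe = "\<lambda>P i j. path_entry Q (count_list w) X P (word_index w i) (word_index w j)"
  have entry: "word_rep w X x $$ (i, j) = (\<Sum>P\<in>paths Q. x P * ?pe P i j)"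
    if "x \<in> carrier kQ" "i < length w" "j < length w" for x i j
    using that by (simp add: index_rep_def lin_ext_def)
  have pe: "i \<le> j \<and> (snd P \<noteq> [] \<longrightarrow> i < j)" if "P \<in> paths Q" "?pe P i j \<noteq> 0" "i < length w" "j < length w" for P i j
    using path_map_triangular[OF w X tri path_awalk[OF that(1)] that(3) _ that(4)] that(2)
    by (auto simp: path_entry_def split: if_splits)
  have triv: "?pe (v, []) i j = of_bool (i = j \<and> w ! i = v)" if "i < length w" "j < length w" for v i j
    by (rule path_entry_trivial[OF w that])
  show ?thesis
    unfolding triangular_alg_rep_def
  proof (intro conjI ballI allI impI)
    fix x :: "('v, 'a, 'k) path_alg" and i assume x: "x \<in> carrier kQ" and i: "i < length w"
    have "x P * ?pe P i i = (if P = (w ! i, []) then x P else 0)" if P: "P \<in> paths Q" for P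
    proof (cases "snd P = []")
      case True
      then obtain v where "P = (v, [])" by (cases P) auto
      then show ?thesis using triv[OF i i, of v] by simp
    next
      case False
      then show ?thesis using pe[OF P _ i i] by auto
    qed
    then have "word_rep w X x $$ (i, i) = (\<Sum>P\<in>paths Q. if P = (w ! i, []) then x P else 0)"
      unfolding entry[OF x i i] by (intro sum.cong) auto
    then show "word_rep w X x $$ (i, i) = x (w ! i, [])"
      using finite_paths x by (simp add: carrier_path_algebra)
    fix j assume j: "j < i"
    then have j': "j < length w" using i by simp
    show "word_rep w X x $$ (i, j) = 0"
      unfolding entry[OF x i j'] using pe[OF _ _ i j'] j by (intro sum.neutral) fastforce
  next
    fix v i j assume v: "v \<in> verts Q" and ij: "i < length w" "j < length w" "i \<noteq> j"
    have "word_rep w X (path_elem (v, [])) $$ (i, j) = ?pe (v, []) i j"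
      using v ij trivial_path by (simp add: index_rep_path_elem)
    then show "word_rep w X (path_elem (v, [])) $$ (i, j) = 0" using triv ij by simp
  qed
qed

text \<open>\<open>X\<close> collects the relevant blocks of the matrices of the arrows. Both
  representations agree on trivial paths, which triangularity and the diagonal idempotents determine
  completely, then on arrows, and hence on all paths by multiplicativity.\<close>

lemma triangular_alg_rep_word_rep:
  fixes \<sigma> :: "('v, 'a, 'k::field) alg_rep"
  assumes w: "w \<in> lists (verts Q)" and \<sigma>: "\<sigma> \<in> rep_n Q (length w)" and tri: "triangular_alg_rep w \<sigma>"
  shows "\<exists>X\<in>rep_space Q (count_list w). word_triangular Q w X \<and> \<sigma> = word_rep w X"
proof -
  let ?c = "count_list w" and ?n = "length w"
  note \<gamma> = bij_word_index_set[OF w]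
  \<comment> \<open>The position of the letter that carries a given coordinate.\<close>
  define pos where "pos v p = inv_into {..<?n} (word_index w) (v, p)" for v p
  have pos: "pos (w ! i) (snd (word_index w i)) = i" if "i < ?n" for i
  proof -
    have "(w ! i, snd (word_index w i)) = word_index w i" by (simp add: prod_eq_iff)
    then show ?thesis using that \<gamma> unfolding pos_def bij_betw_def by (simp add: inv_into_f_f)
  qed
  define arc where "arc a = (path_elem (tail Q a, [a]) :: ('v, 'a, 'k) path_alg)" for a
  define X where "X = (\<lambda>a\<in>arcs Q. mat (?c (head Q a)) (?c (tail Q a))
    (\<lambda>(p, q). \<sigma> (arc a) $$ (pos (head Q a) p, pos (tail Q a) q)))"
  have X: "X \<in> rep_space Q ?c" by (auto simp: X_def rep_space_def)
  have Xe: "X a $$ (snd (word_index w i), snd (word_index w j)) = \<sigma> (arc a) $$ (i, j)"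
    if "a \<in> arcs Q" "i < ?n" "j < ?n" "w ! i = head Q a" "w ! j = tail Q a" for a i j
    using that word_index_less[of i w] word_index_less[of j w] pos[of i] pos[of j] by (simp add: X_def)
  have arc_carrier: "arc a \<in> carrier kQ" if "a \<in> arcs Q" for a
    unfolding arc_def using path_elem_carrier arc_path(1)[OF that] by blast
  have "word_triangular Q w X"
    unfolding word_triangular_def
  proof (intro ballI allI impI)
    fix a i j assume a: "a \<in> arcs Q" and ij: "i < ?n" "j \<le> i" "w ! i = head Q a" "w ! j = tail Q a"
    \<comment> \<open>An arrow has no component at a trivial path, so its diagonal entries vanish as
      well; this covers \<open>i = j\<close>.\<close>
    have "arc a (w ! i, []) = 0" by (simp add: arc_def path_elem_def)
    then have "\<sigma> (arc a) $$ (i, j) = 0"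
      using tri arc_carrier[OF a] ij unfolding triangular_alg_rep_def by (cases "i = j") auto
    then show "X a $$ (snd (word_index w i), snd (word_index w j)) = 0"
      using Xe[OF a] ij by simp
  qed
  moreover have "\<sigma> = word_rep w X"
  proof (rule rep_n_eqI[OF \<sigma> index_rep_n[OF X \<gamma>]])
    have triv: "\<sigma> (path_elem (v, [])) = mat ?n ?n (\<lambda>(i, j). of_bool (i = j \<and> w ! i = v))" if v: "v \<in> verts Q" for v
    proof (rule eq_matI)
      have c: "path_elem (v, []) \<in> carrier kQ" using path_elem_carrier trivial_path v by blast
      note cc = carrier_matD[OF rep_nD(1)[OF \<sigma> this]]
      show "\<sigma> (path_elem (v, [])) $$ (i, j) = mat ?n ?n (\<lambda>(i, j). of_bool (i = j \<and> w ! i = v)) $$ (i, j)"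
        if "i < dim_row (mat ?n ?n (\<lambda>(i, j). of_bool (i = j \<and> w ! i = v)))"
          "j < dim_col (mat ?n ?n (\<lambda>(i, j). of_bool (i = j \<and> w ! i = v)))" for i j
        using that tri c v unfolding triangular_alg_rep_def by (cases "i = j") (auto simp: path_elem_def)
      show "dim_row (\<sigma> (path_elem (v, []))) = dim_row (mat ?n ?n (\<lambda>(i, j). of_bool (i = j \<and> w ! i = v)))"
        "dim_col (\<sigma> (path_elem (v, []))) = dim_col (mat ?n ?n (\<lambda>(i, j). of_bool (i = j \<and> w ! i = v)))"
        using cc by simp_all
    qed
    have arcs: "\<sigma> (arc a) = word_rep w X (arc a)" if a: "a \<in> arcs Q" for a
    proof (rule eq_matI)
      note ap = arc_path[OF a]
      have v: "head Q a \<in> verts Q" "tail Q a \<in> verts Q" using a by auto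
      let ?h = "path_elem (head Q a, []) :: ('v, 'a, 'k) path_alg" and ?t = "path_elem (tail Q a, []) :: ('v, 'a, 'k) path_alg"
      have c: "?h \<in> carrier kQ" "?t \<in> carrier kQ"
        using path_elem_carrier trivial_path v by blast+
      note s = rep_nD(1)[OF \<sigma> arc_carrier[OF a]]
      \<comment> \<open>An arrow is fixed by the idempotents of its two ends; as these act by
        diagonal 0-1 matrices, all entries outside the block of the arrow vanish.\<close>
      have "?h \<otimes>\<^bsub>kQ\<^esub> arc a = arc a"
        unfolding arc_def using mult_path_elem[of "(head Q a, [])" "(tail Q a, [a])"] ap v trivial_path by simp
      then have l: "\<sigma> ?h * \<sigma> (arc a) = \<sigma> (arc a)" using rep_nD(2)[OF \<sigma> c(1) arc_carrier[OF a]] by simp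
      have "arc a \<otimes>\<^bsub>kQ\<^esub> ?t = arc a"
        unfolding arc_def using mult_path_elem[of "(tail Q a, [a])" "(tail Q a, [])"] ap v trivial_path by simp
      then have r: "\<sigma> (arc a) * \<sigma> ?t = \<sigma> (arc a)" using rep_nD(2)[OF \<sigma> arc_carrier[OF a] c(2)] by simp
      have X1: "word_rep w X (arc a) $$ (i, j) = (if w ! i = head Q a \<and> w ! j = tail Q a then \<sigma> (arc a) $$ (i, j) else 0)"
        if "i < ?n" "j < ?n" for i j
      proof -
        have "path_map ?c X (tail Q a, [a]) = X a"
          using rep_space_carrier[OF X a] by (simp add: path_map_def right_mult_one_mat)
        then show ?thesis using that ap Xe[OF a that] by (simp add: arc_def index_rep_path_elem path_entry_def)
      qed
      have dw: "word_rep w X (arc a) \<in> carrier_mat ?n ?n"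
        by (rule rep_nD(1)[OF index_rep_n[OF X \<gamma>] arc_carrier[OF a]])
      show "dim_row (\<sigma> (arc a)) = dim_row (word_rep w X (arc a))"
        "dim_col (\<sigma> (arc a)) = dim_col (word_rep w X (arc a))" using s dw by auto
      fix i j assume "i < dim_row (word_rep w X (arc a))" "j < dim_col (word_rep w X (arc a))"
      then have ij: "i < ?n" "j < ?n" using dw by auto
      have "\<sigma> (arc a) $$ (i, j) = 0" if "w ! i \<noteq> head Q a"
      proof -
        have "(\<sigma> ?h * \<sigma> (arc a)) $$ (i, j) = 0"
          using that ij s unfolding triv[OF v(1)] by (auto simp: scalar_prod_def intro!: sum.neutral)
        then show ?thesis unfolding l .
      qed
      moreover have "\<sigma> (arc a) $$ (i, j) = 0" if "w ! j \<noteq> tail Q a"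
      proof -
        have "(\<sigma> (arc a) * \<sigma> ?t) $$ (i, j) = 0"
          using that ij s unfolding triv[OF v(2)] by (auto simp: scalar_prod_def intro!: sum.neutral)
        then show ?thesis unfolding r .
      qed
      ultimately show "\<sigma> (arc a) $$ (i, j) = word_rep w X (arc a) $$ (i, j)"
        unfolding X1[OF ij] by auto
    qed
    have "\<sigma> (path_elem (u, p)) = word_rep w X (path_elem (u, p))" if "awalk u p v" for u p v
      using that
    proof (induction p arbitrary: u)
      case Nil
      then have u: "u \<in> verts Q" by (auto simp: awalk_Nil_iff)
      show ?case
        unfolding triv[OF u] index_rep_path_elem[OF trivial_path(1)[THEN iffD2, OF u]]
        by (rule eq_matI) (simp_all add: path_entry_trivial[OF w])
    next
      case (Cons a p)
      then have a: "a \<in> arcs Q" "u = tail Q a" and hp: "awalk (head Q a) p v" by (auto simp: awalk_Cons_iff)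
      have P: "(head Q a, p) \<in> paths Q" "(tail Q a, [a]) \<in> paths Q" "path_end Q (tail Q a, [a]) = head Q a"
        using paths_I(1)[OF hp] arc_path[OF a(1)] by auto
      have e: "path_elem (u, a # p) = path_elem (head Q a, p) \<otimes>\<^bsub>kQ\<^esub> arc a"
        by (simp add: arc_def mult_path_elem[OF P(1,2)] P(3) a)
      have "\<sigma> (path_elem (u, a # p)) = \<sigma> (path_elem (head Q a, p)) * \<sigma> (arc a)"
        unfolding e by (rule rep_nD(2)[OF \<sigma> path_elem_carrier[OF P(1)] arc_carrier[OF a(1)]])
      also have "\<dots> = word_rep w X (path_elem (head Q a, p)) * word_rep w X (arc a)"
        by (simp only: Cons.IH[OF hp] arcs[OF a(1)])
      also have "\<dots> = word_rep w X (path_elem (u, a # p))"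
        unfolding e by (rule rep_nD(2)[OF index_rep_n[OF X \<gamma>] path_elem_carrier[OF P(1)] arc_carrier[OF a(1)], symmetric])
      finally show ?case .
    qed
    then show "\<sigma> (path_elem P) = word_rep w X (path_elem P)" if "P \<in> paths Q" for P
      using path_awalk[OF that] by (cases P) simp
  qed
  ultimately show ?thesis using X by blast
qed

text \<open>The basis given by the columns of \<open>g\<close> is adapted to a Jordan--Hoelder filtration of type \<open>w\<close>.\<close>

definition has_word_basis :: "'v list \<Rightarrow> nat \<Rightarrow> ('v, 'a, 'k::field) alg_rep \<Rightarrow> bool" where
  "has_word_basis w n \<rho> \<longleftrightarrow> \<rho> \<in> rep_n Q n \<and> n = length w \<and>
    (\<exists>g\<in>GL TYPE('k) n. \<exists>\<sigma>\<in>rep_n Q n. triangular_alg_rep w \<sigma> \<and> \<rho> = conj_rep n g \<sigma>)"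

lemma assoc_bundle_iff_word_basis:
  fixes \<rho> :: "('v, 'a, 'k::field) alg_rep"
  assumes vs: "distinct vs" "set vs = verts Q" and w: "w \<in> lists (verts Q)"
  shows "(n, \<rho>) \<in> assoc_bundle Q vs (word_value Q w) \<longleftrightarrow> has_word_basis w n \<rho>"
proof
  assume "(n, \<rho>) \<in> assoc_bundle Q vs (word_value Q w)"
  then obtain g X where n: "n = length w" and g: "g \<in> GL TYPE('k) n" and X: "X \<in> rep_space Q (count_list w)"
    "word_triangular Q w X" and \<rho>: "\<rho> = conj_rep n g (word_rep w X)"
    unfolding assoc_bundle_word[OF assms] by blast
  note R = index_rep_n[OF X(1) bij_word_index_set[OF w], folded n]
  show "has_word_basis w n \<rho>"
    unfolding has_word_basis_def using conj_rep_n[OF R g] word_rep_triangular[OF w X] R g n \<rho> by blast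
next
  assume "has_word_basis w n \<rho>"
  then obtain g \<sigma> where n: "n = length w" and g: "g \<in> GL TYPE('k) n" and \<sigma>: "\<sigma> \<in> rep_n Q n"
    "triangular_alg_rep w \<sigma>" "\<rho> = conj_rep n g \<sigma>"
    unfolding has_word_basis_def by blast
  show "(n, \<rho>) \<in> assoc_bundle Q vs (word_value Q w)"
    unfolding assoc_bundle_word[OF assms]
    using triangular_alg_rep_word_rep[OF w \<sigma>(1)[unfolded n] \<sigma>(2)] g n \<sigma>(3) by blast
qed

end

subsection \<open>Simple subquotients\<close>

lemma vec_add_diff_cancel:
  fixes u v :: "'k::field vec"
  assumes "u \<in> carrier_vec n" "v \<in> carrier_vec n"
  shows "u + v - v = u"
  using assms by (auto intro!: eq_vecI)

lemma smult_mat_vec: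
  fixes A :: "'k::field mat"
  shows "u \<in> carrier_vec (dim_col A) \<Longrightarrow> (c \<cdot>\<^sub>m A) *\<^sub>v u = c \<cdot>\<^sub>v (A *\<^sub>v u)"
  by (intro eq_vecI) (auto simp: scalar_prod_def sum_distrib_left mult.assoc)

definition coset :: "'k::field vec set \<Rightarrow> 'k vec \<Rightarrow> 'k vec set" where
  "coset N u = (\<lambda>h. h + u) ` N"

context acyclic_fin_digraph
begin

text \<open>Closure under scalars and negatives is derived instead of listed: multiples of the unit
  of the algebra act as scalars.\<close>

definition invariant_subspace :: "nat \<Rightarrow> ('v, 'a, 'k::field) alg_rep \<Rightarrow> 'k vec set \<Rightarrow> bool" where
  "invariant_subspace n \<rho> N \<longleftrightarrow> N \<subseteq> carrier_vec n \<and> 0\<^sub>v n \<in> N \<and> (\<forall>u\<in>N. \<forall>v\<in>N. u + v \<in> N) \<and>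
     (\<forall>x\<in>carrier kQ. \<forall>u\<in>N. \<rho> x *\<^sub>v u \<in> N)"

lemma scalar_action:
  assumes \<rho>: "\<rho> \<in> rep_n Q n" and u: "u \<in> carrier_vec n"
  shows "\<rho> (c \<odot>\<^bsub>kQ\<^esub> \<one>\<^bsub>kQ\<^esub>) *\<^sub>v u = c \<cdot>\<^sub>v u"
proof -
  have "\<rho> (c \<odot>\<^bsub>kQ\<^esub> \<one>\<^bsub>kQ\<^esub>) = c \<cdot>\<^sub>m 1\<^sub>m n"
    using rep_nD(4)[OF \<rho> carrier_closed(4), of c] rep_nD(5)[OF \<rho>] by (simp add: smult_path_algebra)
  then show ?thesis using u by (simp add: smult_mat_vec)
qed

lemma invariant_subspaceD:
  assumes \<rho>: "\<rho> \<in> rep_n Q n" and N: "invariant_subspace n \<rho> N"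
  shows "u \<in> N \<Longrightarrow> u \<in> carrier_vec n" "0\<^sub>v n \<in> N" "u \<in> N \<Longrightarrow> v \<in> N \<Longrightarrow> u + v \<in> N"
    and "x \<in> carrier kQ \<Longrightarrow> u \<in> N \<Longrightarrow> \<rho> x *\<^sub>v u \<in> N"
    and "u \<in> N \<Longrightarrow> c \<cdot>\<^sub>v u \<in> N" "u \<in> N \<Longrightarrow> v \<in> N \<Longrightarrow> u - v \<in> N"
proof -
  show c: "u \<in> N \<Longrightarrow> u \<in> carrier_vec n" and "0\<^sub>v n \<in> N" and add: "u \<in> N \<Longrightarrow> v \<in> N \<Longrightarrow> u + v \<in> N"
    and act: "x \<in> carrier kQ \<Longrightarrow> u \<in> N \<Longrightarrow> \<rho> x *\<^sub>v u \<in> N" for u v x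
    using N by (auto simp: invariant_subspace_def)
  show smult: "c \<cdot>\<^sub>v u \<in> N" if "u \<in> N" for u c
    using act[OF carrier_closed(3)[OF carrier_closed(4)] that, of c] scalar_action[OF \<rho> c[OF that], of c]
    by simp
  show "u - v \<in> N" if "u \<in> N" "v \<in> N"
  proof -
    have "u - v = u + (-1) \<cdot>\<^sub>v v" using c that by (auto intro!: eq_vecI)
    then show ?thesis using add smult that by simp
  qed
qed

text \<open>The substance is the additive inverse: in the underlying record it is a definite
  description, which has to be identified with multiplication by -1 before closure under scalars
  applies.\<close>

lemma submodule_rep_module:
  assumes \<rho>: "\<rho> \<in> rep_n Q n"
  shows "Module.submodule N kQ (rep_module (n, \<rho>)) \<longleftrightarrow>
    invariant_subspace n \<rho> N"
proof
  assume "Module.submodule N kQ (rep_module (n, \<rho>))"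
  then interpret Module.submodule N kQ "rep_module (n, \<rho>)" .
  show "invariant_subspace n \<rho> N"
    using subset m_closed one_closed smult_closed
    by (auto simp: rep_module_def invariant_subspace_def)
next
  assume N: "invariant_subspace n \<rho> N"
  note D = invariant_subspaceD[OF \<rho> N]
  have inv: "inv\<^bsub>add_monoid (rep_module (n, \<rho>))\<^esub> u = (-1) \<cdot>\<^sub>v u" if "u \<in> carrier_vec n" for u
    unfolding m_inv_def
  proof (rule the_equality)
    show "(-1) \<cdot>\<^sub>v u \<in> carrier (add_monoid (rep_module (n, \<rho>))) \<and>
      u \<otimes>\<^bsub>add_monoid (rep_module (n, \<rho>))\<^esub> ((-1) \<cdot>\<^sub>v u) = \<one>\<^bsub>add_monoid (rep_module (n, \<rho>))\<^esub> \<and>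
      ((-1) \<cdot>\<^sub>v u) \<otimes>\<^bsub>add_monoid (rep_module (n, \<rho>))\<^esub> u = \<one>\<^bsub>add_monoid (rep_module (n, \<rho>))\<^esub>"
      using that by (auto simp: rep_module_def intro!: eq_vecI)
    fix y assume "y \<in> carrier (add_monoid (rep_module (n, \<rho>))) \<and>
      u \<otimes>\<^bsub>add_monoid (rep_module (n, \<rho>))\<^esub> y = \<one>\<^bsub>add_monoid (rep_module (n, \<rho>))\<^esub> \<and>
      y \<otimes>\<^bsub>add_monoid (rep_module (n, \<rho>))\<^esub> u = \<one>\<^bsub>add_monoid (rep_module (n, \<rho>))\<^esub>"
    then have y: "y \<in> carrier_vec n" "u + y = 0\<^sub>v n" by (auto simp: rep_module_def)
    show "y = (-1) \<cdot>\<^sub>v u"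
    proof (rule eq_vecI)
      fix i assume "i < dim_vec ((-1) \<cdot>\<^sub>v u)"
      then have i: "i < n" using that by simp
      then have "u $ i + y $ i = 0" using arg_cong[OF y(2), of "\<lambda>v. v $ i"] that y(1) by simp
      then show "y $ i = ((-1) \<cdot>\<^sub>v u) $ i" using i that by (simp add: eq_neg_iff_add_eq_0 add.commute)
    qed (use y that in auto)
  qed
  show "Module.submodule N kQ (rep_module (n, \<rho>))"
  proof (intro Module.submodule.intro subgroup.intro Module.submodule_axioms.intro)
    show "N \<subseteq> carrier (add_monoid (rep_module (n, \<rho>)))" using D(1) by (auto simp: rep_module_def)
    show "u \<otimes>\<^bsub>add_monoid (rep_module (n, \<rho>))\<^esub> v \<in> N" if "u \<in> N" "v \<in> N" for u v
      using D(3)[OF that] by (simp add: rep_module_def)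
    show "\<one>\<^bsub>add_monoid (rep_module (n, \<rho>))\<^esub> \<in> N" using D(2) by (simp add: rep_module_def)
    show "inv\<^bsub>add_monoid (rep_module (n, \<rho>))\<^esub> u \<in> N" if "u \<in> N" for u
      using inv[OF D(1)[OF that]] D(5)[OF that] by simp
    show "x \<odot>\<^bsub>rep_module (n, \<rho>)\<^esub> u \<in> N" if "x \<in> carrier kQ" "u \<in> N" for x u
      using D(4)[OF that] by (simp add: rep_module_def)
  qed
qed

lemma subquotient_rep_module:
  "carrier (subquotient (rep_module (n, \<rho>)) L N) = coset N ` L"
  "\<zero>\<^bsub>subquotient (rep_module (n, \<rho>)) L N\<^esub> = N"
  "C \<oplus>\<^bsub>subquotient (rep_module (n, \<rho>)) L N\<^esub> D = (\<Union>c\<in>C. \<Union>d\<in>D. {c + d})"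
  "x \<odot>\<^bsub>subquotient (rep_module (n, \<rho>)) L N\<^esub> C = (\<Union>c\<in>C. coset N (\<rho> x *\<^sub>v c))"
  unfolding subquotient_def quotient_module_def
  by (auto simp: rep_module_def coset_def A_RCOSETS_def' a_r_coset_def' set_add_def' image_def)

end

text \<open>One step of a filtration. The inclusion may be an equality, because strictness is a
  consequence of a spanning vector and is not always known when the step is set up.\<close>

locale invariant_pair = acyclic_fin_digraph Q for Q :: "('v, 'a) pre_digraph" +
  fixes n :: nat and \<rho> :: "('v, 'a, 'k::field) alg_rep" and L N :: "'k vec set"
  assumes \<rho>: "\<rho> \<in> rep_n Q n" and L: "invariant_subspace n \<rho> L" and N: "invariant_subspace n \<rho> N"
    and NL: "N \<subseteq> L"
begin

abbreviation LN :: "(('v, 'a, 'k) path_alg, 'k vec set) module" where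
  "LN \<equiv> subquotient (rep_module (n, \<rho>)) L N"

lemmas LD = invariant_subspaceD[OF \<rho> L]
lemmas ND = invariant_subspaceD[OF \<rho> N]

lemma coset_eq_iff:
  assumes "u \<in> carrier_vec n" "v \<in> carrier_vec n"
  shows "coset N u = coset N v \<longleftrightarrow> u - v \<in> N"
proof
  assume eq: "coset N u = coset N v"
  have "0\<^sub>v n + u \<in> coset N u" unfolding coset_def using ND(2) by (rule imageI)
  then obtain h where h: "h \<in> N" "0\<^sub>v n + u = h + v" unfolding eq by (auto simp: coset_def)
  have "u - v = h" using h ND(1)[OF h(1)] assms vec_add_diff_cancel[of h n v] by simp
  then show "u - v \<in> N" using h by simp
next
  assume uv: "u - v \<in> N"
  have sub: "coset N u \<subseteq> coset N v" if uv: "u - v \<in> N" "u \<in> carrier_vec n" "v \<in> carrier_vec n" for u v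
  proof
    fix z assume "z \<in> coset N u"
    then obtain h where h: "h \<in> N" "z = h + u" by (auto simp: coset_def)
    have "z = (h + (u - v)) + v" using h ND(1)[OF h(1)] uv(2,3) by (auto intro!: eq_vecI)
    then show "z \<in> coset N v" using ND(3)[OF h(1) uv(1)] by (auto simp: coset_def)
  qed
  have "v - u = (-1) \<cdot>\<^sub>v (u - v)" using assms by (auto intro!: eq_vecI)
  then have "v - u \<in> N" using ND(5)[OF uv, of "-1"] by simp
  then show "coset N u = coset N v" using sub uv assms by blast
qed

lemma coset_zero: "coset N (0\<^sub>v n) = N"
  using ND(1) by (force simp: coset_def image_def)

lemma coset_eq_N: "u \<in> carrier_vec n \<Longrightarrow> coset N u = N \<longleftrightarrow> u \<in> N"
  using coset_eq_iff[of u "0\<^sub>v n"] coset_zero by simp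

lemma coset_add:
  assumes "u \<in> carrier_vec n" "v \<in> carrier_vec n"
  shows "coset N u \<oplus>\<^bsub>LN\<^esub> coset N v = coset N (u + v)"
  unfolding subquotient_rep_module
proof
  show "(\<Union>c\<in>coset N u. \<Union>d\<in>coset N v. {c + d}) \<subseteq> coset N (u + v)"
  proof clarify
    fix c d assume "c \<in> coset N u" "d \<in> coset N v"
    then obtain h k where h: "h \<in> N" "c = h + u" and k: "k \<in> N" "d = k + v" by (auto simp: coset_def)
    have "c + d = (h + k) + (u + v)"
      using h k ND(1)[OF h(1)] ND(1)[OF k(1)] assms by (auto intro!: eq_vecI)
    then show "c + d \<in> coset N (u + v)" using ND(3)[OF h(1) k(1)] by (auto simp: coset_def)
  qed
  show "coset N (u + v) \<subseteq> (\<Union>c\<in>coset N u. \<Union>d\<in>coset N v. {c + d})"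
  proof
    fix z assume "z \<in> coset N (u + v)"
    then obtain h where h: "h \<in> N" "z = h + (u + v)" by (auto simp: coset_def)
    have "z = (h + u) + (0\<^sub>v n + v)" using h ND(1)[OF h(1)] assms by (auto intro!: eq_vecI)
    moreover have "h + u \<in> coset N u" "0\<^sub>v n + v \<in> coset N v" unfolding coset_def using h ND(2) by blast+
    ultimately show "z \<in> (\<Union>c\<in>coset N u. \<Union>d\<in>coset N v. {c + d})" by blast
  qed
qed

lemma coset_act:
  assumes x: "x \<in> carrier kQ" and u: "u \<in> carrier_vec n"
  shows "x \<odot>\<^bsub>LN\<^esub> coset N u = coset N (\<rho> x *\<^sub>v u)"
proof -
  note r = rep_nD(1)[OF \<rho> x]
  have "coset N (\<rho> x *\<^sub>v c) = coset N (\<rho> x *\<^sub>v u)" if c: "c \<in> coset N u" for c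
  proof -
    obtain h where h: "h \<in> N" "c = h + u" using c by (auto simp: coset_def)
    have "\<rho> x *\<^sub>v c = \<rho> x *\<^sub>v h + \<rho> x *\<^sub>v u"
      unfolding h(2) by (rule mult_add_distrib_mat_vec[OF r ND(1)[OF h(1)] u])
    then have "\<rho> x *\<^sub>v c - \<rho> x *\<^sub>v u = \<rho> x *\<^sub>v h"
      using r ND(1)[OF h(1)] u vec_add_diff_cancel[of "\<rho> x *\<^sub>v h" n "\<rho> x *\<^sub>v u"] by simp
    then have "\<rho> x *\<^sub>v c - \<rho> x *\<^sub>v u \<in> N" using ND(4)[OF x h(1)] by simp
    moreover have "c \<in> carrier_vec n" using h ND(1) u by auto
    ultimately show ?thesis using coset_eq_iff r u by simp
  qed
  moreover have "0\<^sub>v n + u \<in> coset N u" unfolding coset_def using ND(2) by (rule imageI)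
  ultimately show ?thesis unfolding subquotient_rep_module by blast
qed

lemma submodule_LN:
  assumes K: "invariant_subspace n \<rho> K" and KL: "N \<subseteq> K" "K \<subseteq> L"
  shows "Module.submodule (coset N ` K) kQ LN"
proof -
  note KD = invariant_subspaceD[OF \<rho> K]
  have inv: "inv\<^bsub>add_monoid LN\<^esub> (coset N u) = coset N ((-1) \<cdot>\<^sub>v u)" if u: "u \<in> L" for u
    unfolding m_inv_def
  proof (rule the_equality)
    note uc = LD(1)[OF u]
    have m: "(-1) \<cdot>\<^sub>v u \<in> L" by (rule LD(5)[OF u])
    have "u + (-1) \<cdot>\<^sub>v u = 0\<^sub>v n" "(-1) \<cdot>\<^sub>v u + u = 0\<^sub>v n" using uc by (auto intro!: eq_vecI)
    then show "coset N ((-1) \<cdot>\<^sub>v u) \<in> carrier (add_monoid LN) \<and>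
      coset N u \<otimes>\<^bsub>add_monoid LN\<^esub> coset N ((-1) \<cdot>\<^sub>v u) = \<one>\<^bsub>add_monoid LN\<^esub> \<and>
      coset N ((-1) \<cdot>\<^sub>v u) \<otimes>\<^bsub>add_monoid LN\<^esub> coset N u = \<one>\<^bsub>add_monoid LN\<^esub>"
      using m uc by (simp add: coset_add coset_zero subquotient_rep_module(1,2))
    fix C assume C: "C \<in> carrier (add_monoid LN) \<and>
      coset N u \<otimes>\<^bsub>add_monoid LN\<^esub> C = \<one>\<^bsub>add_monoid LN\<^esub> \<and> C \<otimes>\<^bsub>add_monoid LN\<^esub> coset N u = \<one>\<^bsub>add_monoid LN\<^esub>"
    then obtain v where v: "v \<in> L" "C = coset N v" by (auto simp: subquotient_rep_module(1))
    note vc = LD(1)[OF v(1)]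
    have "coset N (u + v) = N" using C v uc vc by (simp add: coset_add subquotient_rep_module(2))
    then have "u + v \<in> N" using coset_eq_N uc vc by simp
    moreover have "v - (-1) \<cdot>\<^sub>v u = u + v" using uc vc by (auto intro!: eq_vecI)
    ultimately show "C = coset N ((-1) \<cdot>\<^sub>v u)"
      unfolding v(2) using coset_eq_iff uc vc by simp
  qed
  show ?thesis
  proof (intro Module.submodule.intro subgroup.intro Module.submodule_axioms.intro)
    show "coset N ` K \<subseteq> carrier (add_monoid LN)" using KL by (auto simp: subquotient_rep_module(1))
    show "C \<otimes>\<^bsub>add_monoid LN\<^esub> D \<in> coset N ` K" if CD: "C \<in> coset N ` K" "D \<in> coset N ` K" for C D
    proof -
      obtain u v where "u \<in> K" "C = coset N u" "v \<in> K" "D = coset N v" using CD by auto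
      then show ?thesis using KD(3)[of u v] KD(1) by (simp add: coset_add)
    qed
    show "\<one>\<^bsub>add_monoid LN\<^esub> \<in> coset N ` K"
      using image_eqI[of N "coset N" "0\<^sub>v n" K] coset_zero KD(2) by (simp add: subquotient_rep_module(2))
    show "inv\<^bsub>add_monoid LN\<^esub> C \<in> coset N ` K" if C: "C \<in> coset N ` K" for C
    proof -
      obtain u where u: "u \<in> K" "C = coset N u" using C by auto
      then show ?thesis using inv[of u] KL KD(5)[OF u(1), of "-1"] by auto
    qed
    show "x \<odot>\<^bsub>LN\<^esub> C \<in> coset N ` K" if x: "x \<in> carrier kQ" and C: "C \<in> coset N ` K" for x C
    proof -
      obtain u where u: "u \<in> K" "C = coset N u" using C by auto
      then show ?thesis using coset_act[OF x KD(1)[OF u(1)]] KD(4)[OF x u(1)] by auto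
    qed
  qed
qed

text \<open>Isomorphism of L/N with the vertex simple at \<open>i\<close>, phrased with vectors of
  the ambient space so that bases can be built without cosets: the class of \<open>d\<close> is a
  basis, and the algebra acts on it through the coefficient at the trivial path.\<close>

definition spanned_by :: "'v \<Rightarrow> 'k vec \<Rightarrow> bool" where
  "spanned_by i d \<longleftrightarrow> d \<in> L \<and> d \<notin> N \<and> (\<forall>l\<in>L. \<exists>t. l - t \<cdot>\<^sub>v d \<in> N) \<and>
    (\<forall>x\<in>carrier kQ. \<rho> x *\<^sub>v d - x (i, []) \<cdot>\<^sub>v d \<in> N)"

lemma vertex_simple_module:
  "carrier (rep_module (vertex_simple Q i :: nat \<times> ('v, 'a, 'k) alg_rep)) = carrier_vec 1"
  "u \<oplus>\<^bsub>rep_module (vertex_simple Q i :: nat \<times> ('v, 'a, 'k) alg_rep)\<^esub> v = u + v"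
  "x \<in> carrier kQ \<Longrightarrow> u \<in> carrier_vec 1 \<Longrightarrow>
    x \<odot>\<^bsub>rep_module (vertex_simple Q i :: nat \<times> ('v, 'a, 'k) alg_rep)\<^esub> u = x (i, []) \<cdot>\<^sub>v u"
  by (auto simp: rep_module_def vertex_simple_def scalar_prod_def intro!: eq_vecI)

text \<open>The natural map goes from scalars to cosets of multiples of \<open>d\<close>; the
  required isomorphism starts at the quotient and is its inverse.\<close>

lemma spanned_by_imp_iso:
  assumes d: "spanned_by i d"
  shows "isomorphic_modules kQ LN
    (rep_module (vertex_simple Q i :: nat \<times> ('v, 'a, 'k) alg_rep))"
proof -
  note d' = d[unfolded spanned_by_def]
  have dc: "d \<in> carrier_vec n" using d' LD(1) by blast
  define h where "h v = coset N (v $ 0 \<cdot>\<^sub>v d)" for v :: "'k vec"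
  have bij: "bij_betw h (carrier_vec 1) (carrier LN)"
    unfolding bij_betw_def
  proof
    show "inj_on h (carrier_vec 1)"
    proof (rule inj_onI)
      fix v w :: "'k vec" assume vw: "v \<in> carrier_vec 1" "w \<in> carrier_vec 1" "h v = h w"
      have "v $ 0 \<cdot>\<^sub>v d - w $ 0 \<cdot>\<^sub>v d = (v $ 0 - w $ 0) \<cdot>\<^sub>v d"
        using dc by (auto intro!: eq_vecI simp: algebra_simps)
      then have *: "(v $ 0 - w $ 0) \<cdot>\<^sub>v d \<in> N"
        using vw(3) coset_eq_iff[of "v $ 0 \<cdot>\<^sub>v d" "w $ 0 \<cdot>\<^sub>v d"] dc by (simp add: h_def)
      have "v $ 0 = w $ 0"
      proof (rule ccontr)
        assume ne: "v $ 0 \<noteq> w $ 0"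
        then have "d = (1 / (v $ 0 - w $ 0)) \<cdot>\<^sub>v ((v $ 0 - w $ 0) \<cdot>\<^sub>v d)"
          using dc by (auto intro!: eq_vecI)
        then have "d \<in> N" using ND(5)[OF *] by metis
        then show False using d' by blast
      qed
      then show "v = w" using vw by (auto intro!: eq_vecI)
    qed
    show "h ` carrier_vec 1 = carrier LN"
      unfolding subquotient_rep_module(1)
    proof
      show "h ` carrier_vec 1 \<subseteq> coset N ` L" using d' LD(5) by (auto simp: h_def)
      show "coset N ` L \<subseteq> h ` carrier_vec 1"
      proof (rule image_subsetI)
        fix l assume l: "l \<in> L"
        then obtain t where "l - t \<cdot>\<^sub>v d \<in> N" using d' by blast
        then have "coset N l = h (vec 1 (\<lambda>_. t))" using coset_eq_iff LD(1)[OF l] dc by (simp add: h_def)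
        then show "coset N l \<in> h ` carrier_vec 1" by (intro image_eqI) auto
      qed
    qed
  qed
  define f where "f = the_inv_into (carrier_vec 1) h"
  have f: "bij_betw f (carrier LN) (carrier_vec 1)"
    unfolding f_def by (rule bij_betw_the_inv_into[OF bij])
  have fh: "f (h v) = v" if "v \<in> carrier_vec 1" for v
    unfolding f_def using the_inv_into_f_f[OF bij_betw_imp_inj_on[OF bij] that] .
  have ex: "\<exists>v\<in>carrier_vec 1. C = h v" if "C \<in> carrier LN" for C
    using that bij by (auto simp: bij_betw_def)
  have add: "f (C \<oplus>\<^bsub>LN\<^esub> D) = f C + f D" if C: "C \<in> carrier LN" and D: "D \<in> carrier LN" for C D
  proof -
    obtain v w where vw: "v \<in> carrier_vec 1" "C = h v" "w \<in> carrier_vec 1" "D = h w" using ex C D by metis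
    have "C \<oplus>\<^bsub>LN\<^esub> D = coset N (v $ 0 \<cdot>\<^sub>v d + w $ 0 \<cdot>\<^sub>v d)"
      unfolding vw(2,4) h_def using dc by (intro coset_add) auto
    also have "v $ 0 \<cdot>\<^sub>v d + w $ 0 \<cdot>\<^sub>v d = (v + w) $ 0 \<cdot>\<^sub>v d"
      using dc vw by (auto intro!: eq_vecI simp: algebra_simps)
    finally have "C \<oplus>\<^bsub>LN\<^esub> D = h (v + w)" by (simp add: h_def)
    then show ?thesis using fh vw by simp
  qed
  have act: "f (x \<odot>\<^bsub>LN\<^esub> C) = x (i, []) \<cdot>\<^sub>v f C"
    if x: "x \<in> carrier kQ" and C: "C \<in> carrier LN" for x C
  proof -
    obtain v where v: "v \<in> carrier_vec 1" "C = h v" using ex C by metis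
    note r = rep_nD(1)[OF \<rho> x]
    have "x \<odot>\<^bsub>LN\<^esub> C = coset N (\<rho> x *\<^sub>v (v $ 0 \<cdot>\<^sub>v d))"
      unfolding v(2) h_def using dc by (intro coset_act[OF x]) auto
    also have "\<rho> x *\<^sub>v (v $ 0 \<cdot>\<^sub>v d) = v $ 0 \<cdot>\<^sub>v (\<rho> x *\<^sub>v d)" by (rule mult_mat_vec[OF r dc])
    also have "coset N (v $ 0 \<cdot>\<^sub>v (\<rho> x *\<^sub>v d)) = coset N ((x (i, []) \<cdot>\<^sub>v v) $ 0 \<cdot>\<^sub>v d)"
    proof (subst coset_eq_iff)
      have "v $ 0 \<cdot>\<^sub>v (\<rho> x *\<^sub>v d) - (x (i, []) \<cdot>\<^sub>v v) $ 0 \<cdot>\<^sub>v d = v $ 0 \<cdot>\<^sub>v (\<rho> x *\<^sub>v d - x (i, []) \<cdot>\<^sub>v d)"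
        using dc v r by (auto intro!: eq_vecI simp: algebra_simps)
      then show "v $ 0 \<cdot>\<^sub>v (\<rho> x *\<^sub>v d) - (x (i, []) \<cdot>\<^sub>v v) $ 0 \<cdot>\<^sub>v d \<in> N"
        using ND(5) d' x by simp
    qed (use dc r in auto)
    finally have "x \<odot>\<^bsub>LN\<^esub> C = h (x (i, []) \<cdot>\<^sub>v v)" by (simp add: h_def)
    then show ?thesis using fh v by simp
  qed
  show ?thesis
    unfolding isomorphic_modules_def
    using f add act vertex_simple_module(1,2) vertex_simple_module(3)[OF _ bij_betwE[OF f, rule_format]]
    by (intro exI[of _ f]) (auto simp: vertex_simple_module(1,2))
qed

text \<open>The given bijection is only assumed additive and equivariant; linearity is recovered
  from multiples of the unit of the algebra. Here \<open>i\<close> must be a vertex, for otherwise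
  the unit has coefficient 0 at the trivial path. Then \<open>d\<close> represents the preimage of
  the basis vector.\<close>

lemma iso_imp_spanned_by:
  assumes i: "i \<in> verts Q"
    and iso: "isomorphic_modules kQ LN
      (rep_module (vertex_simple Q i :: nat \<times> ('v, 'a, 'k) alg_rep))"
  shows "\<exists>d. spanned_by i d"
proof -
  obtain f where f: "bij_betw f (carrier LN) (carrier_vec 1)"
    and add: "\<And>C D. C \<in> carrier LN \<Longrightarrow> D \<in> carrier LN \<Longrightarrow> f (C \<oplus>\<^bsub>LN\<^esub> D) = f C + f D"
    and act: "\<And>x C. x \<in> carrier kQ \<Longrightarrow> C \<in> carrier LN \<Longrightarrow>
      f (x \<odot>\<^bsub>LN\<^esub> C) = x \<odot>\<^bsub>rep_module (vertex_simple Q i :: nat \<times> ('v, 'a, 'k) alg_rep)\<^esub> f C"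
    using iso unfolding isomorphic_modules_def vertex_simple_module(1,2) by blast
  have fc: "f (coset N l) \<in> carrier_vec 1" if "l \<in> L" for l
    using bij_betwE[OF f] that by (auto simp: subquotient_rep_module(1))
  have act': "f (coset N (\<rho> x *\<^sub>v l)) = x (i, []) \<cdot>\<^sub>v f (coset N l)"
    if x: "x \<in> carrier kQ" and l: "l \<in> L" for x l
    using act[OF x, of "coset N l"] coset_act[OF x LD(1)[OF l]] vertex_simple_module(3)[OF x fc[OF l]] l
    by (simp add: subquotient_rep_module(1))
  have scal: "f (coset N (c \<cdot>\<^sub>v l)) = c \<cdot>\<^sub>v f (coset N l)" if l: "l \<in> L" for c l
  proof -
    have "(c \<odot>\<^bsub>kQ\<^esub> \<one>\<^bsub>kQ\<^esub>) (i, []) = c"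
      using i by (simp add: smult_path_algebra one_path_algebra)
    then show ?thesis
      using act'[OF carrier_closed(3)[OF carrier_closed(4)] l, of c] scalar_action[OF \<rho> LD(1)[OF l], of c]
      by simp
  qed
  have inj: "u - v \<in> N" if "u \<in> L" "v \<in> L" "f (coset N u) = f (coset N v)" for u v
  proof -
    have "coset N u = coset N v"
      using that f by (auto simp: bij_betw_def inj_on_def subquotient_rep_module(1))
    then show ?thesis using coset_eq_iff LD(1) that by blast
  qed
  have "unit_vec 1 0 \<in> f ` carrier LN" using f by (simp add: bij_betw_def)
  then obtain d where d: "d \<in> L" "f (coset N d) = unit_vec 1 0" by (auto simp: subquotient_rep_module(1))
  have "d \<notin> N"
  proof
    assume "d \<in> N"
    then have "coset N (0 \<cdot>\<^sub>v d) = coset N d"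
      using coset_eq_N[of d] coset_eq_N[of "0 \<cdot>\<^sub>v d"] ND(1,5) by auto
    then have "f (coset N d) = 0 \<cdot>\<^sub>v f (coset N d)" using scal[OF d(1), of 0] by simp
    then have "(unit_vec 1 0 :: 'k vec) $ 0 = (0 \<cdot>\<^sub>v unit_vec 1 0) $ 0" unfolding d(2) by simp
    then show False by simp
  qed
  moreover have "\<exists>t. l - t \<cdot>\<^sub>v d \<in> N" if l: "l \<in> L" for l
  proof -
    have "f (coset N l) = f (coset N (f (coset N l) $ 0 \<cdot>\<^sub>v d))"
      unfolding scal[OF d(1)] d(2) using fc[OF l] by (auto intro!: eq_vecI)
    then show ?thesis using inj[OF l LD(5)[OF d(1)]] by blast
  qed
  moreover have "\<rho> x *\<^sub>v d - x (i, []) \<cdot>\<^sub>v d \<in> N" if x: "x \<in> carrier kQ" for x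
    using act'[OF x d(1)] scal[OF d(1)] by (intro inj[OF LD(4)[OF x d(1)] LD(5)[OF d(1)]]) simp
  ultimately show ?thesis unfolding spanned_by_def using d(1) by blast
qed

text \<open>A nonzero class is a nonzero multiple \<open>t\<close> of the class of \<open>d\<close>,
  and the scalar \<open>s / t\<close> moves it to any other multiple \<open>s\<close>, so it
  generates everything.\<close>

lemma spanned_by_imp_simple:
  assumes d: "spanned_by i d"
  shows "simple_module kQ LN"
proof -
  note d' = d[unfolded spanned_by_def]
  have dc: "d \<in> carrier_vec n" using d' LD(1) by blast
  show ?thesis
    unfolding simple_module_def
  proof (intro conjI allI impI)
    have "coset N d \<in> carrier LN" "coset N d \<noteq> N"
      using d' coset_eq_N[OF dc] by (auto simp: subquotient_rep_module(1))
    then show "carrier LN \<noteq> {\<zero>\<^bsub>LN\<^esub>}" by (auto simp: subquotient_rep_module(2))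
    fix K assume "Module.submodule K kQ LN"
    then interpret K: Module.submodule K kQ LN .
    have sub: "K \<subseteq> coset N ` L" and NK: "N \<in> K"
      using K.subset K.one_closed by (auto simp: subquotient_rep_module(1,2))
    have "K = carrier LN" if ne: "K \<noteq> {N}"
    proof -
      obtain C where C: "C \<in> K" "C \<noteq> N" using ne NK by blast
      then obtain l where l: "l \<in> L" "C = coset N l" using sub by blast
      obtain t where t: "l - t \<cdot>\<^sub>v d \<in> N" using d' l by blast
      note lc = LD(1)[OF l(1)]
      have t0: "t \<noteq> 0"
      proof
        assume "t = 0"
        moreover have "l - 0 \<cdot>\<^sub>v d = l" using lc dc by (auto intro!: eq_vecI)
        ultimately have "l \<in> N" using t by simp
        then show False using C l coset_eq_N[OF lc] by simp
      qed
      have "coset N ` L \<subseteq> K"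
      proof (rule image_subsetI)
        fix m assume m: "m \<in> L"
        then obtain s where s: "m - s \<cdot>\<^sub>v d \<in> N" using d' by blast
        note mc = LD(1)[OF m]
        let ?x = "(s / t) \<odot>\<^bsub>kQ\<^esub> \<one>\<^bsub>kQ\<^esub> :: ('v, 'a, 'k) path_alg"
        have x: "?x \<in> carrier kQ" by (rule carrier_closed(3)[OF carrier_closed(4)])
        have "?x \<odot>\<^bsub>LN\<^esub> C = coset N ((s / t) \<cdot>\<^sub>v l)"
          unfolding l(2) coset_act[OF x lc] scalar_action[OF \<rho> lc] ..
        also have "\<dots> = coset N m"
        proof (subst coset_eq_iff)
          have "(s / t) \<cdot>\<^sub>v l - m = (s / t) \<cdot>\<^sub>v (l - t \<cdot>\<^sub>v d) - (m - s \<cdot>\<^sub>v d)"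
            using lc mc dc t0 by (auto intro!: eq_vecI simp: field_simps)
          then show "(s / t) \<cdot>\<^sub>v l - m \<in> N" using ND(6)[OF ND(5)[OF t] s] by simp
        qed (use lc mc in auto)
        finally show "coset N m \<in> K" using K.smult_closed[OF x C(1)] by simp
      qed
      then show ?thesis using sub by (auto simp: subquotient_rep_module(1))
    qed
    then show "K = {\<zero>\<^bsub>LN\<^esub>} \<or> K = carrier LN" by (auto simp: subquotient_rep_module(2))
  qed
qed

text \<open>Expansion along the basis of paths. Only paths in the support are tested, so an element
  from which one path has been cancelled may be used even if that path keeps \<open>u\<close>
  outside \<open>N\<close>.\<close>

lemma act_in_N:
  assumes u: "u \<in> carrier_vec n" and x: "x \<in> carrier kQ"
    and P: "\<And>P. P \<in> paths Q \<Longrightarrow> x P \<noteq> 0 \<Longrightarrow> \<rho> (path_elem P) *\<^sub>v u \<in> N"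
  shows "\<rho> x *\<^sub>v u \<in> N"
proof -
  have *: "\<rho> (\<lambda>r. if r \<in> S then x r else 0) *\<^sub>v u \<in> N" if "finite S" "S \<subseteq> paths Q" for S
    using that
  proof (induction S)
    case empty
    have "0\<^sub>m n n *\<^sub>v u = 0\<^sub>v n" using u by (auto intro!: eq_vecI)
    then show ?case using rep_n_zero[OF \<rho>] ND(2) by simp
  next
    case (insert p S)
    have p: "p \<in> paths Q" using insert by auto
    let ?z = "\<lambda>r. if r \<in> S then x r else 0"
    have c: "?z \<in> carrier kQ" using insert by (auto simp: carrier_path_algebra)
    note rp = rep_nD(1)[OF \<rho> path_elem_carrier[OF p]]
    have "\<rho> (\<lambda>r. if r \<in> insert p S then x r else 0) *\<^sub>v u = x p \<cdot>\<^sub>v (\<rho> (path_elem p) *\<^sub>v u) + \<rho> ?z *\<^sub>v u"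
      unfolding rep_n_insert[OF \<rho> insert.prems insert.hyps(2)]
      using add_mult_distrib_mat_vec[OF smult_carrier_mat[OF rp] rep_nD(1)[OF \<rho> c] u]
        smult_mat_vec[of u "\<rho> (path_elem p)"] rp u by simp
    moreover have "x p \<cdot>\<^sub>v (\<rho> (path_elem p) *\<^sub>v u) \<in> N"
    proof (cases "x p = 0")
      case True
      have "0 \<cdot>\<^sub>v (\<rho> (path_elem p) *\<^sub>v u) = 0\<^sub>v n" using rp u by (auto intro!: eq_vecI)
      then show ?thesis using True ND(2) by simp
    next
      case False
      then show ?thesis using ND(5)[OF P[OF p]] by blast
    qed
    ultimately show ?case using insert ND(3) by simp
  qed
  have "(\<lambda>r. if r \<in> paths Q then x r else 0) = x"
    using x by (auto simp: carrier_path_algebra)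
  then show ?thesis using *[OF finite_paths] by simp
qed

text \<open>
  Take \<open>c\<close> outside \<open>N\<close> and a longest path \<open>P\<close> that does not move \<open>c\<close> into \<open>N\<close>, which exists since
  there are finitely many paths. Modulo \<open>N\<close> all arrows kill \<open>d = P c\<close>, so that \<open>d\<close> spans a
  submodule isomorphic to the simple at the end of \<open>P\<close>.
\<close>

lemma simple_imp_spanned_by:
  assumes ne: "N \<noteq> L" and simple: "simple_module kQ LN"
  shows "\<exists>i\<in>verts Q. \<exists>d. spanned_by i d"
proof -
  obtain c where c: "c \<in> L" "c \<notin> N" using ne NL by blast
  note cc = LD(1)[OF c(1)]
  define S where "S = {P \<in> paths Q. \<rho> (path_elem P) *\<^sub>v c \<notin> N}"
  have finS: "finite S" unfolding S_def using finite_paths by simp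
  \<comment> \<open>The unit fixes \<open>c\<close> and is a sum of trivial paths, so one of these
    does not move \<open>c\<close> into \<open>N\<close>.\<close>
  have "S \<noteq> {}"
  proof
    assume "S = {}"
    then have "\<rho> \<one>\<^bsub>kQ\<^esub> *\<^sub>v c \<in> N" by (intro act_in_N[OF cc carrier_closed(4)]) (auto simp: S_def)
    then show False using c cc rep_nD(5)[OF \<rho>] by simp
  qed
  then obtain P where P: "P \<in> S" and Max: "Max ((\<lambda>P. length (snd P)) ` S) = length (snd P)"
    using obtains_MAX[OF finS, of "\<lambda>P. length (snd P)"] by blast
  have max: "length (snd P') \<le> length (snd P)" if "P' \<in> S" for P'
    unfolding Max[symmetric] using finS that by (intro Max_ge) auto
  have Pp: "P \<in> paths Q" using P by (simp add: S_def)
  define i where "i = path_end Q P"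
  define d where "d = \<rho> (path_elem P) *\<^sub>v c"
  have i: "i \<in> verts Q" unfolding i_def by (rule path_verts(2)[OF Pp])
  have ip: "(i, []) \<in> paths Q" using trivial_path i by blast
  have d: "d \<in> L" "d \<notin> N" using P LD(4)[OF path_elem_carrier[OF Pp] c(1)] by (auto simp: d_def S_def)
  note dc = LD(1)[OF d(1)]
  have comp: "\<rho> (path_elem P') *\<^sub>v d = \<rho> (path_elem P' \<otimes>\<^bsub>kQ\<^esub> path_elem P) *\<^sub>v c" if P': "P' \<in> paths Q" for P'
    unfolding d_def rep_nD(2)[OF \<rho> path_elem_carrier[OF P'] path_elem_carrier[OF Pp]]
    by (rule assoc_mult_mat_vec[symmetric, OF rep_nD(1)[OF \<rho> path_elem_carrier[OF P']]
        rep_nD(1)[OF \<rho> path_elem_carrier[OF Pp]] cc])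
  have ed: "\<rho> (path_elem (i, [])) *\<^sub>v d = d"
    unfolding comp[OF ip] by (simp add: mult_path_elem[OF ip Pp] i_def[symmetric] d_def)
  have kill: "\<rho> (path_elem P') *\<^sub>v d \<in> N" if P': "P' \<in> paths Q" "P' \<noteq> (i, [])" for P'
  proof (cases "path_end Q P = fst P'")
    case False
    then have "\<rho> (path_elem P') *\<^sub>v d = 0\<^sub>m n n *\<^sub>v c"
      unfolding comp[OF P'(1)] mult_path_elem[OF P'(1) Pp] using rep_n_zero[OF \<rho>] by simp
    also have "\<dots> = 0\<^sub>v n" using cc by (auto intro!: eq_vecI)
    finally show ?thesis using ND(2) by simp
  next
    case True
    then have "snd P' \<noteq> []" using P'(2) by (cases P') (auto simp: i_def)
    then have "path_comp P' P \<notin> S" using max[of "path_comp P' P"] by auto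
    then show ?thesis
      unfolding comp[OF P'(1)] mult_path_elem[OF P'(1) Pp]
      using True path_compI(1)[OF P'(1) Pp True] by (simp add: S_def)
  qed
  have act: "\<rho> x *\<^sub>v d - x (i, []) \<cdot>\<^sub>v d \<in> N" if x: "x \<in> carrier kQ" for x
  proof -
    \<comment> \<open>Subtracting the trivial path at \<open>i\<close> with its coefficient leaves
      an element supported on paths that move \<open>d\<close> into \<open>N\<close>, while the
      subtracted part acts on \<open>d\<close> by that coefficient.\<close>
    let ?y = "\<lambda>r. - x (i, []) * path_elem (i, []) r"
    let ?z = "\<lambda>r. x r + ?y r"
    have y: "?y \<in> carrier kQ"
      using path_elem_carrier[OF ip] by (auto simp: carrier_path_algebra)
    have z: "?z \<in> carrier kQ" using carrier_closed(2)[OF x y] by (simp add: add_path_algebra)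
    note re = rep_nD(1)[OF \<rho> path_elem_carrier[OF ip]] and rx = rep_nD(1)[OF \<rho> x]
    have "\<rho> ?z *\<^sub>v d \<in> N"
    proof (rule act_in_N[OF dc z])
      fix P' assume "P' \<in> paths Q" "?z P' \<noteq> 0"
      then show "\<rho> (path_elem P') *\<^sub>v d \<in> N" using kill by (cases "P' = (i, [])") (auto simp: path_elem_def)
    qed
    also have "\<rho> ?z = \<rho> x + (- x (i, [])) \<cdot>\<^sub>m \<rho> (path_elem (i, []))"
      unfolding rep_nD(3)[OF \<rho> x y] rep_nD(4)[OF \<rho> path_elem_carrier[OF ip]] ..
    also have "(\<rho> x + (- x (i, [])) \<cdot>\<^sub>m \<rho> (path_elem (i, []))) *\<^sub>v d = \<rho> x *\<^sub>v d + (- x (i, [])) \<cdot>\<^sub>v d"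
      using add_mult_distrib_mat_vec[OF rx smult_carrier_mat[OF re] dc] smult_mat_vec[of d "\<rho> (path_elem (i, []))"] re dc ed by simp
    also have "\<dots> = \<rho> x *\<^sub>v d - x (i, []) \<cdot>\<^sub>v d" using rx dc by (auto intro!: eq_vecI)
    finally show ?thesis .
  qed
  \<comment> \<open>The sum of \<open>N\<close> and the line through \<open>d\<close>; it is
    invariant by \<open>act\<close>, so by simplicity it has the same image in the quotient as
    \<open>L\<close>.\<close>
  define K where "K = {u \<in> carrier_vec n. \<exists>t. u - t \<cdot>\<^sub>v d \<in> N}"
  have NK: "N \<subseteq> K"
  proof
    fix u assume u: "u \<in> N"
    have "u - 0 \<cdot>\<^sub>v d = u" using ND(1)[OF u] dc by (auto intro!: eq_vecI)
    then have "u - 0 \<cdot>\<^sub>v d \<in> N" using u by simp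
    then show "u \<in> K" unfolding K_def using ND(1)[OF u] by blast
  qed
  have KL: "K \<subseteq> L"
  proof
    fix u assume "u \<in> K"
    then obtain t where u: "u \<in> carrier_vec n" "u - t \<cdot>\<^sub>v d \<in> N" unfolding K_def by blast
    have "u = (u - t \<cdot>\<^sub>v d) + t \<cdot>\<^sub>v d" using u dc by (auto intro!: eq_vecI)
    moreover have "(u - t \<cdot>\<^sub>v d) + t \<cdot>\<^sub>v d \<in> L" using LD(3)[OF _ LD(5)[OF d(1)]] u(2) NL by blast
    ultimately show "u \<in> L" by simp
  qed
  have K: "invariant_subspace n \<rho> K"
    unfolding invariant_subspace_def
  proof (intro conjI ballI)
    show "K \<subseteq> carrier_vec n" by (auto simp: K_def)
    show "0\<^sub>v n \<in> K" using NK ND(2) by blast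
    fix u assume "u \<in> K"
    then obtain t where u: "u \<in> carrier_vec n" "u - t \<cdot>\<^sub>v d \<in> N" unfolding K_def by blast
    show "u + v \<in> K" if "v \<in> K" for v
    proof -
      obtain s where v: "v \<in> carrier_vec n" "v - s \<cdot>\<^sub>v d \<in> N" using \<open>v \<in> K\<close> unfolding K_def by blast
      have "(u + v) - (t + s) \<cdot>\<^sub>v d = (u - t \<cdot>\<^sub>v d) + (v - s \<cdot>\<^sub>v d)"
        using u v dc by (auto intro!: eq_vecI simp: algebra_simps)
      then have "(u + v) - (t + s) \<cdot>\<^sub>v d \<in> N" using ND(3)[OF u(2) v(2)] by simp
      then show ?thesis unfolding K_def using u(1) v(1) by auto
    qed
    show "\<rho> x *\<^sub>v u \<in> K" if x: "x \<in> carrier kQ" for x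
    proof -
      note r = rep_nD(1)[OF \<rho> x]
      have "\<rho> x *\<^sub>v (u - t \<cdot>\<^sub>v d) = \<rho> x *\<^sub>v u - t \<cdot>\<^sub>v (\<rho> x *\<^sub>v d)"
        using mult_minus_distrib_mat_vec[OF r u(1), of "t \<cdot>\<^sub>v d"] mult_mat_vec[OF r dc] dc by simp
      then have "\<rho> x *\<^sub>v u - (t * x (i, [])) \<cdot>\<^sub>v d = \<rho> x *\<^sub>v (u - t \<cdot>\<^sub>v d) + t \<cdot>\<^sub>v (\<rho> x *\<^sub>v d - x (i, []) \<cdot>\<^sub>v d)"
        using r u(1) dc by (auto intro!: eq_vecI simp: algebra_simps)
      moreover have "\<dots> \<in> N" using ND(3)[OF ND(4)[OF x u(2)] ND(5)[OF act[OF x]]] .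
      ultimately have "\<rho> x *\<^sub>v u - (t * x (i, [])) \<cdot>\<^sub>v d \<in> N" by simp
      then show ?thesis unfolding K_def using r u(1) by auto
    qed
  qed
  have dK: "d \<in> K"
  proof -
    have "d - 1 \<cdot>\<^sub>v d = 0\<^sub>v n" using dc by (auto intro!: eq_vecI)
    then have "d - 1 \<cdot>\<^sub>v d \<in> N" using ND(2) by simp
    then show ?thesis unfolding K_def using dc by blast
  qed
  have "coset N ` K \<noteq> {N}" using dK coset_eq_N[OF dc] d(2) by auto
  then have eq: "coset N ` K = coset N ` L"
    using simple submodule_LN[OF K NK KL] unfolding simple_module_def subquotient_rep_module(1,2) by blast
  have "\<exists>t. l - t \<cdot>\<^sub>v d \<in> N" if l: "l \<in> L" for l
  proof -
    obtain u where u: "u \<in> K" "coset N l = coset N u" using eq l by blast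
    obtain t where t: "u \<in> carrier_vec n" "u - t \<cdot>\<^sub>v d \<in> N" using u(1) unfolding K_def by blast
    have "l - u \<in> N" using u(2) coset_eq_iff LD(1)[OF l] t(1) by blast
    moreover have "l - t \<cdot>\<^sub>v d = (l - u) + (u - t \<cdot>\<^sub>v d)"
      using t(1) LD(1)[OF l] dc by (auto intro!: eq_vecI)
    ultimately show ?thesis using ND(3) t(2) by metis
  qed
  then show ?thesis using i d act unfolding spanned_by_def by blast
qed

end

subsection \<open>Jordan--Hoelder filtrations\<close>

text \<open>If \<open>n < m\<close>, pad \<open>A\<close> with zero rows and \<open>B\<close> with
  zero columns to square matrices of size \<open>m\<close>. The product is still the identity, hence
  so is the product in the other order, although its entry at \<open>(n, n)\<close>
  vanishes.\<close>

lemma left_inverse_dim_le: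
  fixes A B :: "'k::field mat"
  assumes A: "A \<in> carrier_mat n m" and B: "B \<in> carrier_mat m n" and BA: "B * A = 1\<^sub>m m"
  shows "m \<le> n"
proof (rule ccontr)
  assume "\<not> m \<le> n"
  then have nm: "n < m" by simp
  define A' where "A' = mat m m (\<lambda>(i, j). if i < n then A $$ (i, j) else 0)"
  define B' where "B' = mat m m (\<lambda>(i, j). if j < n then B $$ (i, j) else 0)"
  have "B' * A' = B * A"
  proof (rule eq_matI)
    fix i j assume "i < dim_row (B * A)" "j < dim_col (B * A)"
    then have ij: "i < m" "j < m" using A B by auto
    have "(B' * A') $$ (i, j) = (\<Sum>k<m. if k < n then B $$ (i, k) * A $$ (k, j) else 0)"
      using ij by (auto simp: A'_def B'_def scalar_prod_def atLeast0LessThan intro!: sum.cong)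
    also have "\<dots> = (\<Sum>k<n. B $$ (i, k) * A $$ (k, j))"
      using nm by (intro sum.mono_neutral_cong_right) auto
    also have "\<dots> = (B * A) $$ (i, j)" using ij A B by (simp add: scalar_prod_def atLeast0LessThan)
    finally show "(B' * A') $$ (i, j) = (B * A) $$ (i, j)" .
  qed (use A B in \<open>auto simp: A'_def B'_def\<close>)
  moreover have c: "A' \<in> carrier_mat m m" "B' \<in> carrier_mat m m" by (auto simp: A'_def B'_def)
  ultimately have "A' * B' = 1\<^sub>m m"
    using mat_mult_left_right_inverse[of B' m A'] BA by simp
  then have "(A' * B') $$ (n, n) = 1" using nm by simp
  moreover have "(A' * B') $$ (n, n) = 0"
    using nm by (auto simp: A'_def B'_def scalar_prod_def intro!: sum.neutral)
  ultimately show False by simp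
qed

text \<open>The condition on coordinates for a vector to lie in the span of the first
  \<open>j\<close> basis vectors.\<close>

definition vanishes_from :: "nat \<Rightarrow> 'k::field vec \<Rightarrow> bool" where
  "vanishes_from j y \<longleftrightarrow> (\<forall>i. j \<le> i \<longrightarrow> i < dim_vec y \<longrightarrow> y $ i = 0)"

context acyclic_fin_digraph
begin

lemma has_simple_factor_iff:
  fixes \<rho> :: "('v, 'a, 'k::field) alg_rep"
  shows "has_simple_factor Q (n, \<rho>) F j i \<longleftrightarrow>
    isomorphic_modules kQ
      (subquotient (rep_module (n, \<rho>)) (F j) (F (j - 1))) (rep_module (vertex_simple Q i :: nat \<times> ('v, 'a, 'k) alg_rep))"
  by (simp add: has_simple_factor_def)

text \<open>The filtration consists of the spans of the first columns of \<open>g\<close>.\<close>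

lemma word_basis_imp_filtration:
  fixes \<rho> :: "('v, 'a, 'k::field) alg_rep"
  assumes basis: "has_word_basis w n \<rho>"
  shows "\<exists>F. jh_filtration kQ (rep_module (n, \<rho>)) n F \<and>
    (\<forall>j\<in>{1..n}. has_simple_factor Q (n, \<rho>) F j (w ! (j - 1)))"
proof -
  obtain g \<sigma> where \<rho>: "\<rho> \<in> rep_n Q n" and n: "n = length w" and g: "g \<in> GL TYPE('k) n"
    and \<sigma>: "\<sigma> \<in> rep_n Q n" and tri: "triangular_alg_rep w \<sigma>" and conj: "\<rho> = conj_rep n g \<sigma>"
    using basis unfolding has_word_basis_def by blast
  let ?h = "GL_inv n g"
  note gc = GL_carrier[OF g] and hc = GL_inv_carrier[OF g]
  have gh: "g *\<^sub>v (?h *\<^sub>v u) = u" and hg: "?h *\<^sub>v (g *\<^sub>v u) = u" if "u \<in> carrier_vec n" for u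
    using that gc hc GL_inv_left[OF g] GL_inv_right[OF g]
      assoc_mult_mat_vec[OF gc hc that] assoc_mult_mat_vec[OF hc gc that] by simp_all
  have h\<rho>: "?h *\<^sub>v (\<rho> x *\<^sub>v u) = \<sigma> x *\<^sub>v (?h *\<^sub>v u)"
    if x: "x \<in> carrier kQ" and u: "u \<in> carrier_vec n" for x u
  proof -
    note s = rep_nD(1)[OF \<sigma> x]
    have "\<rho> x *\<^sub>v u = g *\<^sub>v (\<sigma> x *\<^sub>v (?h *\<^sub>v u))"
      using x u s carrier_matD[OF gc] carrier_matD[OF hc] carrier_matD[OF s]
      by (simp add: conj conj_rep_def mat_vec_assoc mat_assoc)
    then show ?thesis using hg s hc u by simp
  qed
  have tri1: "\<sigma> x $$ (i, i) = x (w ! i, [])" and tri2: "j < i \<Longrightarrow> \<sigma> x $$ (i, j) = 0"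
    if "x \<in> carrier kQ" "i < n" for x i j
    using tri that n unfolding triangular_alg_rep_def by auto
  \<comment> \<open>The span is described by vanishing coordinates with respect to the columns of
    \<open>g\<close>, which makes membership an entrywise condition.\<close>
  define F where "F j = {u \<in> carrier_vec n. vanishes_from j (?h *\<^sub>v u)}" for j
  have F_iff: "u \<in> F j \<longleftrightarrow> u \<in> carrier_vec n \<and> (\<forall>i. j \<le> i \<longrightarrow> i < n \<longrightarrow> (?h *\<^sub>v u) $ i = 0)" for u j
    using hc by (auto simp: F_def vanishes_from_def)
  have inv: "invariant_subspace n \<rho> (F j)" for j
    unfolding invariant_subspace_def
  proof (intro conjI ballI)
    show "F j \<subseteq> carrier_vec n" by (auto simp: F_def)
    have "?h *\<^sub>v 0\<^sub>v n = 0\<^sub>v n" using mult_mat_zero_vec[of ?h n] hc by simp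
    then show "0\<^sub>v n \<in> F j" by (simp add: F_iff)
    fix u assume u: "u \<in> F j"
    then have uc: "u \<in> carrier_vec n" by (simp add: F_iff)
    show "u + v \<in> F j" if "v \<in> F j" for v
      using u that mult_add_distrib_mat_vec[OF hc, of u v] hc by (simp add: F_iff del: index_mult_mat_vec)
    show "\<rho> x *\<^sub>v u \<in> F j" if x: "x \<in> carrier kQ" for x
    proof -
      note s = rep_nD(1)[OF \<sigma> x]
      have "(\<sigma> x *\<^sub>v (?h *\<^sub>v u)) $ i = 0" if i: "j \<le> i" "i < n" for i
      proof -
        \<comment> \<open>Below the diagonal the matrix entry vanishes; otherwise \<open>k\<close>
          is at least \<open>i\<close>, hence at least \<open>j\<close>, and the coordinate
          vanishes.\<close>
        have "\<sigma> x $$ (i, k) * (?h *\<^sub>v u) $ k = 0" if k: "k < n" for k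
          using tri2[OF x i(2), of k] u i k by (cases "k < i") (auto simp: F_iff simp del: index_mult_mat_vec)
        then have "(\<Sum>k<n. \<sigma> x $$ (i, k) * (?h *\<^sub>v u) $ k) = 0" by (intro sum.neutral) blast
        moreover have "(\<sigma> x *\<^sub>v (?h *\<^sub>v u)) $ i = (\<Sum>k<n. \<sigma> x $$ (i, k) * (?h *\<^sub>v u) $ k)"
          using s hc i by (simp add: scalar_prod_def[of "row (\<sigma> x) i"] atLeast0LessThan)
        ultimately show ?thesis by simp
      qed
      then show ?thesis using h\<rho>[OF x uc] rep_nD(1)[OF \<rho> x] uc by (simp add: F_iff)
    qed
  qed
  have mono: "F j \<subseteq> F (Suc j)" for j by (auto simp: F_iff)
  have span: "invariant_pair.spanned_by Q \<rho> (F (Suc j)) (F j) (w ! j) (g *\<^sub>v unit_vec n j)" if j: "j < n" for j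
  proof -
    interpret P: invariant_pair Q n \<rho> "F (Suc j)" "F j"
      by unfold_locales (use \<rho> inv mono in auto)
    let ?d = "g *\<^sub>v unit_vec n j"
    have dc: "?d \<in> carrier_vec n" using gc by simp
    have hd: "?h *\<^sub>v ?d = unit_vec n j" by (rule hg) simp
    have hdiff: "?h *\<^sub>v (u - t \<cdot>\<^sub>v ?d) = ?h *\<^sub>v u - t \<cdot>\<^sub>v unit_vec n j" if "u \<in> carrier_vec n" for u t
      using mult_minus_distrib_mat_vec[OF hc that, of "t \<cdot>\<^sub>v ?d"] mult_mat_vec[OF hc dc] dc hd by simp
    show ?thesis
      unfolding P.spanned_by_def
    proof (intro conjI ballI)
      show "?d \<in> F (Suc j)" using dc hd by (simp add: F_iff)
      show "?d \<notin> F j" using hd j by (auto simp: F_iff)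
      show "\<exists>t. l - t \<cdot>\<^sub>v ?d \<in> F j" if l: "l \<in> F (Suc j)" for l
      proof (rule exI[of _ "(?h *\<^sub>v l) $ j"])
        have lc: "l \<in> carrier_vec n" using l by (simp add: F_iff)
        have "(?h *\<^sub>v l - (?h *\<^sub>v l) $ j \<cdot>\<^sub>v unit_vec n j) $ i = 0" if "j \<le> i" "i < n" for i
          using l that hc by (cases "i = j") (auto simp: F_iff simp del: index_mult_mat_vec)
        moreover have "l - (?h *\<^sub>v l) $ j \<cdot>\<^sub>v ?d \<in> carrier_vec n"
          by (rule minus_carrier_vec[OF lc smult_carrier_vec[THEN iffD2, OF dc]])
        ultimately show "l - (?h *\<^sub>v l) $ j \<cdot>\<^sub>v ?d \<in> F j" unfolding F_iff hdiff[OF lc] by blast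
      qed
      show "\<rho> x *\<^sub>v ?d - x (w ! j, []) \<cdot>\<^sub>v ?d \<in> F j" if x: "x \<in> carrier kQ" for x
      proof -
        note s = rep_nD(1)[OF \<sigma> x]
        have rc: "\<rho> x *\<^sub>v ?d \<in> carrier_vec n" using rep_nD(1)[OF \<rho> x] dc by simp
        \<comment> \<open>Modulo the span of the earlier vectors only the diagonal entry of this
          column survives, and that is the coefficient at the letter.\<close>
        have h: "?h *\<^sub>v (\<rho> x *\<^sub>v ?d) = col (\<sigma> x) j"
          unfolding h\<rho>[OF x dc] hd using s j by (auto intro!: eq_vecI simp: scalar_prod_right_unit)
        have "(col (\<sigma> x) j - x (w ! j, []) \<cdot>\<^sub>v unit_vec n j) $ i = 0" if "j \<le> i" "i < n" for i
          using s that j tri1[OF x j] tri2[OF x that(2), of j] by (cases "i = j") auto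
        moreover have "\<rho> x *\<^sub>v ?d - x (w ! j, []) \<cdot>\<^sub>v ?d \<in> carrier_vec n"
          by (rule minus_carrier_vec[OF rc smult_carrier_vec[THEN iffD2, OF dc]])
        ultimately show ?thesis unfolding F_iff hdiff[OF rc] h by blast
      qed
    qed
  qed
  have F0: "F 0 = {0\<^sub>v n}"
  proof
    show "F 0 \<subseteq> {0\<^sub>v n}"
    proof
      fix u assume u: "u \<in> F 0"
      then have "?h *\<^sub>v u = 0\<^sub>v n" using hc by (intro eq_vecI) (auto simp: F_iff simp del: index_mult_mat_vec)
      then have "u = g *\<^sub>v 0\<^sub>v n" using gh[of u] u by (simp add: F_iff)
      then show "u \<in> {0\<^sub>v n}" using mult_mat_zero_vec[of g n] gc by simp
    qed
    show "{0\<^sub>v n} \<subseteq> F 0" using inv[of 0] by (auto simp: invariant_subspace_def)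
  qed
  have Fn: "F n = carrier_vec n" by (auto simp: F_iff)
  have step: "F (j - 1) \<subset> F j \<and>
      simple_module kQ (subquotient (rep_module (n, \<rho>)) (F j) (F (j - 1))) \<and>
      has_simple_factor Q (n, \<rho>) F j (w ! (j - 1))" if j: "j \<in> {1..n}" for j
  proof -
    have j': "j - 1 < n" "Suc (j - 1) = j" using j by auto
    interpret P: invariant_pair Q n \<rho> "F j" "F (j - 1)"
      by unfold_locales (use \<rho> inv mono[of "j - 1"] j' in auto)
    have sp: "P.spanned_by (w ! (j - 1)) (g *\<^sub>v unit_vec n (j - 1))" using span[OF j'(1)] unfolding j'(2) .
    then show ?thesis
      unfolding has_simple_factor_iff
      using P.spanned_by_imp_simple[OF sp] P.spanned_by_imp_iso[OF sp] P.NL sp[unfolded P.spanned_by_def] by blast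
  qed
  have "jh_filtration kQ (rep_module (n, \<rho>)) n F"
    unfolding jh_filtration_def submodule_rep_module[OF \<rho>]
    using F0 Fn inv step by (simp add: rep_module_def)
  then show ?thesis using step by blast
qed

text \<open>Lifts of generators of the successive quotients form a basis. That the length of the
  filtration equals \<open>n\<close> is not given; the matrix \<open>g\<close> of the lifts is
  therefore rectangular at first, and its square shape follows from its having inverses on both
  sides.\<close>

lemma filtration_imp_word_basis:
  fixes \<rho> :: "('v, 'a, 'k::field) alg_rep"
  assumes \<rho>: "\<rho> \<in> rep_n Q n" and w: "w \<in> lists (verts Q)"
    and jh: "jh_filtration kQ (rep_module (n, \<rho>)) (length w) F"
    and factor: "\<And>j. j \<in> {1..length w} \<Longrightarrow> has_simple_factor Q (n, \<rho>) F j (w ! (j - 1))"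
  shows "has_word_basis w n \<rho>"
proof -
  let ?m = "length w"
  have F0: "F 0 = {0\<^sub>v n}" and Fm: "F ?m = carrier_vec n" and inv: "\<And>j. j \<le> ?m \<Longrightarrow> invariant_subspace n \<rho> (F j)"
    and step: "\<forall>j\<in>{1..?m}. F (j - 1) \<subset> F j"
    using jh unfolding jh_filtration_def submodule_rep_module[OF \<rho>] by (auto simp: rep_module_def)
  have sub: "F j \<subseteq> F (Suc j)" if "j < ?m" for j
    using bspec[OF step, of "Suc j"] that by auto
  note FD = invariant_subspaceD[OF \<rho> inv]
  have wv: "w ! j \<in> verts Q" if "j < ?m" for j using w that by auto
  have "\<exists>d. invariant_pair.spanned_by Q \<rho> (F (Suc j)) (F j) (w ! j) d" if j: "j < ?m" for j
  proof -
    interpret P: invariant_pair Q n \<rho> "F (Suc j)" "F j"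
      by unfold_locales (use \<rho> inv sub j in auto)
    show ?thesis
      by (rule P.iso_imp_spanned_by[OF wv[OF j]])
        (use factor[of "Suc j"] j in \<open>simp add: has_simple_factor_iff\<close>)
  qed
  then obtain d where d: "\<And>j. j < ?m \<Longrightarrow> invariant_pair.spanned_by Q \<rho> (F (Suc j)) (F j) (w ! j) (d j)"
    by metis
  define e where "e v = (path_elem (v, []) :: ('v, 'a, 'k) path_alg)" for v
  have ec: "e v \<in> carrier kQ" if "v \<in> verts Q" for v
    unfolding e_def by (rule path_elem_carrier) (use that trivial_path in blast)
  text \<open>Projecting to the vertex \<open>w ! j\<close> makes the idempotents diagonal.\<close>
  define b where "b j = \<rho> (e (w ! j)) *\<^sub>v d j" for j
  have b: "b j \<in> F (Suc j)" "b j \<notin> F j" "\<And>l. l \<in> F (Suc j) \<Longrightarrow> \<exists>t. l - t \<cdot>\<^sub>v b j \<in> F j"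
    "\<And>x. x \<in> carrier kQ \<Longrightarrow> \<rho> x *\<^sub>v b j - x (w ! j, []) \<cdot>\<^sub>v b j \<in> F j"
    if j: "j < ?m" for j
  proof -
    interpret P: invariant_pair Q n \<rho> "F (Suc j)" "F j"
      by unfold_locales (use \<rho> inv sub j in auto)
    note d' = d[OF j, unfolded P.spanned_by_def]
    note ecj = ec[OF wv[OF j]]
    have dc: "d j \<in> carrier_vec n" using d' P.LD(1) by blast
    \<comment> \<open>The idempotent of the letter acts as the identity on its factor, so
      \<open>b j\<close> and \<open>d j\<close> agree modulo \<open>F j\<close>, and
      \<open>b j\<close> inherits the properties of \<open>d j\<close>.\<close>
    have "e (w ! j) (w ! j, []) = 1" by (simp add: e_def path_elem_def)
    then have "b j - 1 \<cdot>\<^sub>v d j \<in> F j" using d' ecj by (metis b_def)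
    then have bd: "b j - d j \<in> F j" by simp
    show bL: "b j \<in> F (Suc j)" unfolding b_def using d' P.LD(4)[OF ecj] by blast
    note bc = P.LD(1)[OF bL]
    show "b j \<notin> F j"
    proof
      assume "b j \<in> F j"
      then have "b j - (b j - d j) \<in> F j" using P.ND(6) bd by blast
      moreover have "b j - (b j - d j) = d j" using bc dc by (auto intro!: eq_vecI)
      ultimately show False using d' by simp
    qed
    show "\<exists>t. l - t \<cdot>\<^sub>v b j \<in> F j" if l: "l \<in> F (Suc j)" for l
    proof -
      obtain t where t: "l - t \<cdot>\<^sub>v d j \<in> F j" using d' l by blast
      have "l - t \<cdot>\<^sub>v b j = (l - t \<cdot>\<^sub>v d j) - t \<cdot>\<^sub>v (b j - d j)"
        using P.LD(1)[OF l] bc dc by (auto intro!: eq_vecI simp: algebra_simps)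
      then show ?thesis using P.ND(6)[OF t P.ND(5)[OF bd, of t]] by metis
    qed
    show "\<rho> x *\<^sub>v b j - x (w ! j, []) \<cdot>\<^sub>v b j \<in> F j" if x: "x \<in> carrier kQ" for x
    proof -
      note r = rep_nD(1)[OF \<rho> x]
      have "\<rho> x *\<^sub>v (b j - d j) = \<rho> x *\<^sub>v b j - \<rho> x *\<^sub>v d j"
        by (rule mult_minus_distrib_mat_vec[OF r bc dc])
      then have "\<rho> x *\<^sub>v b j - x (w ! j, []) \<cdot>\<^sub>v b j =
          \<rho> x *\<^sub>v (b j - d j) + (\<rho> x *\<^sub>v d j - x (w ! j, []) \<cdot>\<^sub>v d j) - x (w ! j, []) \<cdot>\<^sub>v (b j - d j)"
        using r bc dc by (auto intro!: eq_vecI simp: algebra_simps)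
      moreover have "\<dots> \<in> F j"
        using P.ND(6)[OF P.ND(3)[OF P.ND(4)[OF x bd] bspec[OF d'[THEN conjunct2, THEN conjunct2, THEN conjunct2] x]] P.ND(5)[OF bd]] .
      ultimately show ?thesis by simp
    qed
  qed
  have bc: "b j \<in> carrier_vec n" if "j < ?m" for j using FD(1)[OF _ b(1)[OF that]] that by simp
  \<comment> \<open>Distinct trivial paths are orthogonal idempotents, so the choice of
    \<open>b j\<close> makes every one of them fix it or kill it.\<close>
  have be: "\<rho> (e v) *\<^sub>v b j = (if w ! j = v then b j else 0\<^sub>v n)" if v: "v \<in> verts Q" and j: "j < ?m" for v j
  proof -
    have dc: "d j \<in> carrier_vec n"
    proof -
      interpret P: invariant_pair Q n \<rho> "F (Suc j)" "F j"
        by unfold_locales (use \<rho> inv sub j in auto)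
      show ?thesis using d[OF j, unfolded P.spanned_by_def] P.LD(1) by blast
    qed
    note c = ec[OF v] ec[OF wv[OF j]]
    have p: "(v, []) \<in> paths Q" "(w ! j, []) \<in> paths Q" using v wv[OF j] trivial_path by blast+
    have "\<rho> (e v) *\<^sub>v b j = \<rho> (e v \<otimes>\<^bsub>kQ\<^esub> e (w ! j)) *\<^sub>v d j"
      unfolding b_def rep_nD(2)[OF \<rho> c]
      by (rule assoc_mult_mat_vec[symmetric, OF rep_nD(1)[OF \<rho> c(1)] rep_nD(1)[OF \<rho> c(2)] dc])
    also have "e v \<otimes>\<^bsub>kQ\<^esub> e (w ! j) = (if w ! j = v then e (w ! j) else (\<lambda>r. 0))"
      by (simp add: e_def mult_path_elem[OF p] trivial_path)
    finally show ?thesis using rep_n_zero[OF \<rho>] dc by (auto simp: b_def intro!: eq_vecI)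
  qed
  define g where "g = mat n ?m (\<lambda>(i, j). b j $ i)"
  have gc: "g \<in> carrier_mat n ?m" by (simp add: g_def)
  have gu: "g *\<^sub>v unit_vec ?m j = b j" if "j < ?m" for j
    using that bc[OF that] by (auto intro!: eq_vecI simp: g_def scalar_prod_right_unit)
  \<comment> \<open>Separates the top coordinate; this is the induction step for both
    \<open>inF\<close> and \<open>inj0\<close>.\<close>
  have split: "\<exists>y'\<in>carrier_vec ?m. vanishes_from j y' \<and> y = y' + y $ j \<cdot>\<^sub>v unit_vec ?m j \<and>
      g *\<^sub>v y = g *\<^sub>v y' + y $ j \<cdot>\<^sub>v b j"
    if j: "j < ?m" and y: "y \<in> carrier_vec ?m" "vanishes_from (Suc j) y" for j y
  proof -
    let ?y' = "y - y $ j \<cdot>\<^sub>v unit_vec ?m j"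
    have "vanishes_from j ?y'"
      unfolding vanishes_from_def
    proof (intro allI impI)
      fix i assume "j \<le> i" "i < dim_vec ?y'"
      then show "?y' $ i = 0" using y by (cases "i = j") (auto simp: vanishes_from_def)
    qed
    moreover have eq: "y = ?y' + y $ j \<cdot>\<^sub>v unit_vec ?m j" using y(1) by (auto intro!: eq_vecI)
    moreover have "g *\<^sub>v (?y' + y $ j \<cdot>\<^sub>v unit_vec ?m j) = g *\<^sub>v ?y' + y $ j \<cdot>\<^sub>v b j"
      using y(1) mult_add_distrib_mat_vec[OF gc, of ?y' "y $ j \<cdot>\<^sub>v unit_vec ?m j"]
        mult_mat_vec[OF gc, of "unit_vec ?m j"] gu[OF j] by simp
    ultimately show ?thesis using y(1) by (intro bexI[of _ ?y']) auto
  qed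
  have zero: "y = 0\<^sub>v ?m" if "y \<in> carrier_vec ?m" "vanishes_from 0 y" for y
    using that by (intro eq_vecI) (auto simp: vanishes_from_def)
  have g0: "g *\<^sub>v 0\<^sub>v ?m = 0\<^sub>v n" using mult_mat_zero_vec[of g ?m] gc by simp
  have inF: "g *\<^sub>v y \<in> F j" if "j \<le> ?m" "y \<in> carrier_vec ?m" "vanishes_from j y" for j y
    using that
  proof (induction j arbitrary: y)
    case 0
    show ?case using zero[OF "0.prems"(2,3)] g0 F0 by simp
  next
    case (Suc j)
    then have j: "j < ?m" by simp
    obtain y' where y': "y' \<in> carrier_vec ?m" "vanishes_from j y'" "g *\<^sub>v y = g *\<^sub>v y' + y $ j \<cdot>\<^sub>v b j"
      using split[OF j Suc.prems(2,3)] by blast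
    have "g *\<^sub>v y' \<in> F (Suc j)" using Suc.IH[OF _ y'(1,2)] sub[OF j] j by auto
    then show ?case
      unfolding y'(3) using FD(3)[OF Suc.prems(1)] FD(5)[OF Suc.prems(1) b(1)[OF j]] by blast
  qed
  have ofF: "\<exists>y\<in>carrier_vec ?m. vanishes_from j y \<and> u = g *\<^sub>v y" if "j \<le> ?m" "u \<in> F j" for j u
    using that
  proof (induction j arbitrary: u)
    case 0
    then have "u = g *\<^sub>v 0\<^sub>v ?m" using g0 F0 by simp
    moreover have "vanishes_from 0 (0\<^sub>v ?m :: 'k vec)" by (auto simp: vanishes_from_def)
    ultimately show ?case by (intro bexI[of _ "0\<^sub>v ?m"]) auto
  next
    case (Suc j)
    then have j: "j < ?m" by simp
    obtain t where t: "u - t \<cdot>\<^sub>v b j \<in> F j" using b(3)[OF j Suc.prems(2)] by blast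
    obtain y where y: "y \<in> carrier_vec ?m" "vanishes_from j y" "u - t \<cdot>\<^sub>v b j = g *\<^sub>v y"
      using Suc.IH[OF _ t] j by auto
    have uc: "u \<in> carrier_vec n" by (rule FD(1)[OF Suc.prems])
    have "u = (u - t \<cdot>\<^sub>v b j) + t \<cdot>\<^sub>v b j" using uc bc[OF j] by (auto intro!: eq_vecI)
    also have "\<dots> = g *\<^sub>v (y + t \<cdot>\<^sub>v unit_vec ?m j)"
      unfolding y(3) using mult_add_distrib_mat_vec[OF gc y(1), of "t \<cdot>\<^sub>v unit_vec ?m j"]
        mult_mat_vec[OF gc, of "unit_vec ?m j"] gu[OF j] by simp
    finally have "u = g *\<^sub>v (y + t \<cdot>\<^sub>v unit_vec ?m j)" .
    moreover have "vanishes_from (Suc j) (y + t \<cdot>\<^sub>v unit_vec ?m j)"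
      using y(1,2) by (auto simp: vanishes_from_def)
    ultimately show ?case using y(1) by (intro bexI[of _ "y + t \<cdot>\<^sub>v unit_vec ?m j"]) auto
  qed
  have inj0: "y = 0\<^sub>v ?m" if "j \<le> ?m" "y \<in> carrier_vec ?m" "vanishes_from j y" "g *\<^sub>v y = 0\<^sub>v n" for j y
    using that
  proof (induction j arbitrary: y)
    case 0
    then show ?case using zero by blast
  next
    case (Suc j)
    then have j: "j < ?m" by simp
    obtain y' where y': "y' \<in> carrier_vec ?m" "vanishes_from j y'" "y = y' + y $ j \<cdot>\<^sub>v unit_vec ?m j"
      "g *\<^sub>v y = g *\<^sub>v y' + y $ j \<cdot>\<^sub>v b j"
      using split[OF j Suc.prems(2,3)] by blast
    have gy': "g *\<^sub>v y' \<in> F j" using inF[OF _ y'(1,2)] j by simp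
    have gyc: "g *\<^sub>v y' \<in> carrier_vec n" using gc y'(1) by simp
    have "y $ j = 0"
    proof (rule ccontr)
      assume ne: "y $ j \<noteq> 0"
      \<comment> \<open>A relation with nonzero top coefficient would express \<open>b j\<close>
        through earlier vectors and place it in \<open>F j\<close>.\<close>
      have "b j = (- 1 / y $ j) \<cdot>\<^sub>v (g *\<^sub>v y')"
      proof (rule eq_vecI)
        fix i assume "i < dim_vec ((- 1 / y $ j) \<cdot>\<^sub>v (g *\<^sub>v y'))"
        then have i: "i < n" using gc by simp
        have "(g *\<^sub>v y' + y $ j \<cdot>\<^sub>v b j) $ i = (0\<^sub>v n :: 'k vec) $ i" using y'(4) Suc.prems(4) by simp
        then have "(g *\<^sub>v y') $ i + y $ j * b j $ i = 0"
          using i gyc gc carrier_vecD[OF bc[OF j]] by (simp del: index_mult_mat_vec)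
        then show "b j $ i = ((- 1 / y $ j) \<cdot>\<^sub>v (g *\<^sub>v y')) $ i"
          using i gc ne
          by (simp add: field_simps eq_neg_iff_add_eq_0 del: index_mult_mat_vec)
      qed (use gc bc[OF j] in auto)
      then have "b j \<in> F j" using FD(5)[OF _ gy'] j by auto
      then show False using b(2)[OF j] by blast
    qed
    moreover have "0 \<cdot>\<^sub>v unit_vec ?m j = (0\<^sub>v ?m :: 'k vec)" by (auto intro!: eq_vecI)
    ultimately have yy': "y = y'" using y'(1,3) by simp
    then show ?case using Suc.IH[of y] y' Suc.prems(4) j by simp
  qed
  have vm: "vanishes_from ?m y" if "y \<in> carrier_vec ?m" for y :: "'k vec"
    using that by (auto simp: vanishes_from_def)
  have inj: "y = z" if y: "y \<in> carrier_vec ?m" and z: "z \<in> carrier_vec ?m" and eq: "g *\<^sub>v y = g *\<^sub>v z" for y z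
  proof -
    have "g *\<^sub>v (y - z) = g *\<^sub>v y - g *\<^sub>v z" by (rule mult_minus_distrib_mat_vec[OF gc y z])
    also have "\<dots> = 0\<^sub>v n" unfolding eq using gc z by (auto intro!: eq_vecI)
    finally have "y - z = 0\<^sub>v ?m" using inj0[of ?m "y - z"] vm[of "y - z"] y z by simp
    moreover have "y = (y - z) + z" using y z by (auto intro!: eq_vecI)
    ultimately show ?thesis using z by simp
  qed
  have surj: "\<exists>y\<in>carrier_vec ?m. g *\<^sub>v y = u" if "u \<in> carrier_vec n" for u
    using ofF[of ?m u] that Fm by auto
  obtain h where h: "h \<in> carrier_mat ?m n" "g * h = 1\<^sub>m n"
    using surj_imp_right_inverse[OF gc surj] by blast
  have "h * g = 1\<^sub>m ?m"
  proof (rule mat_eqI_vec)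
    fix y :: "'k vec" assume y: "y \<in> carrier_vec ?m"
    have "g *\<^sub>v (h * g *\<^sub>v y) = (g * h) *\<^sub>v (g *\<^sub>v y)"
      using y carrier_matD[OF gc] carrier_matD[OF h(1)] by (simp add: mat_vec_assoc)
    also have "\<dots> = g *\<^sub>v (1\<^sub>m ?m *\<^sub>v y)" unfolding h(2) using y gc by simp
    finally show "h * g *\<^sub>v y = 1\<^sub>m ?m *\<^sub>v y" using inj y gc h(1) by simp
  qed (use gc h in auto)
  then have nm: "n = ?m"
    using left_inverse_dim_le[OF gc h(1)] left_inverse_dim_le[OF h(1) gc h(2)] by simp
  have G: "g \<in> GL TYPE('k) n" "GL_inv n g = h" using GL_I[of g n h] gc h nm by simp_all
  define \<sigma> where "\<sigma> = conj_rep n h \<rho>"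
  have hGL: "h \<in> GL TYPE('k) n" "GL_inv n h = g" using GL_inv_inv[OF G(1)] unfolding G(2) by auto
  have \<sigma>: "\<sigma> \<in> rep_n Q n" unfolding \<sigma>_def by (rule conj_rep_n[OF \<rho> hGL(1)])
  have \<rho>\<sigma>: "\<rho> = conj_rep n g \<sigma>"
    unfolding \<sigma>_def conj_rep_conj_rep[OF \<rho> G(1) hGL(1)] h(2) conj_rep_one[OF \<rho>] ..
  have hg: "h *\<^sub>v (g *\<^sub>v y) = y" if "y \<in> carrier_vec n" for y
    using that \<open>h * g = 1\<^sub>m ?m\<close> assoc_mult_mat_vec[OF h(1) gc, of y] nm by simp
  have col: "col (\<sigma> x) j = h *\<^sub>v (\<rho> x *\<^sub>v b j)" if x: "x \<in> carrier kQ" and j: "j < n" for x j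
  proof -
    note r = rep_nD(1)[OF \<rho> x] and s = rep_nD(1)[OF \<sigma> x]
    have "\<sigma> x *\<^sub>v unit_vec n j = h *\<^sub>v (\<rho> x *\<^sub>v (g *\<^sub>v unit_vec n j))"
      using x r carrier_matD[OF gc] carrier_matD[OF h(1)] carrier_matD[OF r] nm
      by (simp add: \<sigma>_def conj_rep_def hGL(2)[unfolded nm] mat_assoc mat_vec_assoc)
    moreover have "col (\<sigma> x) j = \<sigma> x *\<^sub>v unit_vec n j"
      using s j by (auto intro!: eq_vecI simp: scalar_prod_right_unit)
    moreover have "g *\<^sub>v unit_vec n j = b j" using gu[of j] j nm by simp
    ultimately show ?thesis by simp
  qed
  have hb: "h *\<^sub>v b j = unit_vec n j" if "j < n" for j
    using hg[of "unit_vec n j"] gu[of j] that nm by simp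
  have "triangular_alg_rep w \<sigma>"
    unfolding triangular_alg_rep_def
  proof (intro conjI ballI allI impI)
    \<comment> \<open>Column \<open>j\<close> holds the coordinates of the image of
      \<open>b j\<close>, which differs from a multiple of \<open>b j\<close> by a vector of
      \<open>F j\<close>, that is, by coordinates vanishing from \<open>j\<close> on.\<close>
    have entry: "\<sigma> x $$ (i, j) = (if i = j then x (w ! j, []) else 0)"
      if x: "x \<in> carrier kQ" and ij: "i < ?m" "j \<le> i" for x i j
    proof -
      have j: "j < ?m" using ij by simp
      note r = rep_nD(1)[OF \<rho> x] and s = rep_nD(1)[OF \<sigma> x]
      obtain y where y: "y \<in> carrier_vec ?m" "vanishes_from j y" "\<rho> x *\<^sub>v b j - x (w ! j, []) \<cdot>\<^sub>v b j = g *\<^sub>v y"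
        using ofF[OF _ b(4)[OF j x]] j by auto
      have "\<rho> x *\<^sub>v b j = g *\<^sub>v y + x (w ! j, []) \<cdot>\<^sub>v b j"
        unfolding y(3)[symmetric] using r bc[OF j] by (auto intro!: eq_vecI)
      then have "col (\<sigma> x) j = h *\<^sub>v (g *\<^sub>v y) + x (w ! j, []) \<cdot>\<^sub>v (h *\<^sub>v b j)"
        using col[OF x] j nm mult_add_distrib_mat_vec[OF h(1), of "g *\<^sub>v y" "x (w ! j, []) \<cdot>\<^sub>v b j"]
          mult_mat_vec[OF h(1) bc[OF j]] gc y(1) bc[OF j] by simp
      then have "col (\<sigma> x) j = y + x (w ! j, []) \<cdot>\<^sub>v unit_vec n j"
        using hg[of y] hb[of j] y(1) j nm by simp
      then have "\<sigma> x $$ (i, j) = (y + x (w ! j, []) \<cdot>\<^sub>v unit_vec n j) $ i"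
        using s ij j nm by (metis carrier_matD index_col)
      then show ?thesis using y(1,2) ij j nm by (auto simp: vanishes_from_def)
    qed
    show "\<sigma> x $$ (i, i) = x (w ! i, [])" if "x \<in> carrier kQ" "i < ?m" for x i
      using entry[OF that(1,2), of i] by simp
    show "\<sigma> x $$ (i, j) = 0" if "x \<in> carrier kQ" "i < ?m" "j < i" for x i j
      using entry[OF that(1,2), of j] that(3) by simp
    show "\<sigma> (path_elem (v, [])) $$ (i, j) = 0" if v: "v \<in> verts Q" and ij: "i < ?m" "j < ?m" "i \<noteq> j" for v i j
    proof -
      note s = rep_nD(1)[OF \<sigma> ec[OF v]]
      have "col (\<sigma> (e v)) j = (if w ! j = v then unit_vec n j else 0\<^sub>v n)"
        using col[OF ec[OF v], of j] be[OF v, of j] hb[of j] ij nm mult_mat_zero_vec[of h n] h(1) by simp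
      then have "col (\<sigma> (e v)) j $ i = 0" using ij nm by simp
      then show ?thesis using s ij nm by (simp add: e_def)
    qed
  qed
  then show ?thesis unfolding has_word_basis_def using \<rho> nm G(1) \<sigma> \<rho>\<sigma> by blast
qed

lemma filtration_factor_exists:
  assumes \<rho>: "\<rho> \<in> rep_n Q n"
    and jh: "jh_filtration kQ (rep_module (n, \<rho>)) m F"
    and j: "j \<in> {1..m}"
  shows "\<exists>i\<in>verts Q. has_simple_factor Q (n, \<rho>) F j i"
proof -
  have F: "invariant_subspace n \<rho> (F j)" "invariant_subspace n \<rho> (F (j - 1))" "F (j - 1) \<subset> F j"
    "simple_module kQ (subquotient (rep_module (n, \<rho>)) (F j) (F (j - 1)))"
    using jh j unfolding jh_filtration_def submodule_rep_module[OF \<rho>] by auto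
  interpret P: invariant_pair Q n \<rho> "F j" "F (j - 1)"
    by unfold_locales (use \<rho> F in auto)
  show ?thesis
    using P.simple_imp_spanned_by[OF _ F(4)] F(3) P.spanned_by_imp_iso unfolding has_simple_factor_iff by blast
qed

lemma filtration_word:
  assumes \<rho>: "\<rho> \<in> rep_n Q n"
    and jh: "jh_filtration kQ (rep_module (n, \<rho>)) m F"
  obtains W where "W \<in> lists (verts Q)" "length W = m"
    "\<And>j. j \<in> {1..m} \<Longrightarrow> has_simple_factor Q (n, \<rho>) F j (W ! (j - 1))"
proof -
  obtain f where f: "\<And>j. j \<in> {1..m} \<Longrightarrow> f j \<in> verts Q \<and> has_simple_factor Q (n, \<rho>) F j (f j)"
    using filtration_factor_exists[OF \<rho> jh] by metis
  show thesis
    by (rule that[of "map (\<lambda>j. f (Suc j)) [0..<m]"]) (use f in auto)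
qed

section \<open>Basic opens in terms of words and adapted bases\<close>

text \<open>The prescribed factors fix the letters of \<open>w\<close>; the factors above them are
  simple, hence vertex simples, and supply \<open>w''\<close>. Conversely, the filtration of an
  adapted basis starts with the factors of \<open>w\<close>.\<close>

lemma left_open_iff:
  fixes \<rho> :: "('v, 'a, 'k::field) alg_rep"
  assumes w: "w \<in> lists (verts Q)"
  shows "(n, \<rho>) \<in> left_open Q w \<longleftrightarrow> (\<exists>w''\<in>lists (verts Q). has_word_basis (w @ w'') n \<rho>)"
proof
  assume "(n, \<rho>) \<in> left_open Q w"
  then obtain m F where \<rho>: "\<rho> \<in> rep_n Q n" and m: "length w \<le> m"
    and jh: "jh_filtration kQ (rep_module (n, \<rho>)) m F"
    and F: "\<forall>j\<in>{1..length w}. has_simple_factor Q (n, \<rho>) F j (w ! (j - 1))"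
    unfolding left_open_def rep_alg_def by blast
  obtain W where W: "W \<in> lists (verts Q)" "length W = m"
    "\<And>j. j \<in> {1..m} \<Longrightarrow> has_simple_factor Q (n, \<rho>) F j (W ! (j - 1))"
    using filtration_word[OF \<rho> jh] by blast
  let ?w'' = "drop (length w) W"
  have l: "length (w @ ?w'') = m" using W(2) m by simp
  have w'': "?w'' \<in> lists (verts Q)" using W(1) by (auto dest: in_set_dropD)
  have "has_word_basis (w @ ?w'') n \<rho>"
  proof (rule filtration_imp_word_basis[OF \<rho> _ jh[folded l]])
    show "w @ ?w'' \<in> lists (verts Q)" using w w'' by simp
    fix j assume j: "j \<in> {1..length (w @ ?w'')}"
    show "has_simple_factor Q (n, \<rho>) F j ((w @ ?w'') ! (j - 1))"
    proof (cases "j \<le> length w")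
      case True
      then have "j - 1 < length w" using j by auto
      then have "(w @ ?w'') ! (j - 1) = w ! (j - 1)" by (simp only: nth_append if_True)
      then show ?thesis using F True j by simp
    next
      case False
      then have "(w @ ?w'') ! (j - 1) = W ! (j - 1)" using j W(2) m by (auto simp: nth_append)
      then show ?thesis using W(3)[of j] j l by simp
    qed
  qed
  then show "\<exists>w''\<in>lists (verts Q). has_word_basis (w @ w'') n \<rho>" using w'' by blast
next
  assume "\<exists>w''\<in>lists (verts Q). has_word_basis (w @ w'') n \<rho>"
  then obtain w'' where b: "has_word_basis (w @ w'') n \<rho>" by blast
  then have n: "n = length w + length w''" and \<rho>: "\<rho> \<in> rep_n Q n" by (auto simp: has_word_basis_def)
  obtain F where F: "jh_filtration kQ (rep_module (n, \<rho>)) n F"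
    "\<forall>j\<in>{1..n}. has_simple_factor Q (n, \<rho>) F j ((w @ w'') ! (j - 1))"
    using word_basis_imp_filtration[OF b] by blast
  have "has_simple_factor Q (n, \<rho>) F j (w ! (j - 1))" if "j \<in> {1..length w}" for j
  proof -
    have "j - 1 < length w" using that by auto
    then have "(w @ w'') ! (j - 1) = w ! (j - 1)" by (simp only: nth_append if_True)
    then show ?thesis using bspec[OF F(2), of j] that n by simp
  qed
  then show "(n, \<rho>) \<in> left_open Q w"
    unfolding left_open_def rep_alg_def using F(1) \<rho> n by (auto intro!: exI[of _ n])
qed

lemma right_open_iff:
  fixes \<rho> :: "('v, 'a, 'k::field) alg_rep"
  assumes w: "w \<in> lists (verts Q)"
  shows "(n, \<rho>) \<in> right_open Q w \<longleftrightarrow> (\<exists>w''\<in>lists (verts Q). has_word_basis (w'' @ w) n \<rho>)"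
proof
  assume "(n, \<rho>) \<in> right_open Q w"
  then obtain m F where \<rho>: "\<rho> \<in> rep_n Q n" and m: "length w \<le> m"
    and jh: "jh_filtration kQ (rep_module (n, \<rho>)) m F"
    and F: "\<forall>j<length w. has_simple_factor Q (n, \<rho>) F (m - j) (w ! (length w - 1 - j))"
    unfolding right_open_def rep_alg_def by blast
  obtain W where W: "W \<in> lists (verts Q)" "length W = m"
    "\<And>j. j \<in> {1..m} \<Longrightarrow> has_simple_factor Q (n, \<rho>) F j (W ! (j - 1))"
    using filtration_word[OF \<rho> jh] by blast
  define w'' where "w'' = take (m - length w) W"
  have l: "length (w'' @ w) = m" and l'': "length w'' = m - length w" using W(2) m by (simp_all add: w''_def)
  have w'': "w'' \<in> lists (verts Q)" using W(1) by (auto simp: w''_def dest: in_set_takeD)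
  have "has_word_basis (w'' @ w) n \<rho>"
  proof (rule filtration_imp_word_basis[OF \<rho>])
    show "jh_filtration kQ (rep_module (n, \<rho>)) (length (w'' @ w)) F"
      unfolding l by (rule jh)
    show "w'' @ w \<in> lists (verts Q)" using w w'' by simp
    fix j assume "j \<in> {1..length (w'' @ w)}"
    then have j: "1 \<le> j" "j \<le> m" using l by auto
    show "has_simple_factor Q (n, \<rho>) F j ((w'' @ w) ! (j - 1))"
    proof (cases "j \<le> m - length w")
      case True
      then have "j - 1 < length w''" "j - 1 < m - length w" using j l'' by auto
      then have "(w'' @ w) ! (j - 1) = W ! (j - 1)" by (simp only: nth_append if_True w''_def nth_take)
      then show ?thesis using W(3)[of j] j by simp
    next
      case False
      \<comment> \<open>The definition counts factors from the top, so step \<open>j\<close> is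
        addressed by its distance \<open>m - j\<close> from the end.\<close>
      then have e: "(w'' @ w) ! (j - 1) = w ! (length w - 1 - (m - j))" "m - j < length w" "m - (m - j) = j"
        using j l'' m by (auto simp: nth_append intro!: arg_cong[of _ _ "nth w"])
      then show ?thesis using F[rule_format, OF e(2)] by simp
    qed
  qed
  then show "\<exists>w''\<in>lists (verts Q). has_word_basis (w'' @ w) n \<rho>" using w'' by blast
next
  assume "\<exists>w''\<in>lists (verts Q). has_word_basis (w'' @ w) n \<rho>"
  then obtain w'' where b: "has_word_basis (w'' @ w) n \<rho>" by blast
  then have n: "n = length w'' + length w" and \<rho>: "\<rho> \<in> rep_n Q n" by (auto simp: has_word_basis_def)
  obtain F where F: "jh_filtration kQ (rep_module (n, \<rho>)) n F"
    "\<forall>j\<in>{1..n}. has_simple_factor Q (n, \<rho>) F j ((w'' @ w) ! (j - 1))"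
    using word_basis_imp_filtration[OF b] by blast
  have "has_simple_factor Q (n, \<rho>) F (n - j) (w ! (length w - 1 - j))" if j: "j < length w" for j
  proof -
    have "n - j - 1 = length w'' + (length w - 1 - j)" using j n by simp
    then have "(w'' @ w) ! (n - j - 1) = w ! (length w - 1 - j)" by (simp only: nth_append_length_plus)
    then show ?thesis using bspec[OF F(2), of "n - j"] j n by simp
  qed
  then show "(n, \<rho>) \<in> right_open Q w"
    unfolding right_open_def rep_alg_def using F(1) \<rho> n by (auto intro!: exI[of _ n])
qed

end

text \<open>A member of the union depends on \<open>y\<close> only through \<open>v y\<close>. With
  \<open>v\<close> the value of a word and \<open>f\<close> the map that joins \<open>w\<close> to a
  word at one end, this turns rewritability in the monoid into literal prefixes or suffixes.\<close>

lemma UN_representatives: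
  assumes "\<And>x. x \<in> A \<Longrightarrow> f x \<in> A"
  shows "(\<exists>x\<in>A. M \<in> B (v (f x))) \<longleftrightarrow> M \<in> (\<Union>y \<in> {y \<in> A. \<exists>x\<in>A. v y = v (f x)}. B (v y))"
proof
  assume "\<exists>x\<in>A. M \<in> B (v (f x))"
  then obtain x where x: "x \<in> A" "M \<in> B (v (f x))" by blast
  then have "f x \<in> {y \<in> A. \<exists>x\<in>A. v y = v (f x)}" using assms by blast
  then show "M \<in> (\<Union>y \<in> {y \<in> A. \<exists>x\<in>A. v y = v (f x)}. B (v y))" using x(2) by (rule UN_I)
next
  assume "M \<in> (\<Union>y \<in> {y \<in> A. \<exists>x\<in>A. v y = v (f x)}. B (v y))"
  then obtain y x where "x \<in> A" "v y = v (f x)" "M \<in> B (v y)" by blast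
  then show "\<exists>x\<in>A. M \<in> B (v (f x))" by auto
qed

theorem proposition1:
  fixes Q :: "('v, 'a) pre_digraph"
    and vs w :: "'v list"
  assumes "fin_digraph Q"
    and "acyclic_quiver Q"
    and "distinct vs" and "set vs = verts Q"
    and "w \<in> lists (verts Q)"
  shows "(left_open Q w :: (nat \<times> ('v, 'a, 'k::alg_closed_field) alg_rep) set) =
      (\<Union>w' \<in> {w' \<in> lists (verts Q). \<exists>w'' \<in> lists (verts Q).
           (word_value Q w' :: ('v, 'a, 'k) monoid_elem) = word_value Q (w @ w'')}.
         assoc_bundle Q vs (word_value Q w')) \<and>
    (right_open Q w :: (nat \<times> ('v, 'a, 'k) alg_rep) set) =
      (\<Union>w' \<in> {w' \<in> lists (verts Q). \<exists>w'' \<in> lists (verts Q).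
           (word_value Q w' :: ('v, 'a, 'k) monoid_elem) = word_value Q (w'' @ w)}.
         assoc_bundle Q vs (word_value Q w'))"
proof -
  interpret acyclic_fin_digraph Q
    by (intro acyclic_fin_digraph.intro acyclic_fin_digraph_axioms.intro assms)
  note basis = assoc_bundle_iff_word_basis[OF assms(3,4), where ?'k = 'k]
  have app: "w @ w'' \<in> lists (verts Q)" "w'' @ w \<in> lists (verts Q)" if "w'' \<in> lists (verts Q)" for w''
    using assms(5) that by simp_all
  note reps = UN_representatives[where A = "lists (verts Q)" and B = "assoc_bundle Q vs"
    and v = "word_value Q :: 'v list \<Rightarrow> ('v, 'a, 'k) monoid_elem"]
  have left: "M \<in> left_open Q w \<longleftrightarrow> (\<exists>w''\<in>lists (verts Q). M \<in> assoc_bundle Q vs (word_value Q (w @ w'')))"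
    and right: "M \<in> right_open Q w \<longleftrightarrow> (\<exists>w''\<in>lists (verts Q). M \<in> assoc_bundle Q vs (word_value Q (w'' @ w)))"
    for M :: "nat \<times> ('v, 'a, 'k) alg_rep"
    by (cases M; simp only: left_open_iff[OF assms(5)] right_open_iff[OF assms(5)] basis app cong: bex_cong)+
  show ?thesis
    by (intro conjI Set.set_eqI)
      (rule trans[OF left reps[where f = "(@) w"]], erule app,
        rule trans[OF right reps[where f = "\<lambda>w''. w'' @ w"]], erule app)
qed

end
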